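(* Let $n=2p$, let $D\subset\mathbb{R}^{4p}$ be a bounded domain with smooth boundary $\partial D$ and let $g$ be a function which is $\mathfrak{osp}(4|2)$-monogenic in an open neighbourhood $\Omega$ of $\overline{D}$. Then for every $\underline{X}\in\overset{\circ}{D}$ the following representation formulae hold: \begin{align*} g(\underline{X}) &= \frac{1}{(-2i)^n}\int_{\partial D}\left(E(\underline{v}-\underline{z})\,d\sigma_{\underline{v}}+E^{\dagger}(\underline{v}-\underline{z})\,d\sigma_{\underline{v}^\dagger}\right)g(\underline{Y}),\\ g(\underline{X}) &= \frac{1}{(-2i)^n}\int_{\partial D}\left(E^J(\underline{v}-\underline{z})\,d\sigma_{\underline{v}^J}+E^{\dagger J}(\underline{v}-\underline{z})\,d\sigma_{\underline{v}^{\dagger J}}\right)g(\underline{Y}), \end{align*} together with the integral identities \begin{align*} 0&=\int_{\partial D}E^{\dagger}(\underline{v}-\underline{z})\,d\sigma_{\underline{v}}\,g(\underline{Y}),\\ 0&=\int_{\partial D}E^{J}(\underline{v}-\underline{z})\,d\sigma_{\underline{v}^{\dagger J}}\,g(\underline{Y}),\\ 0&=\int_{\partial D}\left(\mathcal{E}E(\underline{v}-\underline{z})\,d\sigma_{\underline{v}}+\mathcal{E}E^{\dagger}(\underline{v}-\underline{z})\,d\sigma_{\underline{v}^\dagger}\right)g(\underline{Y}),\\ 0&=\int_{\partial D}\left(\mathcal{E}E^J(\underline{v}-\underline{z})\,d\sigma_{\underline{v}^J}+\mathcal{E}E^{\dagger J}(\underline{v}-\underline{z})\,d\sigma_{\underline{v}^{\dagger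 J}}\right)g(\underline{Y}), \end{align*} where $\mathcal{E}$ acts with respect to the variables of $\underline{X}$ (i.e. on $\underline{z}$).
   Context: Setting: $n=2p$; coordinates on $\mathbb{R}^{4p}=\mathbb{R}^{2n}$ are $(x_1,y_1,\dots,x_n,y_n)$; $(e_1,\dots,e_{2n})$ is the standard orthonormal basis, generating the complex Clifford algebra $\mathbb{C}_{2n}$ with $e_\alpha e_\beta+e_\beta e_\alpha=-2\delta_{\alpha\beta}$. Complex coordinates: $z_k=x_k+iy_k$, $z_k^c=x_k-iy_k$, identifying $\mathbb{R}^{2n}\cong\mathbb{C}^n$; $\partial_{z_k}=\frac12(\partial_{x_k}-i\partial_{y_k})$, $\partial_{z_k^c}=\frac12(\partial_{x_k}+i\partial_{y_k})$. Witt basis: $\mathfrak{f}_k=-\frac12(e_{2k-1}-ie_{2k})$, $\mathfrak{f}_k^\dagger=\frac12(e_{2k-1}+ie_{2k})$, $k=1,\dots,n$. Spinor space: $\mathbb{S}=\mathbb{C}_{2n}I$ with $I=I_1\cdots I_n$, $I_j=\mathfrak{f}_j\mathfrak{f}_j^\dagger$. Functions take values in $\mathbb{S}$ and Clifford elements act by left multiplication. Vector variables: for a point $\underline{X}$ with complex coordinates $z_k$, $\underline{z}=\sum_{k=1}^n z_k\mathfrak{f}_k$, $\underline{z}^\dagger=\sum_{k=1}^n z_k^c\mathfrak{f}_k^\dagger$, $\underline{z}^J=\sum_{j=1}^p(z_{2j}\mathfrak{f}^\dagger_{2j-1}-z_{2j-1}\mathfrak{f}^\dagger_{2j})$, $\underline{z}^{\dagger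 J}=\sum_{j=1}^p(z_{2j}^c\mathfrak{f}_{2j-1}-z_{2j-1}^c\mathfrak{f}_{2j})$, and $|\underline{z}|^2=\sum_k|z_k|^2=|\underline{X}|^2$. For a point $\underline{Y}\in\partial D$ with complex coordinates $v_k$, the variables $\underline{v},\underline{v}^\dagger,\underline{v}^J,\underline{v}^{\dagger J}$ are defined in the same way. In the integrals $\underline{X}$ corresponds to $\underline{z}$ and $\underline{Y}$ (the integration variable) to $\underline{v}$. Differential operators: $\partial_{\underline{z}}=\sum_{k}\partial_{z_k}\mathfrak{f}_k^\dagger$, $\partial_{\underline{z}}^\dagger=\sum_k\partial_{z_k^c}\mathfrak{f}_k$, $\partial_{\underline{z}}^J=\sum_{j=1}^p(\partial_{z_{2j}}\mathfrak{f}_{2j-1}-\partial_{z_{2j-1}}\mathfrak{f}_{2j})$, $\partial_{\underline{z}}^{\dagger J}=\sum_{j=1}^p(\partial_{z^c_{2j}}\mathfrak{f}^\dagger_{2j-1}-\partial_{z^c_{2j-1}}\mathfrak{f}^\dagger_{2j})$. Multiplication operator: $P=\mathfrak{f}_2\mathfrak{f}_1+\mathfrak{f}_4\mathfrak{f}_3+\cdots+\mathfrak{f}_{2p}\mathfrak{f}_{2p-1}$. Euler-like scalar operator: $\mathcal{E}=\sum_{k=1}^p\left(z_{2k-1}\partial_{z_{2k}^c}-z_{2k}\partial_{z_{2k-1}^c}\right)$. Definition: a (continuously differentiable) $\mathbb{S}$-valued function is $\mathfrak{osp}(4|2)$-monogenic in an open set $\Omega\subset\mathbb{R}^{4p}$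 if in $\Omega$ it is in the kernel of the six operators $\partial_{\underline{z}},\partial_{\underline{z}}^\dagger,\partial_{\underline{z}}^J,\partial_{\underline{z}}^{\dagger J},P,\mathcal{E}$. Kernels ($a_{4p}$ = area of the unit sphere $S^{4p-1}$): $E(\underline{z})=\frac{2}{a_{4p}}\frac{\underline{z}}{|\underline{z}|^{4p}}$, $E^\dagger(\underline{z})=\frac{2}{a_{4p}}\frac{\underline{z}^\dagger}{|\underline{z}|^{4p}}$, $E^J(\underline{z})=\frac{2}{a_{4p}}\frac{\underline{z}^J}{|\underline{z}|^{4p}}$, $E^{\dagger J}(\underline{z})=\frac{2}{a_{4p}}\frac{\underline{z}^{\dagger J}}{|\underline{z}|^{4p}}$. Differential forms: $\widehat{dz_j}$ (resp. $\widehat{dz_j^c}$) is the $(2n-1)$-form obtained from $dz_1\wedge dz_1^c\wedge\cdots\wedge dz_n\wedge dz_n^c$ by omitting $dz_j$ (resp. $dz_j^c$), with the order of the other factors kept. Then $d\sigma_{\underline{z}}=\sum_{j=1}^{n}\mathfrak{f}_j^\dagger\widehat{dz_j}$, $d\sigma_{\underline{z}^\dagger}=-\sum_{j=1}^n\mathfrak{f}_j\widehat{dz_j^c}$, $d\sigma_{\underline{z}^J}=\sum_{j=1}^p(\mathfrak{f}_{2j-1}\widehat{dz_{2j}}-\mathfrak{f}_{2j}\widehat{dz_{2j-1}})$, $d\sigma_{\underline{z}^{\dagger J}}=-\sum_{j=1}^p(\mathfrak{f}_{2j-1}^\dagger\widehat{dz_{2j}^c}-\mathfrak{f}_{2j}^\dagger\widehat{dz_{2j-1}^c})$,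 and likewise with $\underline{v}$ in place of $\underline{z}$. $\mathbb{R}^{2n}$ is oriented by $dx_1\wedge dy_1\wedge\cdots\wedge dx_n\wedge dy_n$ and $\partial D$ carries the induced (outward) boundary orientation. *)

theory Defs
  imports "HOL-Analysis.Analysis" "HOL-Combinatorics.Permutations"
begin

section \<open>Coordinates\<close>

text \<open>
  Points of \<open>\<real>\<^sup>m\<close> are elements of type \<open>real ^ 'm\<close> for a finite linearly ordered index type;
  \<open>idx \<alpha>\<close> is the \<open>\<alpha>\<close>-th smallest index, counting from 1. For \<open>m = 2 n\<close> the coordinates in
  increasing order are \<open>x\<^sub>1, y\<^sub>1, \<dots>, x\<^sub>n, y\<^sub>n\<close>.
\<close>

type_synonym 'm point = "(real, 'm) vec"

definition idx :: "nat \<Rightarrow> 'm::{finite,linorder}" where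
  "idx \<alpha> = sorted_list_of_set UNIV ! (\<alpha> - 1)"

definition zc :: "nat \<Rightarrow> 'm::{finite,linorder} point \<Rightarrow> complex" where
  "zc k X = Complex (X $ idx (2 * k - 1)) (X $ idx (2 * k))"

definition zcc :: "nat \<Rightarrow> 'm::{finite,linorder} point \<Rightarrow> complex" where
  "zcc k X = cnj (zc k X)"


section \<open>The complex Clifford algebra, Witt basis and spinor space\<close>

text \<open>
  An element is the family of its coefficients with respect to the basis
  \<open>e\<^sub>A = e\<^sub>a\<^sub>1 \<cdots> e\<^sub>a\<^sub>r\<close>, \<open>A = {a\<^sub>1 < \<dots> < a\<^sub>r}\<close>. In \<open>e\<^sub>A e\<^sub>B = \<plusminus> e\<^bsub>A \<triangle> B\<^esub>\<close> every pair
  \<open>b < a\<close> (a transposition) and every common index (\<open>e\<^sub>a\<^sup>2 = -1\<close>) contributes a factor \<open>-1\<close>.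
  The library's product on vectors is componentwise, hence the separate symbol;
  complex scalars act by \<^term>\<open>(*s)\<close>.
\<close>

type_synonym 'm cliff = "(complex, 'm set) vec"

definition cl_sign :: "'m::{finite,linorder} set \<Rightarrow> 'm set \<Rightarrow> complex" where
  "cl_sign A B = (-1) ^ card {(a, b). a \<in> A \<and> b \<in> B \<and> b \<le> a}"

definition cmul :: "'m::{finite,linorder} cliff \<Rightarrow> 'm cliff \<Rightarrow> 'm cliff"  (infixl "\<odot>" 70) where
  "a \<odot> b = (\<chi> C. \<Sum>(A, B) | sym_diff A B = C. cl_sign A B * a $ A * b $ B)"

definition cl_one :: "'m::{finite,linorder} cliff" where
  "cl_one = axis {} 1"

definition gen :: "nat \<Rightarrow> 'm::{finite,linorder} cliff" where
  "gen \<alpha> = axis {idx \<alpha>} 1"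

definition witt :: "nat \<Rightarrow> 'm::{finite,linorder} cliff" where
  "witt k = - ((1/2) *s (gen (2 * k - 1) - \<i> *s gen (2 * k)))"

definition wittd :: "nat \<Rightarrow> 'm::{finite,linorder} cliff" where
  "wittd k = (1/2) *s (gen (2 * k - 1) + \<i> *s gen (2 * k))"

definition prim_idem :: "nat \<Rightarrow> 'm::{finite,linorder} cliff" where
  "prim_idem p = foldr (\<lambda>j a. (witt j \<odot> wittd j) \<odot> a) [1..<2 * p + 1] cl_one"

definition spinor_space :: "nat \<Rightarrow> ('m::{finite,linorder} cliff) set" where
  "spinor_space p = range (\<lambda>a. a \<odot> prim_idem p)"

lemma idx_inj:
  assumes "\<alpha> \<in> {1..CARD('m)}" "\<beta> \<in> {1..CARD('m)}"
  shows "(idx \<alpha> :: 'm::{finite,linorder}) = idx \<beta> \<longleftrightarrow> \<alpha> = \<beta>"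
proof -
  have "\<alpha> - 1 < CARD('m)" "\<beta> - 1 < CARD('m)"
    using assms by auto
  then show ?thesis
    using assms unfolding idx_def
    by (subst nth_eq_iff_index_eq) auto
qed

lemma cmul_axis:
  "(axis A x :: 'm::{finite,linorder} cliff) \<odot> axis B y = axis (sym_diff A B) (cl_sign A B * x * y)"
proof -
  have "(\<Sum>(A', B') | sym_diff A' B' = C. cl_sign A' B' * (axis A x :: 'm cliff) $ A' * axis B y $ B')
        = (axis (sym_diff A B) (cl_sign A B * x * y) :: 'm cliff) $ C" for C
  proof -
    have "(\<Sum>(A', B') | sym_diff A' B' = C. cl_sign A' B' * (axis A x :: 'm cliff) $ A' * axis B y $ B')
        = (\<Sum>q | case q of (A', B') \<Rightarrow> sym_diff A' B' = C.
            if q = (A, B) then cl_sign A B * x * y else 0)"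
      by (rule sum.cong) (auto simp: axis_def split: if_splits)
    also have "\<dots> = (if sym_diff A B = C then cl_sign A B * x * y else 0)"
      by (subst sum.delta) auto
    finally show ?thesis
      by (simp add: axis_def)
  qed
  then show ?thesis
    by (simp add: cmul_def vec_eq_iff)
qed

lemma cmul_distrib:
  fixes a b c :: "'m::{finite,linorder} cliff"
  shows "(a + b) \<odot> c = a \<odot> c + b \<odot> c" "a \<odot> (b + c) = a \<odot> b + a \<odot> c"
  by (simp_all add: cmul_def vec_eq_iff algebra_simps sum.distrib case_prod_beta)

lemma cmul_scale:
  fixes a b :: "'m::{finite,linorder} cliff"
  shows "(x *s a) \<odot> b = x *s (a \<odot> b)" "a \<odot> (x *s b) = x *s (a \<odot> b)"
  by (simp_all add: cmul_def vec_eq_iff algebra_simps sum_distrib_left case_prod_beta)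

lemma cmul_sum:
  fixes f :: "'i \<Rightarrow> 'm::{finite,linorder} cliff"
  shows "sum f S \<odot> c = (\<Sum>i\<in>S. f i \<odot> c)" "c \<odot> sum f S = (\<Sum>i\<in>S. c \<odot> f i)"
proof -
  have "0 \<odot> c = 0" "c \<odot> 0 = 0"
    by (simp_all add: cmul_def vec_eq_iff case_prod_beta)
  then show "sum f S \<odot> c = (\<Sum>i\<in>S. f i \<odot> c)" "c \<odot> sum f S = (\<Sum>i\<in>S. c \<odot> f i)"
    by (induction S rule: infinite_finite_induct; simp add: cmul_distrib)+
qed

lemma cl_sign_prod: "cl_sign A B = (\<Prod>a\<in>A. \<Prod>b\<in>B. if b \<le> a then -1 else 1)"
proof -
  have "(\<Prod>a\<in>A. \<Prod>b\<in>B. if b \<le> a then -1 else 1) =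
        (\<Prod>(a, b)\<in>A \<times> B. if b \<le> a then -1 else (1::complex))"
    by (simp add: prod.cartesian_product)
  also have "\<dots> = (\<Prod>q\<in>A \<times> B. if snd q \<le> fst q then -1 else 1)"
    by (simp add: case_prod_beta)
  also have "\<dots> = (\<Prod>q\<in>{q \<in> A \<times> B. snd q \<le> fst q}. -1)"
    by (subst prod.inter_filter) auto
  also have "{q \<in> A \<times> B. snd q \<le> fst q} = {(a, b). a \<in> A \<and> b \<in> B \<and> b \<le> a}"
    by auto
  finally show ?thesis
    by (simp add: cl_sign_def)
qed

lemma prod_sym_diff:
  fixes f :: "'m::finite \<Rightarrow> complex"
  assumes "\<And>x. f x * f x = 1"
  shows "prod f (sym_diff A B) = prod f A * prod f B"
proof -
  have "prod f (A \<inter> B) * prod f (A \<inter> B) = 1"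
    using assms by (simp flip: prod.distrib)
  moreover have "prod f A = prod f (A - B) * prod f (A \<inter> B)"
    by (metis finite prod.Int_Diff mult.commute)
  moreover have "prod f B = prod f (B - A) * prod f (A \<inter> B)"
    by (metis finite prod.Int_Diff mult.commute inf_commute)
  moreover have "prod f (sym_diff A B) = prod f (A - B) * prod f (B - A)"
    by (intro prod.union_disjoint) auto
  moreover have "(u * i) * (v * i) = (u * v) * (i * i)" for u v i :: complex
    by (simp add: ac_simps)
  ultimately show ?thesis
    by simp
qed

lemma cl_sign_sym_diff:
  "cl_sign (sym_diff A B) C = cl_sign A C * cl_sign B C"
  "cl_sign A (sym_diff B C) = cl_sign A B * cl_sign A C"
proof -
  have inner: "(\<Prod>b\<in>S. if b \<le> a then -1 else 1) * (\<Prod>b\<in>S. if b \<le> a then -1 else 1) = (1::complex)"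
    for S and a :: "'a"
    by (simp flip: prod.distrib) (rule prod.neutral, simp)
  show "cl_sign (sym_diff A B) C = cl_sign A C * cl_sign B C"
    unfolding cl_sign_prod by (rule prod_sym_diff) (rule inner)
  show "cl_sign A (sym_diff B C) = cl_sign A B * cl_sign A C"
    unfolding cl_sign_prod prod.distrib[symmetric]
    by (rule prod.cong[OF refl], rule prod_sym_diff) simp
qed

lemma cliff_expand: "(a :: 'm::{finite,linorder} cliff) = (\<Sum>A\<in>UNIV. axis A (a $ A))"
  by (simp add: vec_eq_iff axis_def)

lemma cmul_assoc: "(a \<odot> b) \<odot> c = a \<odot> (b \<odot> (c :: 'm::{finite,linorder} cliff))"
proof -
  have 1: "(axis A x \<odot> axis B y) \<odot> axis C z = axis A x \<odot> (axis B y \<odot> (axis C z :: 'm cliff))"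
    for A B C x y z
  proof -
    have "sym_diff (sym_diff A B) C = sym_diff A (sym_diff B C)" by auto
    then show ?thesis
      by (simp only: cmul_axis cl_sign_sym_diff) (simp add: ac_simps)
  qed
  have "(\<Sum>A\<in>UNIV. axis A (a $ A)) \<odot> (\<Sum>B\<in>UNIV. axis B (b $ B)) \<odot> (\<Sum>C\<in>UNIV. axis C (c $ C))
      = (\<Sum>A\<in>UNIV. axis A (a $ A)) \<odot> ((\<Sum>B\<in>UNIV. axis B (b $ B)) \<odot> (\<Sum>C\<in>UNIV. axis C (c $ C)))"
    by (simp only: cmul_sum 1)
  then show ?thesis
    unfolding cliff_expand[symmetric] .
qed

lemma cmul_one:
  "cl_one \<odot> a = a" "a \<odot> cl_one = (a :: 'm::{finite,linorder} cliff)"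
proof -
  have *: "cl_sign {} A = 1" "cl_sign A {} = 1" for A :: "'m set"
    by (simp_all add: cl_sign_def)
  have "cl_one \<odot> axis A x = axis A x" "axis A x \<odot> cl_one = (axis A x :: 'm cliff)" for A x
    by (simp_all add: cl_one_def cmul_axis *)
  then have "cl_one \<odot> (\<Sum>A\<in>UNIV. axis A (a $ A)) = (\<Sum>A\<in>UNIV. axis A (a $ A))"
    "(\<Sum>A\<in>UNIV. axis A (a $ A)) \<odot> cl_one = (\<Sum>A\<in>UNIV. axis A (a $ A))"
    by (simp_all only: cmul_sum)
  then show "cl_one \<odot> a = a" "a \<odot> cl_one = a"
    unfolding cliff_expand[symmetric] by simp_all
qed

text \<open>The defining relations of the Clifford algebra hold.\<close>

lemma gen_relations:
  assumes "\<alpha> \<in> {1..CARD('m)}" "\<beta> \<in> {1..CARD('m)}"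
  shows "(gen \<alpha> :: 'm::{finite,linorder} cliff) \<odot> gen \<beta> + gen \<beta> \<odot> gen \<alpha>
          = (if \<alpha> = \<beta> then -2 else 0) *s cl_one"
proof (cases "\<alpha> = \<beta>")
  case True
  have "{(a, b). a \<in> {idx \<alpha> :: 'm} \<and> b \<in> {idx \<alpha>} \<and> b \<le> a} = {(idx \<alpha>, idx \<alpha>)}" by auto
  then show ?thesis
    using True by (simp add: gen_def cmul_axis cl_sign_def cl_one_def) (simp add: vec_eq_iff axis_def)
next
  case False
  then have ne: "(idx \<alpha> :: 'm) \<noteq> idx \<beta>"
    using idx_inj[OF assms] by simp
  have s: "cl_sign {i :: 'm} {j} = (if j \<le> i then -1 else 1)" for i j
  proof -
    have "{(a, b). a \<in> {i} \<and> b \<in> {j} \<and> b \<le> a} = (if j \<le> i then {(i, j)} else {})" by auto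
    then show ?thesis by (simp add: cl_sign_def)
  qed
  have "sym_diff {idx \<alpha> :: 'm} {idx \<beta>} = sym_diff {idx \<beta>} {idx \<alpha>}" by auto
  then show ?thesis
    using False ne by (auto simp: gen_def cmul_axis s) (auto simp: vec_eq_iff axis_def)
qed


section \<open>Differential operators\<close>

primrec Ck_on :: "nat \<Rightarrow> 'a::euclidean_space set \<Rightarrow> ('a \<Rightarrow> 'b::real_normed_vector) \<Rightarrow> bool" where
  "Ck_on 0 S f \<longleftrightarrow> continuous_on S f"
| "Ck_on (Suc k) S f \<longleftrightarrow>
     (\<forall>x\<in>S. f differentiable (at x)) \<and>
     (\<forall>b\<in>Basis. Ck_on k S (\<lambda>x. frechet_derivative f (at x) b))"

definition partial_at ::
  "nat \<Rightarrow> ('m::{finite,linorder} point \<Rightarrow> 'b::real_normed_vector) \<Rightarrow> 'm point \<Rightarrow> 'b" where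
  "partial_at \<alpha> F X = frechet_derivative F (at X) (axis (idx \<alpha>) 1)"

definition d_z :: "nat \<Rightarrow> ('m::{finite,linorder} point \<Rightarrow> 'm cliff) \<Rightarrow> 'm point \<Rightarrow> 'm cliff" where
  "d_z k F X = (1/2) *s (partial_at (2 * k - 1) F X - \<i> *s partial_at (2 * k) F X)"

definition d_zc :: "nat \<Rightarrow> ('m::{finite,linorder} point \<Rightarrow> 'm cliff) \<Rightarrow> 'm point \<Rightarrow> 'm cliff" where
  "d_zc k F X = (1/2) *s (partial_at (2 * k - 1) F X + \<i> *s partial_at (2 * k) F X)"

definition dirac :: "nat \<Rightarrow> ('m::{finite,linorder} point \<Rightarrow> 'm cliff) \<Rightarrow> 'm point \<Rightarrow> 'm cliff" where
  "dirac p F X = (\<Sum>k=1..2*p. wittd k \<odot> d_z k F X)"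

definition dirac_dag :: "nat \<Rightarrow> ('m::{finite,linorder} point \<Rightarrow> 'm cliff) \<Rightarrow> 'm point \<Rightarrow> 'm cliff" where
  "dirac_dag p F X = (\<Sum>k=1..2*p. witt k \<odot> d_zc k F X)"

definition dirac_J :: "nat \<Rightarrow> ('m::{finite,linorder} point \<Rightarrow> 'm cliff) \<Rightarrow> 'm point \<Rightarrow> 'm cliff" where
  "dirac_J p F X =
     (\<Sum>j=1..p. witt (2*j-1) \<odot> d_z (2*j) F X - witt (2*j) \<odot> d_z (2*j-1) F X)"

definition dirac_dagJ :: "nat \<Rightarrow> ('m::{finite,linorder} point \<Rightarrow> 'm cliff) \<Rightarrow> 'm point \<Rightarrow> 'm cliff" where
  "dirac_dagJ p F X =
     (\<Sum>j=1..p. wittd (2*j-1) \<odot> d_zc (2*j) F X - wittd (2*j) \<odot> d_zc (2*j-1) F X)"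

definition P_elt :: "nat \<Rightarrow> 'm::{finite,linorder} cliff" where
  "P_elt p = (\<Sum>j=1..p. witt (2*j) \<odot> witt (2*j-1))"

definition euler :: "nat \<Rightarrow> ('m::{finite,linorder} point \<Rightarrow> 'm cliff) \<Rightarrow> 'm point \<Rightarrow> 'm cliff" where
  "euler p F X =
     (\<Sum>k=1..p. zc (2*k-1) X *s d_zc (2*k) F X - zc (2*k) X *s d_zc (2*k-1) F X)"

definition osp_monogenic ::
  "nat \<Rightarrow> ('m::{finite,linorder} point) set \<Rightarrow> ('m point \<Rightarrow> 'm cliff) \<Rightarrow> bool" where
  "osp_monogenic p \<Omega> g \<longleftrightarrow>
     g \<in> \<Omega> \<rightarrow> spinor_space p \<and> Ck_on 1 \<Omega> g \<and>
     (\<forall>X\<in>\<Omega>. dirac p g X = 0 \<and> dirac_dag p g X = 0 \<and> dirac_J p g X = 0 \<and> dirac_dagJ p g X = 0 \<and>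
            P_elt p \<odot> g X = 0 \<and> euler p g X = 0)"


section \<open>Kernels\<close>

definition vec_z :: "nat \<Rightarrow> 'm::{finite,linorder} point \<Rightarrow> 'm cliff" where
  "vec_z p X = (\<Sum>k=1..2*p. zc k X *s witt k)"

definition vec_zdag :: "nat \<Rightarrow> 'm::{finite,linorder} point \<Rightarrow> 'm cliff" where
  "vec_zdag p X = (\<Sum>k=1..2*p. zcc k X *s wittd k)"

definition vec_zJ :: "nat \<Rightarrow> 'm::{finite,linorder} point \<Rightarrow> 'm cliff" where
  "vec_zJ p X = (\<Sum>j=1..p. zc (2*j) X *s wittd (2*j-1) - zc (2*j-1) X *s wittd (2*j))"

definition vec_zdagJ :: "nat \<Rightarrow> 'm::{finite,linorder} point \<Rightarrow> 'm cliff" where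
  "vec_zdagJ p X = (\<Sum>j=1..p. zcc (2*j) X *s witt (2*j-1) - zcc (2*j-1) X *s witt (2*j))"

text \<open>
  Area of the unit sphere of a Euclidean space, with the surface measure of polar coordinates:
  \<open>\<sigma>(A) = m \<cdot> \<lambda>{r x | 0 < r \<le> 1, x \<in> A}\<close>.
\<close>

definition sphere_area :: "'a::euclidean_space itself \<Rightarrow> real" where
  "sphere_area _ = real DIM('a) * measure lborel (cball (0::'a) 1)"

lemma sphere_area_eq:
  "sphere_area TYPE('a::euclidean_space) = 2 * pi powr (DIM('a) / 2) / Gamma (DIM('a) / 2)"
proof -
  have "Gamma (real DIM('a) / 2 + 1) = real DIM('a) / 2 * Gamma (real DIM('a) / 2)"
    by (intro Gamma_plus1) auto
  moreover have "Gamma (real DIM('a) / 2) > 0"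
    by (intro Gamma_real_pos) simp
  ultimately show ?thesis
    unfolding sphere_area_def content_cball[OF zero_le_one] unit_ball_vol_def
    by (simp only:) (simp add: divide_simps)
qed

definition kfactor :: "nat \<Rightarrow> 'm::{finite,linorder} point \<Rightarrow> complex" where
  "kfactor p X = complex_of_real (2 / sphere_area TYPE('m point) / norm X ^ (4 * p))"

definition E :: "nat \<Rightarrow> 'm::{finite,linorder} point \<Rightarrow> 'm cliff" where
  "E p X = kfactor p X *s vec_z p X"

definition Edag :: "nat \<Rightarrow> 'm::{finite,linorder} point \<Rightarrow> 'm cliff" where
  "Edag p X = kfactor p X *s vec_zdag p X"

definition EJ :: "nat \<Rightarrow> 'm::{finite,linorder} point \<Rightarrow> 'm cliff" where
  "EJ p X = kfactor p X *s vec_zJ p X"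

definition EdagJ :: "nat \<Rightarrow> 'm::{finite,linorder} point \<Rightarrow> 'm cliff" where
  "EdagJ p X = kfactor p X *s vec_zdagJ p X"


section \<open>Differential forms\<close>

text \<open>
  An \<open>r\<close>-form at a point is its value on lists of \<open>r\<close> tangent vectors; wedge products are
  normalised by \<open>(dx\<^sub>1 \<and> \<dots> \<and> dx\<^sub>m)(e\<^sub>1, \<dots>, e\<^sub>m) = 1\<close>. The coordinates are linear, so the one-forms
  \<open>dz\<^sub>k\<close> and \<open>dz\<^sub>k\<^sup>c\<close> are \<open>zc k\<close> and \<open>zcc k\<close>, applied to tangent vectors.
\<close>

definition wedge :: "('v \<Rightarrow> 'c::comm_ring_1) list \<Rightarrow> 'v list \<Rightarrow> 'c" where
  "wedge \<alpha>s ts = (\<Sum>\<pi> | \<pi> permutes {..<length \<alpha>s}.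
      of_int (sign \<pi>) * (\<Prod>i<length \<alpha>s. (\<alpha>s ! i) (ts ! \<pi> i)))"

definition omit :: "nat \<Rightarrow> 'b list \<Rightarrow> 'b list" where
  "omit i xs = take i xs @ drop (Suc i) xs"

definition zforms :: "nat \<Rightarrow> ('m::{finite,linorder} point \<Rightarrow> complex) list" where
  "zforms p = concat (map (\<lambda>k. [zc k, zcc k]) [1..<2 * p + 1])"

definition hat_dz :: "nat \<Rightarrow> nat \<Rightarrow> ('m::{finite,linorder} point) list \<Rightarrow> complex" where
  "hat_dz p j = wedge (omit (2 * j - 2) (zforms p))"

definition hat_dzc :: "nat \<Rightarrow> nat \<Rightarrow> ('m::{finite,linorder} point) list \<Rightarrow> complex" where
  "hat_dzc p j = wedge (omit (2 * j - 1) (zforms p))"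

definition dsigma :: "nat \<Rightarrow> ('m::{finite,linorder} point) list \<Rightarrow> 'm cliff" where
  "dsigma p ts = (\<Sum>j=1..2*p. hat_dz p j ts *s wittd j)"

definition dsigma_dag :: "nat \<Rightarrow> ('m::{finite,linorder} point) list \<Rightarrow> 'm cliff" where
  "dsigma_dag p ts = - (\<Sum>j=1..2*p. hat_dzc p j ts *s witt j)"

definition dsigma_J :: "nat \<Rightarrow> ('m::{finite,linorder} point) list \<Rightarrow> 'm cliff" where
  "dsigma_J p ts =
     (\<Sum>j=1..p. hat_dz p (2*j) ts *s witt (2*j-1) - hat_dz p (2*j-1) ts *s witt (2*j))"

definition dsigma_dagJ :: "nat \<Rightarrow> ('m::{finite,linorder} point) list \<Rightarrow> 'm cliff" where
  "dsigma_dagJ p ts =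
     - (\<Sum>j=1..p. hat_dzc p (2*j) ts *s wittd (2*j-1) - hat_dzc p (2*j-1) ts *s wittd (2*j))"


section \<open>Smooth boundaries and integration of forms over them\<close>

text \<open>
  Near a boundary point, up to permuting and reflecting the coordinate axes, \<open>D\<close> is the region
  below the graph of a smooth function \<open>\<gamma>\<close> on the hyperplane orthogonal to a signed coordinate
  vector \<open>k\<close>. Thus \<open>k\<close> points out of \<open>D\<close>. Only the values of \<open>\<gamma>\<close> on that hyperplane matter.
\<close>

definition graph_chart ::
  "'a::euclidean_space set \<Rightarrow> 'a \<Rightarrow> ('a \<Rightarrow> real) \<Rightarrow> 'a set \<Rightarrow> bool" where
  "graph_chart D k \<gamma> W \<longleftrightarrow>
     k \<in> Basis \<union> uminus ` Basis \<and> (\<forall>r. Ck_on r UNIV \<gamma>) \<and> open W \<and>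
     D \<inter> W = {x \<in> W. x \<bullet> k < \<gamma> (x - (x \<bullet> k) *\<^sub>R k)}"

definition smooth_boundary :: "'a::euclidean_space set \<Rightarrow> bool" where
  "smooth_boundary D \<longleftrightarrow> (\<forall>q\<in>frontier D. \<exists>k \<gamma> W. q \<in> W \<and> graph_chart D k \<gamma> W)"

definition graph_map :: "'a::euclidean_space \<Rightarrow> ('a \<Rightarrow> real) \<Rightarrow> 'a \<Rightarrow> 'a" where
  "graph_map k \<gamma> u = u + \<gamma> u *\<^sub>R k"

text \<open>Lebesgue measure of the coordinate hyperplane orthogonal to \<open>k\<close>, with that hyperplane as
  its space; compare the definition of \<open>lborel\<close>.\<close>

definition hyperplane_lborel :: "'a::euclidean_space \<Rightarrow> 'a measure" where
  "hyperplane_lborel k =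
     distr (\<Pi>\<^sub>M b\<in>{b \<in> Basis. b \<bullet> k = 0}. lborel) (restrict_space borel {u. u \<bullet> k = 0})
       (\<lambda>c. \<Sum>b | b \<in> Basis \<and> b \<bullet> k = 0. c b *\<^sub>R b)"

definition vol_form :: "('m::{finite,linorder} point) list \<Rightarrow> real" where
  "vol_form = wedge (map (\<lambda>i X. X $ i) (sorted_list_of_set UNIV))"

definition hyperplane_frame :: "'m::{finite,linorder} point \<Rightarrow> ('m point) list" where
  "hyperplane_frame k =
     filter (\<lambda>b. b \<bullet> k = 0) (map (\<lambda>i. axis i 1) (sorted_list_of_set UNIV))"

text \<open>
  Pullback of a form \<open>\<omega>\<close> (defined along the boundary, of degree one less than the dimension) by
  the graph parametrisation. The sign compares the parametrisation with the boundary orientation,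
  for which a frame is positive if it is positive after putting an outward pointing vector first.
\<close>

definition graph_pullback ::
  "'m::{finite,linorder} point \<Rightarrow> ('m point \<Rightarrow> real) \<Rightarrow>
   ('m point \<Rightarrow> ('m point) list \<Rightarrow> 'b::real_normed_vector) \<Rightarrow> 'm point \<Rightarrow> 'b" where
  "graph_pullback k \<gamma> \<omega> u =
     (let ts = map (frechet_derivative (graph_map k \<gamma>) (at u)) (hyperplane_frame k)
      in sgn (vol_form (k # ts)) *\<^sub>R \<omega> (graph_map k \<gamma> u) ts)"

text \<open>
  \<open>I\<close> is the integral of \<open>\<omega>\<close> over the boundary of \<open>D\<close>, computed from finitely many graph charts and
  a subordinate partition of unity on the boundary. As usual the value depends neither on the
  charts nor on the partition, for which continuous differentiability is enough.
\<close>

definition has_boundary_integral ::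
  "('m::{finite,linorder} point \<Rightarrow> ('m point) list \<Rightarrow> 'b::{banach,second_countable_topology}) \<Rightarrow>
   ('m point) set \<Rightarrow> 'b \<Rightarrow> bool" where
  "has_boundary_integral \<omega> D I \<longleftrightarrow>
     (\<exists>(N::nat) k \<gamma> W \<rho>.
        (\<forall>i<N. graph_chart D (k i) (\<gamma> i) (W i) \<and>
               Ck_on 1 UNIV (\<rho> i) \<and> (\<forall>Y. (0::real) \<le> \<rho> i Y) \<and>
               compact (closure {Y. \<rho> i Y \<noteq> 0}) \<and> closure {Y. \<rho> i Y \<noteq> 0} \<subseteq> W i \<and>
               integrable (hyperplane_lborel (k i))
                 (graph_pullback (k i) (\<gamma> i) (\<lambda>Y ts. \<rho> i Y *\<^sub>R \<omega> Y ts))) \<and>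
        (\<forall>Y\<in>frontier D. (\<Sum>i<N. \<rho> i Y) = 1) \<and>
        I = (\<Sum>i<N. \<integral>u. graph_pullback (k i) (\<gamma> i) (\<lambda>Y ts. \<rho> i Y *\<^sub>R \<omega> Y ts) u
                      \<partial>hyperplane_lborel (k i)))"

definition boundary_integral ::
  "('m::{finite,linorder} point) set \<Rightarrow>
   ('m point \<Rightarrow> ('m point) list \<Rightarrow> 'b::{banach,second_countable_topology}) \<Rightarrow> 'b" where
  "boundary_integral D \<omega> = (THE I. has_boundary_integral \<omega> D I)"

end

theory Submission
  imports "Jordan_Normal_Form.Determinant" Defs
begin

text \<open>
  Laplace expansion of the volume form expresses the four form-valued elements
  \<open>d\<sigma>, d\<sigma>\<^sup>\<dagger>, d\<sigma>\<^sup>J, d\<sigma>\<^sup>\<dagger>\<^sup>J\<close> through \<open>z\<^sup>\<dagger>, z, z\<^sup>\<dagger>\<^sup>J, z\<^sup>J\<close> evaluated at the coordinate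
  vectors \<open>b\<close>, up to the factor \<open>(-2i)\<^sup>n / 2\<close>. This turns every integral into the flux of a vector
  field \<open>\<Phi>\<^sub>b(Y) = |w|\<^bsup>-4p\<^esup> L(w, b) g(Y)\<close>, \<open>w = Y - X\<close>, where \<open>L\<close> is bilinear,
  \<open>L(w, w) = \<lambda> |w|\<^sup>2\<close>, and \<open>\<Sum>\<^sub>b L(w, b) \<partial>\<^sub>b g = 0\<close> by monogenicity. Such a field is divergence
  free away from \<open>X\<close>; cutting it off near \<open>X\<close> and applying the divergence theorem shows that its
  flux is \<open>\<lambda> a g(X)\<close>, \<open>a\<close> the area of the unit sphere. The Witt relations give \<open>\<lambda> = 1\<close> (as
  \<open>z z\<^sup>\<dagger> + z\<^sup>\<dagger> z = |z|\<^sup>2\<close>) for the representation formulae and \<open>\<lambda> = 0\<close> (as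
  \<open>(z\<^sup>\<dagger>)\<^sup>2 = (z\<^sup>J)\<^sup>2 = 0\<close>) for the next two identities; the last two follow by differentiating the
  representation formulae with respect to \<open>X\<close>, since \<open>g\<close> is in the kernel of the Euler operator.
\<close>

hide_type (open) Matrix.vec
no_notation Matrix.vec_index (infixl "$" 100)
no_notation Matrix.scalar_prod (infix "\<bullet>" 70)
no_notation Module.smult (infixl "\<odot>\<index>" 70)
hide_const (open) Matrix.vec Matrix.mat Determinant.det Polynomial.order Matrix.row Matrix.col
  Matrix.rows Matrix.cols Polynomial.content

section \<open>Differential forms and determinants\<close>


text \<open>The boundary integral is a definite description over all graph charts and partitions,
  whose functions are C^1 and sum to 1 on the frontier only, so every choice has to be shown to give
  the same value. The divergence theorem replaces a change of variables here: each choice yields the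
  same volume integral over \<open>D\<close>, because a C^1 function that vanishes on the frontier
  has derivatives of integral zero over \<open>D\<close>. This needs fields that are C^1 on the
  whole space, while the kernel is singular at \<open>X\<close> and \<open>g\<close> is controlled
  only near the closure of \<open>D\<close>. Hence the kernel is multiplied by a function vanishing
  near \<open>X\<close> and \<open>g\<close> is extended by a partition of unity; neither changes
  the field on the frontier. No small sphere around \<open>X\<close> is integrated over: the sphere
  area enters through one radial integral. The power of -2i is the determinant of the passage from
  \<open>x, y\<close> to \<open>z, z^c\<close>, and the remaining 1/2 cancels the 2 in the kernel
  constant \<open>2 / a\<close>.\<close>

lemma wedge_eq_det:
  assumes "length \<alpha>s = n" "length ts = n"
  shows "wedge \<alpha>s ts = Determinant.det (Matrix.mat n n (\<lambda>(i, j). (\<alpha>s ! i) (ts ! j)))"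
proof -
  have "(\<Prod>i<n. (\<alpha>s ! i) (ts ! \<pi> i))
      = (\<Prod>i=0..<n. Matrix.mat n n (\<lambda>(i, j). (\<alpha>s ! i) (ts ! j)) $$ (i, \<pi> i))"
    if "\<pi> permutes {0..<n}" for \<pi>
    using permutes_in_image[OF that] by (intro prod.cong) (auto simp: lessThan_atLeast0)
  then show ?thesis
    unfolding wedge_def
    by (subst det_def'[where n = n]) (auto simp: assms lessThan_atLeast0 sign_def intro!: sum.cong)
qed

text \<open>The tangent vectors are the columns, so a vector put in front calls for expansion along
  column 0, and deleting row \<open>i\<close> is omitting the \<open>i\<close>-th form. In this way
  the hat forms appear as the coefficients of the one-forms in the volume form.\<close>

lemma wedge_Laplace:
  assumes "length \<alpha>s = Suc n" "length ts = n"
  shows "wedge \<alpha>s (v # ts) = (\<Sum>i<Suc n. (\<alpha>s ! i) v * ((-1) ^ i * wedge (omit i \<alpha>s) ts))"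
proof -
  let ?A = "Matrix.mat (Suc n) (Suc n) (\<lambda>(i, j). (\<alpha>s ! i) ((v # ts) ! j))"
  have A: "?A \<in> carrier_mat (Suc n) (Suc n)"
    by simp
  have "Determinant.cofactor ?A i 0 = (-1) ^ i * wedge (omit i \<alpha>s) ts" if "i < Suc n" for i
  proof -
    have len: "length (omit i \<alpha>s) = n"
      using that assms by (simp add: omit_def)
    have "mat_delete ?A i 0 = Matrix.mat n n (\<lambda>(a, b). (omit i \<alpha>s ! a) (ts ! b))"
      using that assms by (intro eq_matI) (auto simp: mat_delete_def omit_def nth_append)
    then show ?thesis
      by (simp add: cofactor_def wedge_eq_det[OF len assms(2)])
  qed
  moreover have "wedge \<alpha>s (v # ts) = Determinant.det ?A"
    using assms by (intro wedge_eq_det) auto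
  ultimately show ?thesis
    using laplace_expansion_column[OF A, of 0] by (auto intro!: sum.cong)
qed

lemma length_concat_pairs: "length (concat (map (\<lambda>k. [f k, g k]) xs)) = 2 * length xs"
  by (induction xs) auto

lemma length_zforms: "length (zforms p) = 4 * p"
  unfolding zforms_def length_concat_pairs by simp

lemma concat_pairs_nth:
  assumes "j < length xs"
  shows "concat (map (\<lambda>k. [f k, g k]) xs) ! (2 * j) = f (xs ! j)"
    "concat (map (\<lambda>k. [f k, g k]) xs) ! Suc (2 * j) = g (xs ! j)"
  using assms
proof (induction xs arbitrary: j)
  case (Cons x xs)
  {
    case 1
    with Cons show ?case by (cases j) auto
  next
    case 2
    with Cons show ?case by (cases j) auto
  }
qed auto

lemma zforms_nth:
  assumes "j < 2 * p"
  shows "zforms p ! (2 * j) = zc (Suc j)" "zforms p ! Suc (2 * j) = zcc (Suc j)"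
  using assms by (simp_all add: zforms_def concat_pairs_nth del: upt_Suc)

lemma sorted_nth_idx: "j < CARD('m) \<Longrightarrow> sorted_list_of_set (UNIV :: 'm::{finite,linorder} set) ! j = idx (Suc j)"
  by (simp add: idx_def)

lemma bij_betw_idx: "bij_betw (\<lambda>j. idx (Suc j) :: 'm::{finite,linorder}) {..<CARD('m)} UNIV"
proof -
  have "inj_on (\<lambda>j. idx (Suc j) :: 'm) {..<CARD('m)}"
    by (intro inj_onI) (simp add: idx_inj)
  moreover from this have "(\<lambda>j. idx (Suc j) :: 'm) ` {..<CARD('m)} = UNIV"
    by (intro card_subset_eq) (auto simp: card_image)
  ultimately show ?thesis
    by (simp add: bij_betw_def)
qed

lemma vol_form_eq_det:
  fixes ts :: "('m::{finite,linorder} point) list"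
  assumes "length ts = CARD('m)"
  shows "vol_form ts = Determinant.det (Matrix.mat CARD('m) CARD('m) (\<lambda>(i, j). ts ! j $ idx (Suc i)))"
proof -
  have "Matrix.mat CARD('m) CARD('m) (\<lambda>(i, j). (map (\<lambda>i X. X $ i) (sorted_list_of_set UNIV) ! i) (ts ! j))
     = (Matrix.mat CARD('m) CARD('m) (\<lambda>(i, j). ts ! j $ idx (Suc i)) :: real mat)"
    by (intro eq_matI) (auto simp: sorted_nth_idx)
  then show ?thesis
    unfolding vol_form_def by (subst wedge_eq_det[where n = "CARD('m)"]) (use assms in auto)
qed

text \<open>The matrix expressing \<open>z\<^sub>k, z\<^sub>k\<^sup>c\<close> through \<open>x\<^sub>k, y\<^sub>k\<close>.\<close>

definition zmat :: "nat \<Rightarrow> complex mat" where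
  "zmat n = Matrix.mat (2 * n) (2 * n) (\<lambda>(i, j). if i div 2 \<noteq> j div 2 then 0
     else if even j then 1 else if even i then \<i> else - \<i>)"

lemma zmat_Suc:
  "zmat (Suc n) = four_block_mat (zmat n) (0\<^sub>m (2 * n) 2) (0\<^sub>m 2 (2 * n)) (zmat 1)"
proof (rule eq_matI)
  fix i j
  assume "i < dim_row (four_block_mat (zmat n) (0\<^sub>m (2 * n) 2) (0\<^sub>m 2 (2 * n)) (zmat 1))"
    "j < dim_col (four_block_mat (zmat n) (0\<^sub>m (2 * n) 2) (0\<^sub>m 2 (2 * n)) (zmat 1))"
  then have ij: "i < 2 * n + 2" "j < 2 * n + 2"
    by (auto simp: zmat_def)
  have d: "l div 2 < n" if "l < 2 * n" for l
    using that by auto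
  have e: "l div 2 = n \<and> (l - 2 * n) div 2 = 0 \<and> (even (l - 2 * n) \<longleftrightarrow> even l)"
    if "\<not> l < 2 * n" "l < 2 * n + 2" for l
    using that by presburger
  show "zmat (Suc n) $$ (i, j)
      = four_block_mat (zmat n) (0\<^sub>m (2 * n) 2) (0\<^sub>m 2 (2 * n)) (zmat 1) $$ (i, j)"
    using ij d[of i] d[of j] e[of i] e[of j]
    by (cases "i < 2 * n"; cases "j < 2 * n") (simp_all add: zmat_def)
qed (auto simp: zmat_def)

text \<open>One diagonal block with rows (1, i) and (1, -i), of determinant -2i, for each complex
  coordinate. This is where the normalisation of the representation formulae comes from.\<close>

lemma det_zmat: "Determinant.det (zmat n) = (- 2 * \<i>) ^ n"
proof (induction n)
  case 0
  then show ?case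
    by (simp add: zmat_def)
next
  case (Suc n)
  have "Determinant.det (zmat 1) = - 2 * \<i>"
    by (subst laplace_expansion_row[where i = 0 and n = 2])
      (auto simp: zmat_def cofactor_def mat_delete_def lessThan_Suc numeral_2_eq_2 det_single)
  moreover have "Determinant.det (zmat (Suc n)) = Determinant.det (zmat n) * Determinant.det (zmat 1)"
    unfolding zmat_Suc
    by (rule det_four_block_mat_lower_left_zero[where n = "2 * n" and m = 2]) (auto simp: zmat_def)
  ultimately show ?case
    using Suc by simp
qed

text \<open>The matrix of the forms \<open>zc k\<close>, \<open>zcc k\<close> on the vectors is
  \<open>zmat\<close> times the real coordinate matrix, so the two determinants multiply.\<close>

lemma wedge_zforms:
  fixes ts :: "('m::{finite,linorder} point) list"
  assumes m: "CARD('m) = 4 * p" and ts: "length ts = CARD('m)"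
  shows "wedge (zforms p) ts = (- 2 * \<i>) ^ (2 * p) * complex_of_real (vol_form ts)"
proof -
  let ?n = "4 * p"
  let ?V = "Matrix.mat ?n ?n (\<lambda>(i, j). ts ! j $ idx (Suc i))"
  have "Matrix.mat ?n ?n (\<lambda>(i, j). (zforms p ! i) (ts ! j)) = zmat (2 * p) * map_mat complex_of_real ?V"
    (is "?L = ?R")
  proof (rule eq_matI)
    fix i j assume "i < dim_row ?R" "j < dim_col ?R"
    then have ij: "i < ?n" "j < ?n"
      by (auto simp: zmat_def)
    define q where "q = i div 2"
    have q: "q < 2 * p" "i = 2 * q \<or> i = Suc (2 * q)"
      using ij unfolding q_def by auto
    have "?R $$ (i, j) = (\<Sum>l<?n. zmat (2 * p) $$ (i, l) * complex_of_real (ts ! j $ idx (Suc l)))"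
      using ij by (simp add: times_mat_def scalar_prod_def zmat_def lessThan_atLeast0)
    \<comment> \<open>Row \<open>i\<close> of \<open>zmat\<close> is supported on the two columns of
      its block, the real and the imaginary part of one coordinate.\<close>
    also have "\<dots> = (\<Sum>l\<in>{2 * q, Suc (2 * q)}. zmat (2 * p) $$ (i, l) * complex_of_real (ts ! j $ idx (Suc l)))"
      by (rule sum.mono_neutral_right) (use ij q in \<open>auto simp: zmat_def q_def\<close>)
    also have "\<dots> = (zforms p ! i) (ts ! j)"
      using q ij by (auto simp: zforms_nth zc_def zcc_def zmat_def complex_eq_iff)
    finally show "?L $$ (i, j) = ?R $$ (i, j)"
      using ij by simp
  qed (auto simp: zmat_def)
  then have "wedge (zforms p) ts = Determinant.det (zmat (2 * p) * map_mat complex_of_real ?V)"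
    using m ts by (subst wedge_eq_det[where n = ?n]) (simp_all add: length_zforms)
  also have "\<dots> = Determinant.det (zmat (2 * p)) * Determinant.det (map_mat complex_of_real ?V)"
    by (rule det_mult[where n = ?n]) (auto simp: zmat_def)
  also have "Determinant.det (map_mat complex_of_real ?V) = complex_of_real (Determinant.det ?V)"
    by (rule of_real_hom.hom_det)
  finally show ?thesis
    by (simp add: det_zmat vol_form_eq_det ts m)
qed

lemma zc_axis:
  assumes "CARD('m) = 4 * p" "k \<in> {1..2 * p}" "l \<in> {1..2 * p}"
  shows "zc k (axis (idx (2 * l - 1)) 1 :: 'm::{finite,linorder} point) = (if k = l then 1 else 0)"
    "zc k (axis (idx (2 * l)) 1 :: 'm point) = (if k = l then \<i> else 0)"
proof -
  have idx: "(idx a :: 'm) = idx b \<longleftrightarrow> a = b" if "a \<in> {1..4 * p}" "b \<in> {1..4 * p}" for a b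
    using idx_inj[where 'm = 'm, of a b] that assms(1) by simp
  then have "(idx (2 * k - 1) :: 'm) = idx (2 * l - 1) \<longleftrightarrow> k = l" "(idx (2 * k) :: 'm) = idx (2 * l) \<longleftrightarrow> k = l"
    "(idx (2 * k) :: 'm) \<noteq> idx (2 * l - 1)" "(idx (2 * k - 1) :: 'm) \<noteq> idx (2 * l)"
  proof -
    have r: "2 * k \<in> {1..4 * p}" "2 * l \<in> {1..4 * p}" "2 * k - 1 \<in> {1..4 * p}" "2 * l - 1 \<in> {1..4 * p}"
      using assms(2,3) by auto
    have "2 * k - 1 = 2 * l - 1 \<longleftrightarrow> k = l" "2 * k \<noteq> 2 * l - 1" "2 * k - 1 \<noteq> 2 * l"
      using assms(2,3) by (simp; presburger)+
    then show "(idx (2 * k - 1) :: 'm) = idx (2 * l - 1) \<longleftrightarrow> k = l" "(idx (2 * k) :: 'm) = idx (2 * l) \<longleftrightarrow> k = l"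
      "(idx (2 * k) :: 'm) \<noteq> idx (2 * l - 1)" "(idx (2 * k - 1) :: 'm) \<noteq> idx (2 * l)"
      using idx[OF r(3,4)] idx[OF r(1,2)] idx[OF r(1,4)] idx[OF r(3,2)] by simp_all
  qed
  then show "zc k (axis (idx (2 * l - 1)) 1 :: 'm point) = (if k = l then 1 else 0)"
    "zc k (axis (idx (2 * l)) 1 :: 'm point) = (if k = l then \<i> else 0)"
    by (auto simp: zc_def axis_def complex_eq_iff)
qed

lemma sum_pairs: "(\<Sum>k=1..2*p. f k) = (\<Sum>j=1..p. f (2 * j - 1) + f (2 * j) :: 'a::ab_group_add)" for p :: nat
  by (induction p) (auto simp: algebra_simps)

lemma sum_Basis_idx:
  fixes f :: "'m::{finite,linorder} point \<Rightarrow> 'a::ab_group_add"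
  assumes "CARD('m) = 4 * p"
  shows "(\<Sum>b\<in>Basis. f b) = (\<Sum>k=1..2*p. f (axis (idx (2 * k - 1)) 1) + f (axis (idx (2 * k)) 1))"
proof -
  have "(\<Sum>b\<in>Basis. f b) = (\<Sum>i\<in>UNIV. f (axis i 1))"
  proof -
    have B: "(Basis :: 'm point set) = range (\<lambda>i. axis i 1)" and i: "inj (\<lambda>i::'m. axis i (1::real))"
      by (auto simp: Basis_vec_def inj_on_def axis_eq_axis)
    show ?thesis
      unfolding B using sum.reindex[OF i, of f] by simp
  qed
  also have "\<dots> = (\<Sum>j<4 * p. f (axis (idx (Suc j)) 1))"
    using sum.reindex_bij_betw[OF bij_betw_idx[where 'm = 'm], of "\<lambda>i. f (axis i 1)"] assms by simp
  also have "\<dots> = (\<Sum>k=1..2 * (2 * p). f (axis (idx k) 1))"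
    by (simp add: sum.atLeast1_atMost_eq)
  finally show ?thesis
    unfolding sum_pairs .
qed

text \<open>Laplace expansion writes \<open>N * vol_form (v # ts)\<close> as a combination of
  \<open>zc k v\<close> and \<open>zcc k v\<close> whose coefficients are the hat forms up to sign.
  Evaluating at the two coordinate vectors of the \<open>j\<close>-th complex coordinate gives two
  linear equations for the two coefficients; solving them costs the factor 1/2.\<close>

lemma hat_forms:
  fixes ts :: "('m::{finite,linorder} point) list"
  assumes m: "CARD('m) = 4 * p" and ts: "Suc (length ts) = CARD('m)" and j: "j \<in> {1..2 * p}"
  shows "hat_dz p j ts = (- 2 * \<i>) ^ (2 * p) / 2 * (\<Sum>b\<in>Basis. vol_form (b # ts) * zcc j b)"
    and "- hat_dzc p j ts = (- 2 * \<i>) ^ (2 * p) / 2 * (\<Sum>b\<in>Basis. vol_form (b # ts) * zc j b)"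
proof -
  define N where "N = (- 2 * \<i>) ^ (2 * p)"
  define W where "W i = (-1) ^ i * wedge (omit i (zforms p)) ts" for i
  have "N * vol_form (v # ts) = (\<Sum>i<4 * p. (zforms p ! i) v * W i)" for v
    using wedge_Laplace[of "zforms p" "length ts" ts v] wedge_zforms[OF m, of "v # ts"] ts m
    by (simp add: length_zforms N_def W_def)
  also have "(\<Sum>i<4 * p. (zforms p ! i) v * W i)
      = (\<Sum>k=1..2*p. zc k v * W (2 * k - 2) + zcc k v * W (2 * k - 1))" for v
  proof -
    have "(\<Sum>i<4 * p. (zforms p ! i) v * W i) = (\<Sum>i=1..2 * (2 * p). (zforms p ! (i - 1)) v * W (i - 1))"
      by (simp add: sum.atLeast1_atMost_eq)
    also have "\<dots> = (\<Sum>k=1..2*p. zc k v * W (2 * k - 2) + zcc k v * W (2 * k - 1))"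
    proof (subst sum_pairs[of _ "2 * p"], rule sum.cong)
      fix k assume "k \<in> {1..2*p}"
      then obtain q where q: "k = Suc q" "q < 2 * p"
        by (cases k) auto
      then show "(zforms p ! (2 * k - 1 - 1)) v * W (2 * k - 1 - 1) + (zforms p ! (2 * k - 1)) v * W (2 * k - 1)
        = zc k v * W (2 * k - 2) + zcc k v * W (2 * k - 1)"
        by (simp add: zforms_nth)
    qed simp
    finally show ?thesis .
  qed
  finally have V: "N * vol_form (v # ts) = (\<Sum>k=1..2*p. zc k v * W (2 * k - 2) + zcc k v * W (2 * k - 1))" for v .
  have 1: "N * vol_form (axis (idx (2 * j - 1)) 1 # ts) = W (2 * j - 2) + W (2 * j - 1)"
  proof -
    have "N * vol_form (axis (idx (2 * j - 1)) 1 # ts)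
       = (\<Sum>k=1..2*p. if k = j then W (2 * k - 2) + W (2 * k - 1) else 0)"
      unfolding V zcc_def by (intro sum.cong) (simp_all only: zc_axis[OF m _ j], auto)
    then show ?thesis
      using j by simp
  qed
  have 2: "N * vol_form (axis (idx (2 * j)) 1 # ts) = \<i> * W (2 * j - 2) - \<i> * W (2 * j - 1)"
  proof -
    have "N * vol_form (axis (idx (2 * j)) 1 # ts)
       = (\<Sum>k=1..2*p. if k = j then \<i> * W (2 * k - 2) - \<i> * W (2 * k - 1) else 0)"
      unfolding V zcc_def by (intro sum.cong) (simp_all only: zc_axis[OF m _ j], auto)
    then show ?thesis
      using j by simp
  qed
  \<comment> \<open>Counted from 0, \<open>zc j\<close> stands at the even position
    \<open>2 * j - 2\<close> and \<open>zcc j\<close> at the odd position \<open>2 * j - 1\<close>.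
    Hence the minus sign in the dagger forms.\<close>
  have "(-1) ^ (2 * j - 2) = (1::complex)" "(-1) ^ (2 * j - 1) = (-1::complex)"
    using j by (simp_all add: uminus_power_if)
  then have W: "W (2 * j - 2) = hat_dz p j ts" "W (2 * j - 1) = - hat_dzc p j ts"
    by (simp_all add: W_def hat_dz_def hat_dzc_def)
  \<comment> \<open>Only the two coordinate vectors of the \<open>j\<close>-th complex coordinate
    contribute. The map \<open>f\<close> is used for conjugation and for the identity.\<close>
  have S: "(\<Sum>b\<in>Basis. vol_form (b # ts) * f (zc j b))
    = vol_form (axis (idx (2 * j - 1)) 1 # ts) * f 1 + vol_form (axis (idx (2 * j)) 1 # ts) * f \<i>"
    if "f 0 = 0" for f :: "complex \<Rightarrow> complex"
  proof -
    have "(\<Sum>b\<in>Basis. vol_form (b # ts) * f (zc j b))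
      = (\<Sum>l=1..2*p. if l = j then vol_form (axis (idx (2 * l - 1)) 1 # ts) * f 1
           + vol_form (axis (idx (2 * l)) 1 # ts) * f \<i> else 0)"
      unfolding sum_Basis_idx[OF m] using that
      by (intro sum.cong) (simp_all only: zc_axis[OF m j], auto)
    then show ?thesis
      using j by simp
  qed
  have "N / 2 * (\<Sum>b\<in>Basis. vol_form (b # ts) * cnj (zc j b)) = W (2 * j - 2)"
  proof -
    have "N / 2 * (\<Sum>b\<in>Basis. vol_form (b # ts) * cnj (zc j b))
       = (N * vol_form (axis (idx (2 * j - 1)) 1 # ts) - \<i> * (N * vol_form (axis (idx (2 * j)) 1 # ts))) / 2"
      unfolding S[of cnj, OF complex_cnj_zero] by (simp add: algebra_simps)
    also have "\<dots> = W (2 * j - 2)"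
      unfolding 1 2 by (simp add: algebra_simps)
    finally show ?thesis .
  qed
  then show "hat_dz p j ts = (- 2 * \<i>) ^ (2 * p) / 2 * (\<Sum>b\<in>Basis. vol_form (b # ts) * zcc j b)"
    by (simp only: W N_def zcc_def)
  have "N / 2 * (\<Sum>b\<in>Basis. vol_form (b # ts) * zc j b) = W (2 * j - 1)"
  proof -
    have "N / 2 * (\<Sum>b\<in>Basis. vol_form (b # ts) * zc j b)
       = (N * vol_form (axis (idx (2 * j - 1)) 1 # ts) + \<i> * (N * vol_form (axis (idx (2 * j)) 1 # ts))) / 2"
      unfolding S[of "\<lambda>x. x", OF refl] by (simp add: algebra_simps)
    also have "\<dots> = W (2 * j - 1)"
      unfolding 1 2 by (simp add: algebra_simps)
    finally show ?thesis .
  qed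
  then show "- hat_dzc p j ts = (- 2 * \<i>) ^ (2 * p) / 2 * (\<Sum>b\<in>Basis. vol_form (b # ts) * zc j b)"
    by (simp only: W N_def)
qed

section \<open>The real volume form on the tangent frame of a graph\<close>

lemma vol_form_linear:
  fixes ts :: "('m::{finite,linorder} point) list"
  assumes "Suc (length ts) = CARD('m)"
  shows "linear (\<lambda>v. vol_form (v # ts))"
proof -
  let ?xs = "map (\<lambda>i X. X $ i) (sorted_list_of_set (UNIV :: 'm set)) :: ('m point \<Rightarrow> real) list"
  have "vol_form (v # ts) = (\<Sum>i<Suc (length ts). v $ idx (Suc i) * ((-1) ^ i * wedge (omit i ?xs) ts))" for v
    unfolding vol_form_def using assms
    by (subst wedge_Laplace[where n = "length ts"]) (auto intro!: sum.cong simp: sorted_nth_idx)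
  then show ?thesis
    by (auto intro!: linearI simp: algebra_simps sum.distrib sum_distrib_left simp del: sum.lessThan_Suc)
qed

lemma vol_form_repeated:
  fixes ts :: "('m::{finite,linorder} point) list"
  assumes "Suc (length ts) = CARD('m)" "v \<in> set ts"
  shows "vol_form (v # ts) = 0"
proof -
  obtain j where "j < length ts" "ts ! j = v"
    using assms(2) by (auto simp: in_set_conv_nth)
  then show ?thesis
    using assms by (subst vol_form_eq_det)
      (auto intro!: Determinant.det_identical_columns[where i = 0 and j = "Suc j" and n = "CARD('m)"] simp: Matrix.col_def)
qed

lemma sum_idx: "(\<Sum>i=0..<CARD('m). f (idx (Suc i))) = (\<Sum>i\<in>UNIV. f (i :: 'm::{finite,linorder}))"
  using sum.reindex_bij_betw[OF bij_betw_idx[where 'm = 'm], of f] by (simp add: lessThan_atLeast0)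

lemma vol_form_orthonormal:
  fixes ws :: "('m::{finite,linorder} point) list"
  assumes ws: "length ws = CARD('m)"
    "\<And>i j. i < CARD('m) \<Longrightarrow> j < CARD('m) \<Longrightarrow> ws ! i \<bullet> ws ! j = (if i = j then 1 else 0)"
  shows "\<bar>vol_form ws\<bar> = 1"
proof -
  let ?A = "Matrix.mat CARD('m) CARD('m) (\<lambda>(i, j). ws ! j $ idx (Suc i))"
  have "transpose_mat ?A * ?A = 1\<^sub>m CARD('m)"
  proof (rule eq_matI)
    fix i j assume "i < dim_row (1\<^sub>m CARD('m))" "j < dim_col (1\<^sub>m CARD('m) :: real mat)"
    then have ij: "i < CARD('m)" "j < CARD('m)"
      by auto
    then have "(transpose_mat ?A * ?A) $$ (i, j) = (\<Sum>l=0..<CARD('m). ws ! i $ idx (Suc l) * ws ! j $ idx (Suc l))"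
      by (simp add: times_mat_def Matrix.scalar_prod_def)
    also have "\<dots> = ws ! i \<bullet> ws ! j"
      using sum_idx[of "\<lambda>l. ws ! i $ l * ws ! j $ l"] by (simp add: inner_vec_def)
    finally show "(transpose_mat ?A * ?A) $$ (i, j) = (1\<^sub>m CARD('m) :: real mat) $$ (i, j)"
      using ij ws(2) by simp
  qed auto
  moreover have "Determinant.det (transpose_mat ?A * ?A) = Determinant.det (transpose_mat ?A) * Determinant.det ?A"
    by (rule det_mult[where n = "CARD('m)"]) auto
  moreover have "Determinant.det (transpose_mat ?A) = Determinant.det ?A"
    by (rule Determinant.det_transpose[where n = "CARD('m)"]) auto
  ultimately have "vol_form ws * vol_form ws = 1"
    using ws(1) by (simp add: vol_form_eq_det)
  then show ?thesis
    using abs_square_eq_1[of "vol_form ws"] by (simp add: power2_eq_square)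
qed

text \<open>Adding multiples of \<open>k\<close> to the other columns is right multiplication by a
  unitriangular matrix whose off-diagonal entries all lie in row 0. The tangent frame of a graph
  arises from the frame of the hyperplane in this way.\<close>

lemma vol_form_shear:
  fixes k :: "'m::{finite,linorder} point"
  assumes "Suc (length fr) = CARD('m)"
  shows "vol_form (k # map (\<lambda>b. b + c b *\<^sub>R k) fr) = vol_form (k # fr)"
proof -
  let ?m = "CARD('m)" and ?ts = "k # map (\<lambda>b. b + c b *\<^sub>R k) fr" and ?ws = "k # fr"
  let ?A = "\<lambda>ts. Matrix.mat ?m ?m (\<lambda>(i, j). ts ! j $ idx (Suc i)) :: real mat"
  let ?U = "Matrix.mat ?m ?m (\<lambda>(i, j). if i = j then 1 else if i = 0 then c (?ws ! j) else 0) :: real mat"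
  have "?A ?ts = ?A ?ws * ?U"
  proof (rule eq_matI)
    fix i j assume "i < dim_row (?A ?ws * ?U)" "j < dim_col (?A ?ws * ?U)"
    then have ij: "i < ?m" "j < ?m"
      by auto
    have "(?A ?ws * ?U) $$ (i, j)
       = (\<Sum>l=0..<?m. ?ws ! l $ idx (Suc i) * (if l = j then 1 else if l = 0 then c (?ws ! j) else 0))"
      using ij by (simp add: times_mat_def Matrix.scalar_prod_def)
    also have "\<dots> = (\<Sum>l=0..<?m. (if l = j then ?ws ! j $ idx (Suc i) else 0)
         + (if l = 0 then if j = 0 then 0 else ?ws ! 0 $ idx (Suc i) * c (?ws ! j) else 0))"
      by (intro sum.cong) auto
    also have "\<dots> = ?ts ! j $ idx (Suc i)"
      using ij assms unfolding sum.distrib by (cases j) (simp_all add: algebra_simps)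
    finally show "?A ?ts $$ (i, j) = (?A ?ws * ?U) $$ (i, j)"
      using ij by simp
  qed auto
  moreover have "Determinant.det (?A ?ws * ?U) = Determinant.det (?A ?ws) * Determinant.det ?U"
    by (rule det_mult[where n = ?m]) auto
  moreover have "Determinant.det ?U = 1"
  proof -
    have "upper_triangular ?U"
      by auto
    then have "Determinant.det ?U = prod_list (diag_mat ?U)"
      by (rule det_upper_triangular[where n = ?m]) auto
    also have "diag_mat ?U = map (\<lambda>_. 1) [0..<?m]"
      by (auto simp: diag_mat_def)
    finally show ?thesis
      by (simp add: map_replicate_const)
  qed
  ultimately show ?thesis
    using assms by (simp add: vol_form_eq_det)
qed

lemma hyperplane_frame_props:
  fixes k :: "'m::{finite,linorder} point"
  assumes "k \<in> Basis \<union> uminus ` Basis"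
  shows "distinct (hyperplane_frame k)" "set (hyperplane_frame k) = {b \<in> Basis. b \<bullet> k = 0}"
    "Suc (length (hyperplane_frame k)) = CARD('m)"
proof -
  have "inj_on (\<lambda>i::'m. axis i (1::real)) (set (sorted_list_of_set UNIV))"
    by (auto simp: inj_on_def axis_eq_axis)
  then show d: "distinct (hyperplane_frame k)"
    unfolding hyperplane_frame_def by (simp add: distinct_map)
  show s: "set (hyperplane_frame k) = {b \<in> Basis. b \<bullet> k = 0}"
    unfolding hyperplane_frame_def by (auto simp: Basis_vec_def)
  obtain b0 where b0: "b0 \<in> Basis" "k = b0 \<or> k = - b0"
    using assms by auto
  then have "{b \<in> Basis. b \<bullet> k = 0} = Basis - {b0}"
    by (auto simp: inner_Basis)
  then have "card {b \<in> Basis. b \<bullet> k = 0} = CARD('m) - 1"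
    using b0 by (simp add: card_Diff_singleton)
  moreover have "card {b \<in> Basis. b \<bullet> k = 0} = length (hyperplane_frame k)"
    using distinct_card[OF d] s by simp
  ultimately show "Suc (length (hyperplane_frame k)) = CARD('m)"
    by simp
qed

text \<open>\<open>k - \<nabla>\<gamma>\<close> is orthogonal to the graph and has component \<open>1\<close> along \<open>k\<close>, so the expansion of \<open>v\<close>
  in the frame \<open>k, ts\<close> shows that inserting \<open>v\<close> into the volume form gives \<open>v \<bullet> (k - \<nabla>\<gamma>)\<close>.\<close>

lemma vol_form_graph_frame:
  fixes k v :: "'m::{finite,linorder} point"
  assumes k: "k \<in> Basis \<union> uminus ` Basis" and L: "linear L"
  defines "ts \<equiv> map (\<lambda>b. b + L b *\<^sub>R k) (hyperplane_frame k)"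
  shows "sgn (vol_form (k # ts)) * vol_form (v # ts) = v \<bullet> k - L (v - (v \<bullet> k) *\<^sub>R k)"
proof -
  note fr = hyperplane_frame_props[OF k]
  let ?F = "{b \<in> Basis. b \<bullet> k = 0} :: 'm point set"
  interpret V: linear "\<lambda>v. vol_form (v # ts)"
    by (rule vol_form_linear) (simp add: ts_def fr)
  obtain b0 where b0: "b0 \<in> Basis" "k = b0 \<or> k = - b0"
    using k by auto
  then have F: "?F = Basis - {b0}" and kk: "k \<bullet> k = 1"
    by (auto simp: inner_Basis)
  have v: "v - (v \<bullet> k) *\<^sub>R k = (\<Sum>b\<in>?F. (v \<bullet> b) *\<^sub>R b)"
  proof -
    have B: "(\<Sum>b\<in>Basis. h b) = h b0 + (\<Sum>b\<in>?F. h b)" for h :: "'m point \<Rightarrow> 'm point"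
      unfolding F by (rule sum.remove[OF finite_Basis b0(1)])
    have e: "(v \<bullet> b0) *\<^sub>R b0 + (\<Sum>b\<in>?F. (v \<bullet> b) *\<^sub>R b) = v"
      using euclidean_representation[of v] unfolding B[of "\<lambda>b. (v \<bullet> b) *\<^sub>R b"] .
    have "v - (v \<bullet> b0) *\<^sub>R b0 = (\<Sum>b\<in>?F. (v \<bullet> b) *\<^sub>R b)"
      using arg_cong[OF e, of "\<lambda>x. x - (v \<bullet> b0) *\<^sub>R b0"] by (simp only: add_diff_cancel_left')
    moreover have "(v \<bullet> k) *\<^sub>R k = (v \<bullet> b0) *\<^sub>R b0"
      using b0(2) by auto
    ultimately show ?thesis
      by simp
  qed
  \<comment> \<open>Expansion of \<open>v\<close> in the basis \<open>k, ts\<close>: the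
    coefficients along \<open>ts\<close> are those of the projection to the hyperplane, and the
    coefficient of \<open>k\<close> is corrected by the \<open>k\<close>-parts of the sheared
    vectors.\<close>
  have "vol_form (v # ts) = vol_form (((v \<bullet> k - (\<Sum>b\<in>?F. (v \<bullet> b) * L b)) *\<^sub>R k
      + (\<Sum>b\<in>?F. (v \<bullet> b) *\<^sub>R (b + L b *\<^sub>R k))) # ts)"
  proof -
    have "(\<Sum>b\<in>?F. (v \<bullet> b) *\<^sub>R (b + L b *\<^sub>R k))
        = (v - (v \<bullet> k) *\<^sub>R k) + (\<Sum>b\<in>?F. (v \<bullet> b) * L b) *\<^sub>R k"
      unfolding v by (simp add: scaleR_right_distrib sum.distrib scaleR_sum_left)
    then show ?thesis
      by (simp add: scaleR_diff_left)
  qed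
  also have "\<dots> = (v \<bullet> k - (\<Sum>b\<in>?F. (v \<bullet> b) * L b)) * vol_form (k # ts)
      + (\<Sum>b\<in>?F. (v \<bullet> b) * vol_form ((b + L b *\<^sub>R k) # ts))"
    by (simp add: V.add V.scale V.sum del: scaleR_add_right)
  also have "(\<Sum>b\<in>?F. (v \<bullet> b) * vol_form ((b + L b *\<^sub>R k) # ts)) = 0"
  proof (rule sum.neutral, rule ballI)
    fix b assume "b \<in> ?F"
    then have "b + L b *\<^sub>R k \<in> set ts"
      by (auto simp: ts_def fr)
    then show "(v \<bullet> b) * vol_form ((b + L b *\<^sub>R k) # ts) = 0"
      by (simp add: vol_form_repeated ts_def fr)
  qed
  also have "(\<Sum>b\<in>?F. (v \<bullet> b) * L b) = L (v - (v \<bullet> k) *\<^sub>R k)"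
    unfolding v by (simp add: linear_sum[OF L] linear_scale[OF L])
  finally have "vol_form (v # ts) = (v \<bullet> k - L (v - (v \<bullet> k) *\<^sub>R k)) * vol_form (k # ts)"
    by simp
  \<comment> \<open>Because the modulus is 1, the orientation sign is the inverse of this
    determinant and cancels it exactly; no density factor is left over.\<close>
  moreover have "\<bar>vol_form (k # ts)\<bar> = 1"
  proof -
    have *: "hyperplane_frame k ! i \<in> Basis" "hyperplane_frame k ! i \<bullet> k = 0"
      if "Suc i < CARD('m)" for i
    proof -
      have "hyperplane_frame k ! i \<in> ?F"
        using fr(2,3) that by (metis Suc_less_eq nth_mem)
      then show "hyperplane_frame k ! i \<in> Basis" "hyperplane_frame k ! i \<bullet> k = 0"
        by auto
    qed
    have "(k # hyperplane_frame k) ! i \<bullet> (k # hyperplane_frame k) ! j = (if i = j then 1 else 0)"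
      if "i < CARD('m)" "j < CARD('m)" for i j
    proof (cases i; cases j)
      fix i' j' assume ij: "i = Suc i'" "j = Suc j'"
      then have "hyperplane_frame k ! i' = hyperplane_frame k ! j' \<longleftrightarrow> i' = j'"
        using that fr by (intro nth_eq_iff_index_eq) auto
      then show ?thesis
        using *(1)[of i'] *(1)[of j'] ij that by (simp add: inner_Basis)
    qed (use that * kk in \<open>auto simp: inner_commute\<close>)
    then have "\<bar>vol_form (k # hyperplane_frame k)\<bar> = 1"
      by (intro vol_form_orthonormal) (auto simp: fr)
    then show ?thesis
      unfolding ts_def by (subst vol_form_shear) (auto simp: fr)
  qed
  ultimately show ?thesis
    by (auto simp: sgn_real_def abs_real_def split: if_splits)
qed


section \<open>Continuously differentiable functions\<close>

abbreviation D_at ("\<D>") where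
  "\<D> f x \<equiv> frechet_derivative f (at x)"

text \<open>Equivalent to \<open>Ck_on 1\<close>, but with the derivative as a witness, so that
  closure properties follow directly from the \<open>has_derivative\<close> rules. Continuity of the
  derivative is required one direction at a time, which in finite dimension amounts to continuity in
  operator norm.\<close>

definition C1_on :: "'a::euclidean_space set \<Rightarrow> ('a \<Rightarrow> 'b::real_normed_vector) \<Rightarrow> bool" where
  "C1_on S f \<longleftrightarrow> (\<exists>f'. (\<forall>x\<in>S. (f has_derivative f' x) (at x)) \<and> (\<forall>h. continuous_on S (\<lambda>x. f' x h)))"

lemma C1_onI:
  assumes "\<And>x. x \<in> S \<Longrightarrow> (f has_derivative f' x) (at x)" "\<And>h. continuous_on S (\<lambda>x. f' x h)"
  shows "C1_on S f"
  using assms unfolding C1_on_def by blast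

lemma C1_onE:
  assumes "C1_on S f"
  obtains f' where "\<And>x. x \<in> S \<Longrightarrow> (f has_derivative f' x) (at x)" "\<And>h. continuous_on S (\<lambda>x. f' x h)"
  using assms unfolding C1_on_def by blast

lemma C1_on_has_derivative:
  "C1_on S f \<Longrightarrow> x \<in> S \<Longrightarrow> (f has_derivative \<D> f x) (at x)"
  unfolding C1_on_def using frechet_derivative_works differentiable_def by blast

lemma C1_on_continuous_derivative:
  assumes "C1_on S f"
  shows "continuous_on S (\<lambda>x. \<D> f x h)"
proof -
  obtain f' where f': "\<And>x. x \<in> S \<Longrightarrow> (f has_derivative f' x) (at x)" "continuous_on S (\<lambda>x. f' x h)"
    using assms by (rule C1_onE) blast
  have "\<D> f x h = f' x h" if "x \<in> S" for x
    using frechet_derivative_at[OF f'(1)[OF that]] by simp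
  then show ?thesis
    using f'(2) by (simp cong: continuous_on_cong)
qed

lemma C1_on_continuous: "C1_on S f \<Longrightarrow> continuous_on S f"
  by (meson C1_on_has_derivative continuous_at_imp_continuous_on has_derivative_continuous)

lemma Ck_on_1_iff: "Ck_on 1 S f \<longleftrightarrow> C1_on S f"
proof
  assume L: "Ck_on 1 S f"
  show "C1_on S f"
  proof (rule C1_onI)
    show d: "(f has_derivative \<D> f x) (at x)" if "x \<in> S" for x
      using L that by (simp add: frechet_derivative_works)
    show "continuous_on S (\<lambda>x. \<D> f x h)" for h
    proof -
      have "\<D> f x h = (\<Sum>b\<in>Basis. (h \<bullet> b) *\<^sub>R \<D> f x b)"
        if "x \<in> S" for x
      proof -
        interpret linear "\<D> f x"
          using d[OF that] has_derivative_linear by blast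
        have "\<D> f x (\<Sum>b\<in>Basis. (h \<bullet> b) *\<^sub>R b)
            = (\<Sum>b\<in>Basis. (h \<bullet> b) *\<^sub>R \<D> f x b)"
          by (simp only: sum scale)
        then show ?thesis
          by (simp only: euclidean_representation)
      qed
      moreover have "continuous_on S (\<lambda>x. \<Sum>b\<in>Basis. (h \<bullet> b) *\<^sub>R \<D> f x b)"
        using L by (intro continuous_intros) auto
      ultimately show ?thesis
        by (simp cong: continuous_on_cong)
    qed
  qed
next
  assume R: "C1_on S f"
  then show "Ck_on 1 S f"
    using C1_on_has_derivative[OF R] C1_on_continuous_derivative[OF R]
    by (auto simp: differentiable_def)
qed

lemma C1_on_subset: "C1_on S f \<Longrightarrow> T \<subseteq> S \<Longrightarrow> C1_on T f"
  unfolding C1_on_def by (meson continuous_on_subset subsetD)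

lemma C1_on_bilinear:
  assumes "bounded_bilinear mul" and f: "C1_on S f" and g: "C1_on S g"
  shows "C1_on S (\<lambda>x. mul (f x) (g x))"
proof -
  interpret bounded_bilinear mul by fact
  show ?thesis
    by (rule C1_onI[OF FDERIV[OF C1_on_has_derivative[OF f] C1_on_has_derivative[OF g]]], assumption, assumption)
      (intro continuous_on_add continuous_on C1_on_continuous_derivative[OF f] C1_on_continuous_derivative[OF g]
        C1_on_continuous[OF f] C1_on_continuous[OF g])
qed

lemma C1_on_linear: "bounded_linear L \<Longrightarrow> C1_on S L"
  by (rule C1_onI[where f' = "\<lambda>x. L"]) (auto intro: bounded_linear_imp_has_derivative)

lemma C1_on_const: "C1_on S (\<lambda>x. c)"
  by (rule C1_onI[where f' = "\<lambda>x h. 0"]) auto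

lemma C1_on_id: "C1_on S (\<lambda>x. x)"
  by (rule C1_on_linear) (rule bounded_linear_ident)

lemma C1_on_compose:
  fixes f :: "'a::euclidean_space \<Rightarrow> 'b::euclidean_space"
  assumes "C1_on T g" "C1_on S f" "f ` S \<subseteq> T"
  shows "C1_on S (\<lambda>x. g (f x))"
proof -
  obtain f' where f': "\<And>x. x \<in> S \<Longrightarrow> (f has_derivative f' x) (at x)" "\<And>h. continuous_on S (\<lambda>x. f' x h)"
    using assms(2) by (rule C1_onE) blast
  obtain g' where g': "\<And>x. x \<in> T \<Longrightarrow> (g has_derivative g' x) (at x)" "\<And>h. continuous_on T (\<lambda>x. g' x h)"
    using assms(1) by (rule C1_onE) blast
  show ?thesis
  proof (rule C1_onI)
    show "((\<lambda>x. g (f x)) has_derivative (\<lambda>h. g' (f x) (f' x h))) (at x)" if "x \<in> S" for x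
      using has_derivative_compose[OF f'(1)[OF that] g'(1)] that assms(3) by blast
    \<comment> \<open>Here both the base point and the direction vary with \<open>x\<close>, whereas
      continuity of \<open>g'\<close> is known for fixed directions only. Expanding the direction in
      the basis leaves finitely many fixed directions.\<close>
    have "g' (f x) (f' x h) = (\<Sum>b\<in>Basis. (f' x h \<bullet> b) *\<^sub>R g' (f x) b)" if "x \<in> S" for x h
    proof -
      interpret linear "g' (f x)"
        using g'(1) assms(3) that has_derivative_linear by blast
      have "g' (f x) (\<Sum>b\<in>Basis. (f' x h \<bullet> b) *\<^sub>R b) = (\<Sum>b\<in>Basis. (f' x h \<bullet> b) *\<^sub>R g' (f x) b)"
        by (simp only: sum scale)
      then show ?thesis
        by (simp only: euclidean_representation)
    qed
    moreover have "continuous_on S (\<lambda>x. \<Sum>b\<in>Basis. (f' x h \<bullet> b) *\<^sub>R g' (f x) b)" for h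
      by (intro continuous_intros f' continuous_on_compose2[OF g'(2) C1_on_continuous[OF assms(2)] assms(3)])
    ultimately show "continuous_on S (\<lambda>x. g' (f x) (f' x h))" for h
      by (simp cong: continuous_on_cong)
  qed
qed

lemma C1_on_bounded_linear:
  assumes L: "bounded_linear L" and f: "C1_on S f"
  shows "C1_on S (\<lambda>x. L (f x))"
  by (rule C1_onI[OF bounded_linear.has_derivative[OF L C1_on_has_derivative[OF f]]], assumption)
    (intro bounded_linear.continuous_on[OF L] C1_on_continuous_derivative[OF f])

lemma C1_on_add:
  assumes f: "C1_on S f" and g: "C1_on S g"
  shows "C1_on S (\<lambda>x. f x + g x)"
  by (rule C1_onI[OF has_derivative_add[OF C1_on_has_derivative[OF f] C1_on_has_derivative[OF g]]], assumption, assumption)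
    (intro continuous_on_add C1_on_continuous_derivative[OF f] C1_on_continuous_derivative[OF g])

lemma C1_on_sum: "(\<And>i. i \<in> I \<Longrightarrow> C1_on S (f i)) \<Longrightarrow> C1_on S (\<lambda>x. \<Sum>i\<in>I. f i x)"
  by (induction I rule: infinite_finite_induct) (auto intro: C1_on_add C1_on_const)

lemma C1_on_scaleR: "C1_on S f \<Longrightarrow> C1_on S g \<Longrightarrow> C1_on S (\<lambda>x. f x *\<^sub>R g x)"
  by (rule C1_on_bilinear[OF bounded_bilinear_scaleR])

lemma C1_on_mult: "C1_on S f \<Longrightarrow> C1_on S g \<Longrightarrow> C1_on S (\<lambda>x. f x * g x :: 'b::real_normed_algebra)"
  by (rule C1_on_bilinear[OF bounded_bilinear_mult])

lemma C1_on_inner: "C1_on S f \<Longrightarrow> C1_on S g \<Longrightarrow> C1_on S (\<lambda>x. f x \<bullet> g x)"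
  by (rule C1_on_bilinear[OF bounded_bilinear_inner])

lemma C1_on_diff: "C1_on S f \<Longrightarrow> C1_on S g \<Longrightarrow> C1_on S (\<lambda>x. f x - g x)"
  using C1_on_add[of S f "\<lambda>x. - g x"] C1_on_bounded_linear[OF bounded_linear_minus[OF bounded_linear_ident], of S g]
  by simp

lemma C1_on_prod: "(\<And>i. i \<in> I \<Longrightarrow> C1_on S (f i)) \<Longrightarrow> C1_on S (\<lambda>x. \<Prod>i\<in>I. f i x :: real)"
  by (induction I rule: infinite_finite_induct) (auto intro: C1_on_mult C1_on_const)

lemma C1_on_real:
  assumes "\<And>x. x \<in> S \<Longrightarrow> (f has_real_derivative f' x) (at x)" "continuous_on S f'"
  shows "C1_on S f"
  by (rule C1_onI[where f' = "\<lambda>x h. f' x * h"])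
    (use assms in \<open>auto simp: has_field_derivative_def intro!: continuous_intros\<close>)

lemmas C1_on_intros = C1_on_const C1_on_id C1_on_add C1_on_diff C1_on_sum C1_on_scaleR C1_on_mult
  C1_on_inner C1_on_prod

text \<open>\<open>S\<close> and the complement of the support of \<open>\<rho>\<close> form an open
  cover, and on the second set the product is identically zero, whatever values \<open>f\<close>
  takes off \<open>S\<close>.\<close>

lemma C1_on_extend_by_zero:
  fixes f :: "'a::euclidean_space \<Rightarrow> 'b::real_normed_vector"
  assumes S: "open S" "closure {x. \<rho> x \<noteq> 0} \<subseteq> S" and \<rho>: "C1_on UNIV \<rho>" and f: "C1_on S f"
  shows "C1_on UNIV (\<lambda>x. \<rho> x *\<^sub>R f x)"
proof -
  let ?T = "- closure {x. \<rho> x \<noteq> 0}"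
  let ?F = "\<lambda>x. \<rho> x *\<^sub>R f x"
  have 1: "C1_on S ?F"
    by (rule C1_on_scaleR[OF C1_on_subset[OF \<rho> subset_UNIV] f])
  have T: "\<rho> x = 0" if "x \<in> ?T" for x
    using that closure_subset[of "{x. \<rho> x \<noteq> 0}"] by blast
  have 2: "C1_on ?T ?F"
  proof (rule C1_onI[where f' = "\<lambda>x h. 0"])
    fix x assume x: "x \<in> ?T"
    show "(?F has_derivative (\<lambda>h. 0)) (at x)"
    proof (rule has_derivative_transform_within_open[OF has_derivative_const _ x])
      show "0 = ?F y" if "y \<in> ?T" for y
        using T[OF that] by simp
    qed (rule open_Compl[OF closed_closure])
  qed (rule continuous_on_const)
  have U: "S \<union> ?T = UNIV"
    using S(2) by auto
  show ?thesis
  proof (rule C1_onI[where f' = "\<lambda>x. \<D> ?F x"])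
    fix x
    show "(?F has_derivative \<D> ?F x) (at x)"
    proof (cases "x \<in> S")
      case False
      then have "x \<in> ?T"
        using U by (metis UNIV_I UnE)
      then show ?thesis
        by (rule C1_on_has_derivative[OF 2])
    qed (rule C1_on_has_derivative[OF 1])
  next
    fix h
    have "continuous_on (S \<union> ?T) (\<lambda>x. \<D> ?F x h)"
      by (intro continuous_on_open_Un C1_on_continuous_derivative[OF 1] C1_on_continuous_derivative[OF 2]
          S(1) open_Compl closed_closure)
    then show "continuous_on UNIV (\<lambda>x. \<D> ?F x h)"
      unfolding U .
  qed
qed

section \<open>Cut-off functions\<close>

text \<open>A C^1 step of the form \<open>a / (a + b)\<close>: the square of a positive part is C^1,
  and \<open>a\<close> and \<open>b\<close> never vanish together since \<open>s < 1\<close> or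
  \<open>s > 1/4\<close>. It is applied to the squared distance divided by \<open>r\<^sup>2\<close>,
  so the thresholds 1/4 and 1 are the radii \<open>r / 2\<close> and \<open>r\<close>.\<close>

definition cutoff :: "real \<Rightarrow> real" where
  "cutoff s = (max 0 (1 - s))\<^sup>2 / ((max 0 (1 - s))\<^sup>2 + (max 0 (s - 1/4))\<^sup>2)"

text \<open>The quotient rule after cancellation, arranged as minus a sum of nonnegative terms over
  a square. The visible sign later makes the approximate identity nonnegative.\<close>

definition cutoff' :: "real \<Rightarrow> real" where
  "cutoff' s = - (2 * max 0 (1 - s) * (max 0 (s - 1/4))\<^sup>2 + (max 0 (1 - s))\<^sup>2 * (2 * max 0 (s - 1/4)))
     / ((max 0 (1 - s))\<^sup>2 + (max 0 (s - 1/4))\<^sup>2)\<^sup>2"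

lemma cutoff_denominator_pos: "(max 0 (1 - s))\<^sup>2 + (max 0 (s - 1/4))\<^sup>2 > (0::real)"
proof (cases "s < 1")
  case True
  then have "0 < (max 0 (1 - s))\<^sup>2"
    by simp
  then show ?thesis
    by (intro add_pos_nonneg) auto
next
  case False
  then have "0 < (max 0 (s - 1/4))\<^sup>2"
    by simp
  then show ?thesis
    by (intro add_nonneg_pos) auto
qed

lemma DERIV_max_0_squared: "((\<lambda>x. (max 0 x)\<^sup>2) has_real_derivative 2 * max 0 x) (at x)" for x :: real
proof -
  consider "x > 0" | "x < 0" | "x = 0"
    by linarith
  then show ?thesis
  proof cases
    case 1
    have "((\<lambda>x. x\<^sup>2) has_real_derivative 2 * x) (at x)"
      by (auto intro!: derivative_eq_intros)
    then have "((\<lambda>x. (max 0 x)\<^sup>2) has_real_derivative 2 * x) (at x)"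
      by (rule has_field_derivative_transform_within_open[where S = "{0<..}"]) (use 1 in auto)
    then show ?thesis
      using 1 by simp
  next
    case 2
    have "((\<lambda>x. 0) has_real_derivative 0) (at x)"
      by simp
    then have "((\<lambda>x. (max 0 x)\<^sup>2) has_real_derivative 0) (at x)"
      by (rule has_field_derivative_transform_within_open[where S = "{..<0}"]) (use 2 in auto)
    then show ?thesis
      using 2 by simp
  next
    case 3
    have "((\<lambda>h. (max 0 h)\<^sup>2 / h) \<longlongrightarrow> 0) (at (0::real))"
    proof (rule Lim_null_comparison)
      show "\<forall>\<^sub>F h in at 0. norm ((max 0 h)\<^sup>2 / h) \<le> \<bar>h::real\<bar>"
        by (rule always_eventually) (auto simp: max_def power2_eq_square)
      show "((\<lambda>h. \<bar>h\<bar>) \<longlongrightarrow> 0) (at (0::real))"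
        by (rule tendsto_eq_intros refl | simp)+
    qed
    then show ?thesis
      using 3 by (simp add: DERIV_def)
  qed
qed

lemma DERIV_cutoff: "(cutoff has_real_derivative cutoff' s) (at s)"
proof -
  have 1: "((\<lambda>s. (max 0 (1 - s))\<^sup>2) has_real_derivative - (2 * max 0 (1 - s))) (at s)"
  proof -
    have "((\<lambda>s. 1 - s) has_real_derivative -1) (at s)"
      by (auto intro!: derivative_eq_intros)
    from DERIV_chain2[OF DERIV_max_0_squared this] show ?thesis
      by simp
  qed
  have 2: "((\<lambda>s. (max 0 (s - 1/4))\<^sup>2) has_real_derivative 2 * max 0 (s - 1/4)) (at s)"
  proof -
    have "((\<lambda>s. s - 1/4) has_real_derivative 1) (at s)"
      by (auto intro!: derivative_eq_intros)
    from DERIV_chain2[OF DERIV_max_0_squared this] show ?thesis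
      by simp
  qed
  have eq: "- (a * B + A * b) / (A + B)\<^sup>2 = (- a * (A + B) - A * (- a + b)) / ((A + B) * (A + B))"
    for a b A B :: real
    by (simp add: power2_eq_square algebra_simps)
  show ?thesis
    using DERIV_divide[OF 1 DERIV_add[OF 1 2] less_imp_neq[OF cutoff_denominator_pos, symmetric]]
    unfolding cutoff_def[abs_def] cutoff'_def eq by simp
qed

lemma continuous_on_cutoff': "continuous_on S cutoff'"
  unfolding cutoff'_def[abs_def]
  by (intro continuous_intros) (use cutoff_denominator_pos in \<open>auto simp: less_imp_neq[symmetric]\<close>)

lemma cutoff'_nonpos: "cutoff' s \<le> 0"
  unfolding cutoff'_def by (rule divide_nonpos_nonneg) (auto intro!: add_nonneg_nonneg simp del: minus_add_distrib)

lemma cutoff_bounds: "0 \<le> cutoff s" "cutoff s \<le> 1"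
  using cutoff_denominator_pos[of s] by (auto simp: cutoff_def divide_simps)

lemma cutoff_eq_1: "s \<le> 1/4 \<Longrightarrow> cutoff s = 1"
  using cutoff_denominator_pos[of s] by (simp add: cutoff_def)

lemma cutoff_eq_0: "s \<ge> 1 \<Longrightarrow> cutoff s = 0"
  by (simp add: cutoff_def max_def)

lemma cutoff'_eq_0: "s \<le> 1/4 \<or> s \<ge> 1 \<Longrightarrow> cutoff' s = 0"
proof (elim disjE)
  assume "s \<le> 1/4"
  then have "max 0 (s - 1/4) = 0"
    by simp
  then show ?thesis
    unfolding cutoff'_def by simp
qed (simp add: cutoff'_def)

lemma C1_on_cutoff: "C1_on S cutoff"
  by (rule C1_on_real[OF DERIV_cutoff continuous_on_cutoff'])

lemma C1_on_cutoff_ball: "C1_on S (\<lambda>x::'a::euclidean_space. cutoff (((x - q) \<bullet> (x - q)) / r\<^sup>2))"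
  using C1_on_compose[OF C1_on_cutoff[of UNIV], of S "\<lambda>x. inverse (r\<^sup>2) * ((x - q) \<bullet> (x - q))"]
  by (simp add: C1_on_intros divide_inverse mult.commute)

text \<open>With \<open>\<rho> i = \<beta> i * (\<Prod>j<i. 1 - \<beta> j)\<close> the sum
  telescopes to \<open>1 - (\<Prod>j<N. 1 - \<beta> j)\<close>, which is 1 wherever some
  \<open>\<beta> i\<close> is 1; no division is involved. The balls of half radius make this hold on
  an open set around \<open>K\<close>, so that the identity can be differentiated on
  \<open>K\<close>.\<close>

lemma C1_partition_of_unity:
  fixes K :: "'a::euclidean_space set"
  assumes "compact K" "\<And>q. q \<in> K \<Longrightarrow> open (U q) \<and> q \<in> U q"
  obtains N :: nat and c \<rho> V where
    "open V" "K \<subseteq> V" "\<And>Y. Y \<in> V \<Longrightarrow> (\<Sum>i<N. \<rho> i Y) = (1::real)"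
    "\<And>i. i < N \<Longrightarrow> c i \<in> K" "\<And>i. C1_on UNIV (\<rho> i)" "\<And>i Y. 0 \<le> \<rho> i Y"
    "\<And>i. compact (closure {Y. \<rho> i Y \<noteq> 0})" "\<And>i. i < N \<Longrightarrow> closure {Y. \<rho> i Y \<noteq> 0} \<subseteq> U (c i)"
proof -
  have "\<exists>r>0. cball q r \<subseteq> U q" if "q \<in> K" for q
    using assms(2)[OF that] by (meson open_contains_cball)
  then obtain r where r: "\<And>q. q \<in> K \<Longrightarrow> r q > 0" "\<And>q. q \<in> K \<Longrightarrow> cball q (r q) \<subseteq> U q"
    by metis
  obtain C where C: "C \<subseteq> K" "finite C" "K \<subseteq> (\<Union>q\<in>C. ball q (r q / 2))"
  proof (rule compactE_image[OF assms(1), of K "\<lambda>q. ball q (r q / 2)"])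
    show "K \<subseteq> (\<Union>q\<in>K. ball q (r q / 2))"
      using r(1) by force
  qed auto
  \<comment> \<open>The telescoping products depend on an order, hence the enumeration of the
    centres.\<close>
  obtain c N where c: "C = c ` {i::nat. i < N}"
    using finite_imp_nat_seg_image_inj_on[OF C(2)] by auto
  then have cK: "c i \<in> K" if "i < N" for i
    using that C(1) by auto
  define \<beta> where "\<beta> i Y = cutoff (((Y - c i) \<bullet> (Y - c i)) / (r (c i))\<^sup>2)" for i Y
  define \<rho> where "\<rho> i Y = (if i < N then \<beta> i Y * (\<Prod>j<i. 1 - \<beta> j Y) else 0)" for i Y
  have \<beta>: "0 \<le> \<beta> i Y" "\<beta> i Y \<le> 1" for i Y
    by (simp_all add: \<beta>_def cutoff_bounds)
  have tele: "(\<Sum>i<n. \<beta> i Y * (\<Prod>j<i. 1 - \<beta> j Y)) = 1 - (\<Prod>j<n. 1 - \<beta> j Y)" for n Y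
    by (induction n) (auto simp: algebra_simps)
  have supp: "closure {Y. \<rho> i Y \<noteq> 0} \<subseteq> cball (c i) (r (c i))" if "i < N" for i
  proof (rule closure_minimal)
    have "\<rho> i Y = 0" if "Y \<notin> cball (c i) (r (c i))" for Y
    proof -
      have "(r (c i))\<^sup>2 \<le> (norm (Y - c i))\<^sup>2"
        using that r(1)[OF cK[OF \<open>i < N\<close>]] by (intro power_mono) (auto simp: dist_norm norm_minus_commute)
      then have "\<beta> i Y = 0"
        using r(1)[OF cK[OF \<open>i < N\<close>]] unfolding \<beta>_def
        by (intro cutoff_eq_0) (simp add: divide_simps power2_norm_eq_inner)
      then show ?thesis
        by (simp add: \<rho>_def)
    qed
    then show "{Y. \<rho> i Y \<noteq> 0} \<subseteq> cball (c i) (r (c i))"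
      by blast
  qed auto
  show ?thesis
  proof (rule that[of "\<Union>q\<in>C. ball q (r q / 2)" \<rho> N c])
    show "(\<Sum>i<N. \<rho> i Y) = 1" if Y: "Y \<in> (\<Union>q\<in>C. ball q (r q / 2))" for Y
    proof -
      obtain i where i: "i < N" "Y \<in> ball (c i) (r (c i) / 2)"
        using Y c by auto
      have "(norm (Y - c i))\<^sup>2 \<le> (r (c i) / 2)\<^sup>2"
        using i(2) by (intro power_mono) (auto simp: dist_norm norm_minus_commute)
      then have "\<beta> i Y = 1"
        using r(1)[OF cK[OF i(1)]] unfolding \<beta>_def
        by (intro cutoff_eq_1) (simp add: divide_simps power2_norm_eq_inner)
      then have "(\<Prod>j<N. 1 - \<beta> j Y) = 0"
        using i(1) by auto
      then show ?thesis
        using tele[of Y N] by (simp add: \<rho>_def)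
    qed
    show "C1_on UNIV (\<rho> i)" for i
    proof (cases "i < N")
      case True
      have "C1_on UNIV (\<beta> j)" for j
        unfolding \<beta>_def[abs_def] by (rule C1_on_cutoff_ball)
      then have "C1_on UNIV (\<lambda>Y. \<beta> i Y * (\<Prod>j<i. 1 - \<beta> j Y))"
        by (intro C1_on_intros)
      then show ?thesis
        unfolding \<rho>_def[abs_def] using True by simp
    qed (simp add: \<rho>_def[abs_def] C1_on_const)
    show "0 \<le> \<rho> i Y" for i Y
      using \<beta> by (auto simp: \<rho>_def intro!: mult_nonneg_nonneg prod_nonneg)
    show "compact (closure {Y. \<rho> i Y \<noteq> 0})" for i
    proof (cases "i < N")
      case True
      then show ?thesis
        using supp[OF True] by (metis bounded_cball bounded_subset compact_closure closure_subset subset_trans)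
    qed (simp add: \<rho>_def)
    show "closure {Y. \<rho> i Y \<noteq> 0} \<subseteq> U (c i)" if "i < N" for i
      using supp[OF that] r(2)[OF cK[OF that]] by blast
    show "open (\<Union>q\<in>C. ball q (r q / 2))"
      by (intro open_UN ballI open_ball)
    show "K \<subseteq> (\<Union>q\<in>C. ball q (r q / 2))"
      by (rule C(3))
    show "c i \<in> K" if "i < N" for i
      by (rule cK[OF that])
  qed
qed



section \<open>The divergence theorem in a graph chart\<close>

lemma signed_Basis_inner:
  assumes "k \<in> Basis \<union> uminus ` Basis"
  shows "k \<bullet> k = 1" "norm k = 1"
    and "b \<in> Basis \<Longrightarrow> b \<bullet> k = 0 \<or> b - (b \<bullet> k) *\<^sub>R k = 0"
proof -
  obtain b0 where b0: "b0 \<in> Basis" "k = b0 \<or> k = - b0"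
    using assms by auto
  then show "k \<bullet> k = 1" "norm k = 1"
    by auto
  show "b \<bullet> k = 0 \<or> b - (b \<bullet> k) *\<^sub>R k = 0" if "b \<in> Basis"
    using b0 that by (cases "b = b0") (auto simp: inner_Basis)
qed

section \<open>Fubini along a signed coordinate vector\<close>

lemma hyperplane_embedding_measurable:
  "(\<lambda>c. \<Sum>b | b \<in> Basis \<and> b \<bullet> k = 0. c b *\<^sub>R b)
    \<in> (\<Pi>\<^sub>M b\<in>{b \<in> Basis. b \<bullet> k = 0}. lborel) \<rightarrow>\<^sub>M restrict_space borel {u. u \<bullet> k = 0}"
proof (rule measurable_restrict_space2)
  have "(\<Sum>b | b \<in> Basis \<and> b \<bullet> k = 0. c b *\<^sub>R b) \<bullet> k = 0" for c
    by (simp add: inner_sum_left)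
  then show "(\<lambda>c. \<Sum>b | b \<in> Basis \<and> b \<bullet> k = 0. c b *\<^sub>R b)
      \<in> space (\<Pi>\<^sub>M b\<in>{b \<in> Basis. b \<bullet> k = 0}. lborel) \<rightarrow> {u. u \<bullet> k = 0}"
    by simp
  have "(\<lambda>c. c b) \<in> borel_measurable (\<Pi>\<^sub>M b\<in>{b \<in> Basis. b \<bullet> k = 0}. lborel)"
    if "b \<in> {b \<in> Basis. b \<bullet> k = 0}" for b
    using measurable_component_singleton[OF that, of "\<lambda>_. lborel"] by simp
  then show "(\<lambda>c. \<Sum>b | b \<in> Basis \<and> b \<bullet> k = 0. c b *\<^sub>R b)
      \<in> borel_measurable (\<Pi>\<^sub>M b\<in>{b \<in> Basis. b \<bullet> k = 0}. lborel)"
    by (intro borel_measurable_sum borel_measurable_scaleR) auto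
qed

lemma space_hyperplane_lborel: "space (hyperplane_lborel k) = {u. u \<bullet> k = 0}"
  by (simp add: hyperplane_lborel_def space_restrict_space)

text \<open>\<open>lborel\<close> is the image of a product of one-dimensional measures indexed by
  \<open>Basis\<close>. Splitting off the factor of the basis vector parallel to \<open>k\<close>
  leaves exactly the product measure behind \<open>hyperplane_lborel k\<close>.\<close>

lemma integral_lborel_fibres:
  fixes f :: "'a::euclidean_space \<Rightarrow> 'b::{banach, second_countable_topology}"
  assumes k: "k \<in> Basis \<union> uminus ` Basis" and f: "integrable lborel f"
  shows "(\<integral>x. f x \<partial>lborel) = (\<integral>u. (\<integral>s. f (u + s *\<^sub>R k) \<partial>lborel) \<partial>hyperplane_lborel k)"
proof -
  let ?I = "{b \<in> Basis. b \<bullet> k = 0}"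
  let ?e = "\<lambda>c. \<Sum>b | b \<in> Basis \<and> b \<bullet> k = 0. c b *\<^sub>R b"
  obtain b0 where b0: "b0 \<in> Basis" "k = b0 \<or> k = - b0"
    using k by auto
  then have B: "Basis = insert b0 ?I" "b0 \<notin> ?I" "finite ?I"
    by (auto simp: inner_Basis)
  interpret product_sigma_finite "\<lambda>b::'a. lborel :: real measure"
    by standard
  have fm[measurable]: "f \<in> borel_measurable borel"
    using f by simp
  have em: "(\<lambda>c. \<Sum>b\<in>Basis. c b *\<^sub>R b) \<in> (\<Pi>\<^sub>M b\<in>Basis. lborel) \<rightarrow>\<^sub>M (borel :: 'a measure)"
    by measurable
  have int: "integrable (\<Pi>\<^sub>M b\<in>Basis. lborel) (\<lambda>c. f (\<Sum>b\<in>Basis. c b *\<^sub>R b))"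
    using f by (subst (asm) lborel_eq) (simp add: integrable_distr_eq[OF em])
  have "(\<integral>x. f x \<partial>lborel) = (\<integral>c. f (\<Sum>b\<in>Basis. c b *\<^sub>R b) \<partial>(\<Pi>\<^sub>M b\<in>Basis. lborel))"
    by (subst lborel_eq) (simp add: integral_distr[OF em])
  also have "\<dots> = (\<integral>c. (\<integral>s. f (\<Sum>b\<in>Basis. (c(b0 := s)) b *\<^sub>R b) \<partial>lborel) \<partial>(\<Pi>\<^sub>M b\<in>?I. lborel))"
    using product_integral_insert[OF B(3,2)] int unfolding B(1)[symmetric] by blast
  also have "\<dots> = (\<integral>c. (\<integral>s. f (?e c + s *\<^sub>R k) \<partial>lborel) \<partial>(\<Pi>\<^sub>M b\<in>?I. lborel))"
  proof (rule Bochner_Integration.integral_cong[OF refl])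
    fix c :: "'a \<Rightarrow> real"
    have "(\<Sum>b\<in>Basis. (c(b0 := s)) b *\<^sub>R b) = ?e c + s *\<^sub>R b0" for s
    proof -
      have "(\<Sum>b\<in>Basis. (c(b0 := s)) b *\<^sub>R b) = (\<Sum>b\<in>insert b0 ?I. (c(b0 := s)) b *\<^sub>R b)"
        using B(1) by simp
      also have "\<dots> = s *\<^sub>R b0 + (\<Sum>b\<in>?I. (c(b0 := s)) b *\<^sub>R b)"
        using B(2,3) by (subst sum.insert) auto
      also have "(\<Sum>b\<in>?I. (c(b0 := s)) b *\<^sub>R b) = ?e c"
        using B(2) by (intro sum.cong) auto
      finally show ?thesis
        by simp
    qed
    then have "(\<integral>s. f (\<Sum>b\<in>Basis. (c(b0 := s)) b *\<^sub>R b) \<partial>lborel) = (\<integral>s. f (?e c + s *\<^sub>R b0) \<partial>lborel)"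
      by simp
    \<comment> \<open>For a negative \<open>k\<close> the line is traversed backwards; the
      reflection of the parameter preserves Lebesgue measure.\<close>
    also have "\<dots> = (\<integral>s. f (?e c + s *\<^sub>R k) \<partial>lborel)"
      using b0(2) lborel_integral_real_affine[of "-1" "\<lambda>s. f (?e c + s *\<^sub>R b0)" 0] by auto
    finally show "(\<integral>s. f (\<Sum>b\<in>Basis. (c(b0 := s)) b *\<^sub>R b) \<partial>lborel) = (\<integral>s. f (?e c + s *\<^sub>R k) \<partial>lborel)" .
  qed
  also have "\<dots> = (\<integral>u. (\<integral>s. f (u + s *\<^sub>R k) \<partial>lborel) \<partial>hyperplane_lborel k)"
  proof -
    have "(\<lambda>u. \<integral>s. f (u + s *\<^sub>R k) \<partial>lborel) \<in> borel_measurable borel"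
      by measurable
    then have "(\<lambda>u. \<integral>s. f (u + s *\<^sub>R k) \<partial>lborel) \<in> borel_measurable (restrict_space borel {u. u \<bullet> k = 0})"
      by (rule measurable_restrict_space1)
    then show ?thesis
      unfolding hyperplane_lborel_def by (subst integral_distr[OF hyperplane_embedding_measurable]) auto
  qed
  finally show ?thesis .
qed

lemma bounded_range_of_bounded_support:
  fixes f :: "'a::euclidean_space \<Rightarrow> 'b::real_normed_vector"
  assumes "continuous_on UNIV f" "\<And>x. norm x > R \<Longrightarrow> f x = 0"
  shows "\<exists>B. \<forall>x. norm (f x) \<le> B"
proof -
  have "compact (f ` cball 0 R)"
    by (intro compact_continuous_image continuous_on_subset[OF assms(1)]) auto
  then obtain B where B: "\<And>y. y \<in> f ` cball 0 R \<Longrightarrow> norm y \<le> B"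
    using compact_imp_bounded bounded_iff by metis
  have "norm (f x) \<le> max B 0" for x
    using B[of "f x"] assms(2)[of x] by (cases "norm x \<le> R") force+
  then show ?thesis
    by blast
qed

lemma integrable_lborel_bounded_support:
  fixes f :: "'a::euclidean_space \<Rightarrow> 'b::{banach, second_countable_topology}"
  assumes "continuous_on UNIV f" "\<And>x. norm x > R \<Longrightarrow> f x = 0"
  shows "integrable lborel f"
proof -
  have "integrable lborel (\<lambda>x. indicator (cball 0 R) x *\<^sub>R f x)"
    by (intro borel_integrable_compact continuous_on_subset[OF assms(1)]) auto
  also have "(\<lambda>x. indicator (cball 0 R) x *\<^sub>R f x) = f"
    using assms(2) by (auto simp: indicator_def fun_eq_iff not_le)
  finally show ?thesis .
qed

text \<open>Integrability is checked on the product measure: a box of half width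
  \<open>\<bar>R\<bar>\<close> has finite measure, and off the box one coordinate, hence the norm of
  the point, exceeds \<open>R\<close>.\<close>

lemma integrable_hyperplane_bounded_support:
  fixes f :: "'a::euclidean_space \<Rightarrow> 'b::{banach, second_countable_topology}"
  assumes f: "continuous_on UNIV f" "\<And>x. norm x > R \<Longrightarrow> f x = 0"
  shows "integrable (hyperplane_lborel k) f"
proof -
  let ?I = "{b \<in> Basis. b \<bullet> k = 0}"
  let ?e = "\<lambda>c. \<Sum>b | b \<in> Basis \<and> b \<bullet> k = 0. c b *\<^sub>R b"
  let ?M = "PiM ?I (\<lambda>_. lborel :: real measure)"
  interpret product_sigma_finite "\<lambda>b::'a. lborel :: real measure"
    by standard
  obtain B where B: "\<And>x. norm (f x) \<le> B"
    using bounded_range_of_bounded_support[OF f] by blast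
  have fm: "f \<in> borel_measurable (restrict_space borel {u. u \<bullet> k = 0})"
    using f(1) by (intro measurable_restrict_space1 borel_measurable_continuous_onI)
  let ?A = "PiE ?I (\<lambda>_. {- \<bar>R\<bar>..\<bar>R\<bar>})"
  have "integrable ?M (\<lambda>c. f (?e c))"
  proof (rule integrableI_bounded_set[where A = ?A and B = B])
    show "?A \<in> sets ?M"
      by (intro sets_PiM_I_finite) auto
    show "(\<lambda>c. f (?e c)) \<in> borel_measurable ?M"
      using measurable_compose[OF hyperplane_embedding_measurable fm] .
    have "emeasure ?M ?A = (\<Prod>b\<in>?I. ennreal (2 * \<bar>R\<bar>))"
      by (subst emeasure_PiM) auto
    also have "\<dots> < \<infinity>"
      by (simp add: power_less_top_ennreal)
    finally show "emeasure ?M ?A < \<infinity>" .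
    show "AE c in ?M. c \<notin> ?A \<longrightarrow> f (?e c) = 0"
    proof (rule AE_I2, rule impI)
      fix c assume c: "c \<in> space ?M" "c \<notin> ?A"
      then obtain b where b: "b \<in> ?I" "\<bar>c b\<bar> > \<bar>R\<bar>"
        by (auto simp: space_PiM PiE_iff abs_le_iff not_le)
      have "?e c \<bullet> b = (\<Sum>b'\<in>?I. if b' = b then c b else 0)"
        unfolding inner_sum_left using b(1) by (intro sum.cong) (auto simp: inner_Basis)
      also have "\<dots> = c b"
        using b(1) by (subst sum.delta) auto
      finally have "\<bar>c b\<bar> \<le> norm (?e c)"
        using Basis_le_norm[of b "?e c"] b(1) by simp
      then show "f (?e c) = 0"
        using b(2) by (intro f(2)) linarith
    qed
  qed (use B in auto)
  then show ?thesis
    unfolding hyperplane_lborel_def by (subst integrable_distr_eq[OF hyperplane_embedding_measurable fm])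
qed

section \<open>Integrals of derivatives along lines\<close>

lemma integral_derivative_line:
  fixes F :: "real \<Rightarrow> 'b::euclidean_space"
  assumes F: "\<And>s. (F has_vector_derivative F' s) (at s)" and cont: "continuous_on UNIV F'"
    and supp: "\<And>s. \<bar>s\<bar> > R \<Longrightarrow> F s = 0" "\<And>s. \<bar>s\<bar> > R \<Longrightarrow> F' s = 0"
  shows "(\<integral>s. F' s \<partial>lborel) = 0" "(\<integral>s. indicator {..<0} s *\<^sub>R F' s \<partial>lborel) = F 0"
proof -
  define r where "r = \<bar>R\<bar> + 1"
  have r: "r > 0" "r > R"
    by (auto simp: r_def)
  have FTC: "(\<integral>s. indicator {a..b} s *\<^sub>R F' s \<partial>lborel) = F b - F a" if "a \<le> b" for a b
    using that F cont
    by (intro integral_FTC_Icc) (auto intro: has_vector_derivative_at_within continuous_on_subset)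
  have m[measurable]: "F' \<in> borel_measurable borel"
    using cont by (rule borel_measurable_continuous_onI)
  have "(\<integral>s. F' s \<partial>lborel) = (\<integral>s. indicator {-r..r} s *\<^sub>R F' s \<partial>lborel)"
    using r by (intro Bochner_Integration.integral_cong refl) (auto simp: indicator_def intro!: supp)
  also have "\<dots> = 0"
    using r by (subst FTC) (auto simp: supp)
  finally show "(\<integral>s. F' s \<partial>lborel) = 0" .
  have "(\<integral>s. indicator {..<0} s *\<^sub>R F' s \<partial>lborel) = (\<integral>s. indicator {-r..0} s *\<^sub>R F' s \<partial>lborel)"
  proof (rule integral_cong_AE)
    show "AE s in lborel. indicator {..<0} s *\<^sub>R F' s = indicator {-r..0} s *\<^sub>R F' s"
      using AE_lborel_singleton[of 0]
      by eventually_elim (use r in \<open>auto simp: indicator_def intro!: supp\<close>)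
  qed measurable
  also have "\<dots> = F 0"
    using r by (subst FTC) (auto simp: supp)
  finally show "(\<integral>s. indicator {..<0} s *\<^sub>R F' s \<partial>lborel) = F 0" .
qed

lemma frechet_derivative_zero_open:
  assumes "open S" "x \<in> S" "\<And>y. y \<in> S \<Longrightarrow> F y = 0"
  shows "\<D> F x = (\<lambda>h. 0)"
proof -
  have "(F has_derivative (\<lambda>h. 0)) (at x)"
    by (rule has_derivative_transform_within_open[OF has_derivative_const assms(1,2)])
      (use assms(3) in auto)
  then show ?thesis
    by (rule frechet_derivative_at[symmetric])
qed

lemma frechet_derivative_outside_support:
  assumes "x \<notin> closure {x. F x \<noteq> 0}"
  shows "\<D> F x = (\<lambda>h. 0)"
proof (rule frechet_derivative_zero_open)
  show "x \<in> - closure {x. F x \<noteq> 0}"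
    using assms by blast
  show "F y = 0" if "y \<in> - closure {x. F x \<noteq> 0}" for y
    using that closure_subset[of "{x. F x \<noteq> 0}"] by blast
qed (rule open_Compl[OF closed_closure])

lemma frechet_derivative_outside_ball:
  fixes F :: "'a::real_normed_vector \<Rightarrow> 'b::real_normed_vector"
  assumes "\<And>x. norm x > R \<Longrightarrow> F x = 0" "norm x > R"
  shows "\<D> F x h = 0"
proof -
  have "open {x::'a. norm x > R}"
    by (intro open_Collect_less continuous_intros)
  then show ?thesis
    using frechet_derivative_zero_open[of "{x. norm x > R}" x F] assms by auto
qed

lemma compact_support_radius:
  assumes "compact (closure {x. F x \<noteq> 0})"
  shows "\<exists>R. \<forall>x. norm x > R \<longrightarrow> F x = 0"
  using compact_imp_bounded[OF assms] closure_subset[of "{x. F x \<noteq> 0}"]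
  unfolding bounded_iff by (metis (mono_tags, lifting) mem_Collect_eq not_less subsetD)

text \<open>The full line serves the directions tangent to the boundary of a half space, where
  nothing remains. The half line serves the transversal direction, where the boundary value
  \<open>F u\<close> remains.\<close>

lemma integral_derivative_along:
  fixes F :: "'a::euclidean_space \<Rightarrow> 'b::euclidean_space"
  assumes F: "C1_on UNIV F" and supp: "\<And>x. norm x > R \<Longrightarrow> F x = 0" and e: "norm e = 1"
  shows "(\<integral>s. \<D> F (u + s *\<^sub>R e) e \<partial>lborel) = 0"
    "(\<integral>s. indicator {..<0} s *\<^sub>R \<D> F (u + s *\<^sub>R e) e \<partial>lborel) = F u"
proof -
  have line: "((\<lambda>s. F (u + s *\<^sub>R e)) has_vector_derivative \<D> F (u + s *\<^sub>R e) e) (at s)" for s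
  proof -
    have "((\<lambda>s. u + s *\<^sub>R e) has_derivative (\<lambda>t. t *\<^sub>R e)) (at s)"
      by (auto intro!: derivative_eq_intros)
    from has_derivative_compose[OF this C1_on_has_derivative[OF F UNIV_I]]
    show ?thesis
      using C1_on_has_derivative[OF F UNIV_I, THEN has_derivative_linear]
      by (simp add: has_vector_derivative_def linear_scale)
  qed
  have c: "continuous_on UNIV (\<lambda>s. \<D> F (u + s *\<^sub>R e) e)"
    by (intro continuous_on_compose2[OF C1_on_continuous_derivative[OF F]] continuous_intros) auto
  have far: "norm (u + s *\<^sub>R e) > R" if "\<bar>s\<bar> > R + norm u" for s
  proof -
    have "\<bar>s\<bar> = norm ((u + s *\<^sub>R e) - u)"
      using e by simp
    also have "\<dots> \<le> norm (u + s *\<^sub>R e) + norm u"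
      by (rule norm_triangle_ineq4)
    finally show ?thesis
      using that by linarith
  qed
  note * = line c supp[OF far] frechet_derivative_outside_ball[OF supp far]
  show "(\<integral>s. \<D> F (u + s *\<^sub>R e) e \<partial>lborel) = 0"
    by (rule integral_derivative_line(1)[OF *])
  show "(\<integral>s. indicator {..<0} s *\<^sub>R \<D> F (u + s *\<^sub>R e) e \<partial>lborel) = F u"
    using integral_derivative_line(2)[OF *] by simp
qed

lemma integral_derivative_compact_support:
  fixes F :: "'a::euclidean_space \<Rightarrow> 'b::euclidean_space"
  assumes F: "C1_on UNIV F" and supp: "compact (closure {x. F x \<noteq> 0})" and b: "b \<in> Basis"
  shows "(\<integral>x. \<D> F x b \<partial>lborel) = 0"
proof -
  obtain R where R: "\<And>x. norm x > R \<Longrightarrow> F x = 0"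
    using compact_support_radius[OF supp] by blast
  have "integrable lborel (\<lambda>x. \<D> F x b)"
    by (rule integrable_lborel_bounded_support[OF C1_on_continuous_derivative[OF F]
          frechet_derivative_outside_ball[OF R]])
  moreover have "(\<integral>s. \<D> F (u + s *\<^sub>R b) b \<partial>lborel) = 0" for u
    using b by (intro integral_derivative_along[OF F R]) auto
  ultimately show ?thesis
    using b by (subst integral_lborel_fibres[of b]) auto
qed

text \<open>The component along \<open>b\<close> of \<open>k\<close> minus the gradient of
  \<open>\<gamma>\<close> within the hyperplane, that is, of the outward unit normal multiplied by
  the surface density of the graph. Keeping the product avoids square roots and a separate surface
  measure.\<close>

definition graph_conormal :: "'a::euclidean_space \<Rightarrow> ('a \<Rightarrow> real) \<Rightarrow> 'a \<Rightarrow> 'a \<Rightarrow> real" where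
  "graph_conormal k \<gamma> u b = b \<bullet> k - \<D> \<gamma> u (b - (b \<bullet> k) *\<^sub>R k)"

text \<open>The shear \<open>x \<mapsto> x + \<gamma>(x') k\<close>, with \<open>x'\<close> the projection of \<open>x\<close> to the hyperplane, straightens
  the graph; on the half space \<open>x \<bullet> k < 0\<close> one integrates along \<open>k\<close> and along \<open>b \<bottom> k\<close> separately.\<close>

lemma divergence_theorem_chart:
  fixes F :: "'a::euclidean_space \<Rightarrow> 'b::euclidean_space"
  assumes D: "open D" and chart: "graph_chart D k \<gamma> W" and F: "C1_on UNIV F"
    and supp: "compact (closure {x. F x \<noteq> 0})" "closure {x. F x \<noteq> 0} \<subseteq> W" and b: "b \<in> Basis"
  shows "integrable (hyperplane_lborel k) (\<lambda>u. graph_conormal k \<gamma> u b *\<^sub>R F (graph_map k \<gamma> u))"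
    and "(\<integral>u. graph_conormal k \<gamma> u b *\<^sub>R F (graph_map k \<gamma> u) \<partial>hyperplane_lborel k)
      = (\<integral>x. indicator D x *\<^sub>R \<D> F x b \<partial>lborel)"
proof -
  have k: "k \<in> Basis \<union> uminus ` Basis" and W: "open W"
    and DW: "D \<inter> W = {x \<in> W. x \<bullet> k < \<gamma> (x - (x \<bullet> k) *\<^sub>R k)}" and \<gamma>: "C1_on UNIV \<gamma>"
    using chart unfolding graph_chart_def Ck_on_1_iff[symmetric] by blast+
  note kk = signed_Basis_inner[OF k]
  define P where "P x = x - (x \<bullet> k) *\<^sub>R k" for x
  define T where "T x = x + \<gamma> (P x) *\<^sub>R k" for x
  define H where "H x = F (T x)" for x
  define \<nu> where "\<nu> u = graph_conormal k \<gamma> u b" for u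
  let ?DF = "\<lambda>x. \<D> F x" and ?DH = "\<lambda>x. \<D> H x"
    and ?D\<gamma> = "\<lambda>x. \<D> \<gamma> x"
  have P_lin: "bounded_linear P"
    unfolding P_def[abs_def]
    by (intro bounded_linear_sub bounded_linear_ident bounded_linear_scaleR_const bounded_linear_inner_left)
  have P_k: "P k = 0" "P (x + s *\<^sub>R k) = P x" "P x \<bullet> k = 0" for x s
    by (simp_all add: P_def kk algebra_simps)
  have P_id: "P u = u" if "u \<bullet> k = 0" for u
    using that by (simp add: P_def)
  have Pc: "continuous_on UNIV P"
    using P_lin by (rule linear_continuous_on)
  have T_C1: "C1_on UNIV T"
    unfolding T_def[abs_def]
    by (intro C1_on_intros C1_on_compose[OF \<gamma> C1_on_linear[OF P_lin]]) auto
  have H_C1: "C1_on UNIV H"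
    unfolding H_def[abs_def] by (rule C1_on_compose[OF F T_C1]) auto
  have DH: "?DH x v = ?DF (T x) (v + ?D\<gamma> (P x) (P v) *\<^sub>R k)" for x v
  proof -
    have "((\<lambda>x. \<gamma> (P x)) has_derivative (\<lambda>v. ?D\<gamma> (P x) (P v))) (at x)"
      using has_derivative_compose[OF bounded_linear_imp_has_derivative[OF P_lin]
          C1_on_has_derivative[OF \<gamma>, of "P x"]] by simp
    then have "(T has_derivative (\<lambda>v. v + ?D\<gamma> (P x) (P v) *\<^sub>R k)) (at x)"
      unfolding T_def[abs_def] by (auto intro!: derivative_eq_intros)
    from has_derivative_compose[OF this C1_on_has_derivative[OF F UNIV_I]]
    have "(H has_derivative (\<lambda>v. ?DF (T x) (v + ?D\<gamma> (P x) (P v) *\<^sub>R k))) (at x)"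
      unfolding H_def[abs_def] .
    from frechet_derivative_at[OF this, symmetric] show ?thesis
      by simp
  qed
  have lin: "linear (?DF x)" "linear (?DH x)" "linear (?D\<gamma> x)" for x
    using C1_on_has_derivative[OF F UNIV_I] C1_on_has_derivative[OF H_C1 UNIV_I]
      C1_on_has_derivative[OF \<gamma> UNIV_I] has_derivative_linear by blast+
  \<comment> \<open>The chain rule in the straightened coordinates: a derivative of \<open>F\<close>
    along \<open>b\<close> is a derivative of \<open>H\<close> within the hyperplane plus
    \<open>\<nu>\<close> times the derivative along \<open>k\<close>.\<close>
  have split: "?DF (T x) b = ?DH x (P b) + \<nu> (P x) *\<^sub>R ?DH x k" for x
  proof -
    have "?D\<gamma> (P x) 0 = 0"
      by (rule linear_0[OF lin(3)])
    then have "?DH x (P b) + \<nu> (P x) *\<^sub>R ?DH x k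
       = ?DF (T x) (P b + ?D\<gamma> (P x) (P b) *\<^sub>R k) + \<nu> (P x) *\<^sub>R ?DF (T x) k"
      using P_k by (simp add: DH P_id)
    also have "\<dots> = ?DF (T x) (P b + ?D\<gamma> (P x) (P b) *\<^sub>R k + \<nu> (P x) *\<^sub>R k)"
      by (simp add: linear_add[OF lin(1)] linear_scale[OF lin(1)])
    also have "P b + ?D\<gamma> (P x) (P b) *\<^sub>R k + \<nu> (P x) *\<^sub>R k = b"
      by (simp add: \<nu>_def graph_conormal_def P_def algebra_simps)
    finally show ?thesis
      by simp
  qed
  have \<nu>_cont: "continuous_on UNIV \<nu>"
    unfolding \<nu>_def[abs_def] graph_conormal_def
    by (intro continuous_intros C1_on_continuous_derivative \<gamma>)
  have T_cont: "continuous_on UNIV T"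
    by (rule C1_on_continuous[OF T_C1])
  obtain R1 where R1: "\<And>x. norm x > R1 \<Longrightarrow> F x = 0"
    using compact_support_radius[OF supp(1)] by blast
  obtain R2 where R2: "\<And>x. H x \<noteq> 0 \<Longrightarrow> norm x \<le> R2"
  proof -
    \<comment> \<open>The inverse shear is continuous, so it carries the compact support of
      \<open>F\<close> to a compact set containing every point where \<open>H\<close> is
      nonzero.\<close>
    have "compact ((\<lambda>y. y - \<gamma> (P y) *\<^sub>R k) ` closure {x. F x \<noteq> 0})"
      by (intro compact_continuous_image supp(1) continuous_intros
          continuous_on_compose2[OF C1_on_continuous[OF \<gamma>]] continuous_on_subset[OF Pc]) auto
    then obtain R2 where R2: "\<And>x. x \<in> (\<lambda>y. y - \<gamma> (P y) *\<^sub>R k) ` closure {x. F x \<noteq> 0} \<Longrightarrow> norm x \<le> R2"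
      using compact_imp_bounded bounded_iff by metis
    have "norm x \<le> R2" if "H x \<noteq> 0" for x
    proof (rule R2, rule image_eqI)
      show "x = T x - \<gamma> (P (T x)) *\<^sub>R k"
        by (simp add: T_def P_k)
      show "T x \<in> closure {x. F x \<noteq> 0}"
        using that closure_subset[of "{x. F x \<noteq> 0}"] unfolding H_def by blast
    qed
    then show ?thesis
      by (rule that)
  qed
  define R where "R = max R1 R2"
  have F0: "F x = 0" and H0: "H x = 0" if "norm x > R" for x
    using R1[of x] R2[of x] that by (auto simp: R_def)
  note DF0 = frechet_derivative_outside_ball[OF F0] and DH0 = frechet_derivative_outside_ball[OF H0]
  have DF0': "?DF x h = 0" if "x \<notin> W" for x h
  proof -
    have "?DF x = (\<lambda>h. 0)"
      by (rule frechet_derivative_outside_support) (use supp(2) that in blast)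
    then show ?thesis
      by simp
  qed
  have DFc: "continuous_on UNIV (\<lambda>x. ?DF x h)" and DHc: "continuous_on UNIV (\<lambda>x. ?DH x h)" for h
    by (rule C1_on_continuous_derivative[OF F], rule C1_on_continuous_derivative[OF H_C1])

  show int: "integrable (hyperplane_lborel k) (\<lambda>u. graph_conormal k \<gamma> u b *\<^sub>R F (graph_map k \<gamma> u))"
  proof -
    have "integrable (hyperplane_lborel k) (\<lambda>u. \<nu> u *\<^sub>R H u)"
      by (rule integrable_hyperplane_bounded_support[where R = R])
        (auto intro!: continuous_intros \<nu>_cont C1_on_continuous[OF H_C1] simp: H0)
    then show ?thesis
      by (rule Bochner_Integration.integrable_cong[THEN iffD1, rotated 2])
        (auto simp: space_hyperplane_lborel \<nu>_def H_def T_def graph_map_def P_id)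
  qed

  let ?U = "{x. x \<bullet> k < \<gamma> (P x)}" and ?N = "{x::'a. x \<bullet> k < 0}"
  have oU: "open ?U"
    by (intro open_Collect_less continuous_intros continuous_on_compose2[OF C1_on_continuous[OF \<gamma>] Pc]) auto
  have oN: "open ?N"
    by (intro open_Collect_less continuous_intros)
  have iU: "integrable lborel (\<lambda>x. indicator ?U x *\<^sub>R ?DF x b)"
    using oU by (intro integrable_mult_indicator integrable_lborel_bounded_support[OF DFc DF0]) auto
  have c1: "continuous_on UNIV (\<lambda>x. ?DH x (P b))"
    by (rule DHc)
  have c2: "continuous_on UNIV (\<lambda>x. \<nu> (P x) *\<^sub>R ?DH x k)"
    by (intro continuous_intros continuous_on_compose2[OF \<nu>_cont Pc] DHc) auto
  have i1: "integrable lborel (\<lambda>x. indicator ?N x *\<^sub>R ?DH x (P b))"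
    using oN by (intro integrable_mult_indicator integrable_lborel_bounded_support[OF c1 DH0]) auto
  have i2: "integrable lborel (\<lambda>x. indicator ?N x *\<^sub>R \<nu> (P x) *\<^sub>R ?DH x k)"
    using oN by (intro integrable_mult_indicator integrable_lborel_bounded_support[OF c2, of R]) (auto simp: DH0)
  note FTC = integral_derivative_along[OF H_C1 H0]
  \<comment> \<open>\<open>D\<close> agrees with the region under the graph inside \<open>W\<close>
    only; outside \<open>W\<close> the derivative of \<open>F\<close> is zero, so the two indicators
    are interchangeable.\<close>
  have "(\<integral>x. indicator D x *\<^sub>R ?DF x b \<partial>lborel) = (\<integral>x. indicator ?U x *\<^sub>R ?DF x b \<partial>lborel)"
  proof (rule Bochner_Integration.integral_cong[OF refl])
    fix x
    have "x \<in> D \<longleftrightarrow> x \<in> ?U" if "x \<in> W"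
      using DW that unfolding P_def by blast
    then show "indicator D x *\<^sub>R ?DF x b = indicator ?U x *\<^sub>R ?DF x b"
      using DF0'[of x b] by (cases "x \<in> W") (auto simp: indicator_def)
  qed
  also have "\<dots> = (\<integral>u. (\<integral>s. indicator ?U (u + s *\<^sub>R k) *\<^sub>R ?DF (u + s *\<^sub>R k) b \<partial>lborel) \<partial>hyperplane_lborel k)"
    by (rule integral_lborel_fibres[OF k iU])
  also have "\<dots> = (\<integral>u. (\<integral>s. indicator ?N (u + s *\<^sub>R k) *\<^sub>R ?DF (T (u + s *\<^sub>R k)) b \<partial>lborel) \<partial>hyperplane_lborel k)"
  proof (rule Bochner_Integration.integral_cong[OF refl])
    fix u assume "u \<in> space (hyperplane_lborel k)"
    then have u: "u \<bullet> k = 0"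
      by (simp add: space_hyperplane_lborel)
    \<comment> \<open>On each fibre the shear is a translation by \<open>\<gamma> u\<close>, so
      one-dimensional translation invariance replaces a Jacobian computation.\<close>
    have "(\<integral>s. indicator ?U (u + s *\<^sub>R k) *\<^sub>R ?DF (u + s *\<^sub>R k) b \<partial>lborel)
        = (\<integral>s. indicator ?U (u + (\<gamma> u + s) *\<^sub>R k) *\<^sub>R ?DF (u + (\<gamma> u + s) *\<^sub>R k) b \<partial>lborel)"
      using lborel_integral_real_affine[of 1 "\<lambda>s. indicator ?U (u + s *\<^sub>R k) *\<^sub>R ?DF (u + s *\<^sub>R k) b" "\<gamma> u"]
      by simp
    also have "\<dots> = (\<integral>s. indicator ?N (u + s *\<^sub>R k) *\<^sub>R ?DF (T (u + s *\<^sub>R k)) b \<partial>lborel)"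
    proof (rule Bochner_Integration.integral_cong[OF refl])
      fix s
      have "T (u + s *\<^sub>R k) = u + (\<gamma> u + s) *\<^sub>R k"
        by (simp add: T_def P_k P_id[OF u] algebra_simps)
      moreover have "u + (\<gamma> u + s) *\<^sub>R k \<in> ?U \<longleftrightarrow> u + s *\<^sub>R k \<in> ?N"
        using u by (simp add: P_k P_id[OF u] kk inner_add_left)
      ultimately show "indicator ?U (u + (\<gamma> u + s) *\<^sub>R k) *\<^sub>R ?DF (u + (\<gamma> u + s) *\<^sub>R k) b
          = indicator ?N (u + s *\<^sub>R k) *\<^sub>R ?DF (T (u + s *\<^sub>R k)) b"
        by (simp add: indicator_def)
    qed
    finally show "(\<integral>s. indicator ?U (u + s *\<^sub>R k) *\<^sub>R ?DF (u + s *\<^sub>R k) b \<partial>lborel)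
        = (\<integral>s. indicator ?N (u + s *\<^sub>R k) *\<^sub>R ?DF (T (u + s *\<^sub>R k)) b \<partial>lborel)" .
  qed
  also have "\<dots> = (\<integral>u. (\<integral>s. indicator ?N (u + s *\<^sub>R k) *\<^sub>R ?DH (u + s *\<^sub>R k) (P b)
       + indicator ?N (u + s *\<^sub>R k) *\<^sub>R \<nu> (P (u + s *\<^sub>R k)) *\<^sub>R ?DH (u + s *\<^sub>R k) k \<partial>lborel) \<partial>hyperplane_lborel k)"
    by (simp only: split scaleR_add_right)
  also have "\<dots> = (\<integral>x. indicator ?N x *\<^sub>R ?DH x (P b) + indicator ?N x *\<^sub>R \<nu> (P x) *\<^sub>R ?DH x k \<partial>lborel)"
    by (rule integral_lborel_fibres[OF k Bochner_Integration.integrable_add[OF i1 i2], symmetric])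
  also have "\<dots> = (\<integral>x. indicator ?N x *\<^sub>R ?DH x (P b) \<partial>lborel)
      + (\<integral>x. indicator ?N x *\<^sub>R \<nu> (P x) *\<^sub>R ?DH x k \<partial>lborel)"
    by (rule Bochner_Integration.integral_add[OF i1 i2])
  \<comment> \<open>The tangential part: either \<open>b\<close> is parallel to \<open>k\<close> and
    its projection is 0, or the half space is invariant along \<open>b\<close> and each full line
    integrates a derivative of compact support.\<close>
  also have "(\<integral>x. indicator ?N x *\<^sub>R ?DH x (P b) \<partial>lborel) = 0"
  proof (cases "b \<bullet> k = 0")
    case False
    then have "P b = 0"
      using kk(3)[OF b] by (simp add: P_def)
    then show ?thesis
      by (simp add: linear_0[OF lin(2)])
  next
    case True
    have "(\<integral>x. indicator ?N x *\<^sub>R ?DH x (P b) \<partial>lborel)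
       = (\<integral>u. (\<integral>s. indicator ?N (u + s *\<^sub>R b) *\<^sub>R ?DH (u + s *\<^sub>R b) (P b) \<partial>lborel) \<partial>hyperplane_lborel b)"
      using b by (intro integral_lborel_fibres i1) auto
    also have "\<dots> = (\<integral>u. indicator ?N u *\<^sub>R (\<integral>s. ?DH (u + s *\<^sub>R b) b \<partial>lborel) \<partial>hyperplane_lborel b)"
    proof (rule Bochner_Integration.integral_cong[OF refl])
      fix u
      have "indicator ?N (u + s *\<^sub>R b) = (indicator ?N u :: real)" for s
        using True by (simp add: indicator_def inner_add_left)
      then show "(\<integral>s. indicator ?N (u + s *\<^sub>R b) *\<^sub>R ?DH (u + s *\<^sub>R b) (P b) \<partial>lborel)
         = indicator ?N u *\<^sub>R (\<integral>s. ?DH (u + s *\<^sub>R b) b \<partial>lborel)"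
        by (simp add: P_id[OF True])
    qed
    also have "\<dots> = 0"
      using FTC(1)[where e = b] b by simp
    finally show ?thesis .
  qed
  \<comment> \<open>The transversal part: \<open>\<nu>\<close> depends on the hyperplane component
    alone and leaves the inner integral, which returns the value of \<open>H\<close> at the boundary
    of the half space.\<close>
  also have "(\<integral>x. indicator ?N x *\<^sub>R \<nu> (P x) *\<^sub>R ?DH x k \<partial>lborel)
      = (\<integral>u. (\<integral>s. indicator ?N (u + s *\<^sub>R k) *\<^sub>R \<nu> (P (u + s *\<^sub>R k)) *\<^sub>R ?DH (u + s *\<^sub>R k) k \<partial>lborel) \<partial>hyperplane_lborel k)"
    by (rule integral_lborel_fibres[OF k i2])
  also have "\<dots> = (\<integral>u. graph_conormal k \<gamma> u b *\<^sub>R F (graph_map k \<gamma> u) \<partial>hyperplane_lborel k)"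
  proof (rule Bochner_Integration.integral_cong[OF refl])
    fix u assume "u \<in> space (hyperplane_lborel k)"
    then have u: "u \<bullet> k = 0"
      by (simp add: space_hyperplane_lborel)
    have "indicator ?N (u + s *\<^sub>R k) = (indicator {..<0} s :: real)" for s
      using u kk by (simp add: indicator_def inner_add_left)
    then have "(\<integral>s. indicator ?N (u + s *\<^sub>R k) *\<^sub>R \<nu> (P (u + s *\<^sub>R k)) *\<^sub>R ?DH (u + s *\<^sub>R k) k \<partial>lborel)
       = (\<integral>s. \<nu> u *\<^sub>R indicator {..<0} s *\<^sub>R ?DH (u + s *\<^sub>R k) k \<partial>lborel)"
      by (simp add: P_k P_id[OF u] mult.commute)
    also have "\<dots> = \<nu> u *\<^sub>R (\<integral>s. indicator {..<0} s *\<^sub>R ?DH (u + s *\<^sub>R k) k \<partial>lborel)"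
      by (rule integral_scaleR_right)
    also have "\<dots> = \<nu> u *\<^sub>R H u"
      using FTC(2)[where e = k and u = u] kk(2) by simp
    finally show "(\<integral>s. indicator ?N (u + s *\<^sub>R k) *\<^sub>R \<nu> (P (u + s *\<^sub>R k)) *\<^sub>R ?DH (u + s *\<^sub>R k) k \<partial>lborel)
       = graph_conormal k \<gamma> u b *\<^sub>R F (graph_map k \<gamma> u)"
      by (simp add: \<nu>_def H_def T_def graph_map_def P_id[OF u])
  qed
  finally show "(\<integral>u. graph_conormal k \<gamma> u b *\<^sub>R F (graph_map k \<gamma> u) \<partial>hyperplane_lborel k)
      = (\<integral>x. indicator D x *\<^sub>R \<D> F x b \<partial>lborel)"
    by simp
qed



section \<open>Fluxes through the boundary\<close>

text \<open>The part of \<open>has_boundary_integral\<close> that does not involve the form, with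
  the smoothness of the partition functions stated by \<open>C1_on\<close>.\<close>

definition chart_system ::
  "'a::euclidean_space set \<Rightarrow> nat \<Rightarrow> (nat \<Rightarrow> 'a) \<Rightarrow> (nat \<Rightarrow> 'a \<Rightarrow> real) \<Rightarrow> (nat \<Rightarrow> 'a set)
    \<Rightarrow> (nat \<Rightarrow> 'a \<Rightarrow> real) \<Rightarrow> bool" where
  "chart_system D N k \<gamma> W \<rho> \<longleftrightarrow>
     (\<forall>i<N. graph_chart D (k i) (\<gamma> i) (W i) \<and> C1_on UNIV (\<rho> i) \<and> (\<forall>Y. 0 \<le> \<rho> i Y) \<and>
            compact (closure {Y. \<rho> i Y \<noteq> 0}) \<and> closure {Y. \<rho> i Y \<noteq> 0} \<subseteq> W i) \<and>
     (\<forall>Y\<in>frontier D. (\<Sum>i<N. \<rho> i Y) = 1)"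

text \<open>\<open>\<Phi> b\<close> is the component along \<open>b\<close> of a field whose
  components lie themselves in a vector space. No unit normal is needed, since
  \<open>graph_conormal\<close> carries the surface density.\<close>

definition flux_density ::
  "'a::euclidean_space \<Rightarrow> ('a \<Rightarrow> real) \<Rightarrow> ('a \<Rightarrow> real) \<Rightarrow> ('a \<Rightarrow> 'a \<Rightarrow> 'b::real_normed_vector) \<Rightarrow> 'a \<Rightarrow> 'b" where
  "flux_density k \<gamma> \<rho> \<Phi> u =
     (\<Sum>b\<in>Basis. (graph_conormal k \<gamma> u b * \<rho> (graph_map k \<gamma> u)) *\<^sub>R \<Phi> b (graph_map k \<gamma> u))"

abbreviation total_flux where
  "total_flux N k \<gamma> \<rho> \<Phi> \<equiv>
     (\<Sum>i<N. \<integral>u. flux_density (k i) (\<gamma> i) (\<rho> i) \<Phi> u \<partial>hyperplane_lborel (k i))"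

abbreviation chart_integrable where
  "chart_integrable k \<gamma> \<rho> \<Phi> i \<equiv> integrable (hyperplane_lborel (k i)) (flux_density (k i) (\<gamma> i) (\<rho> i) \<Phi>)"

text \<open>Quantifying over all chart systems makes the independence of the charts part of the notion.\<close>

definition has_flux ::
  "'a::euclidean_space set \<Rightarrow> ('a \<Rightarrow> 'a \<Rightarrow> 'b::{banach, second_countable_topology}) \<Rightarrow> 'b \<Rightarrow> bool" where
  "has_flux D \<Phi> I \<longleftrightarrow>
     (\<forall>N k \<gamma> W \<rho>. chart_system D N k \<gamma> W \<rho> \<longrightarrow>
        (\<forall>i<N. chart_integrable k \<gamma> \<rho> \<Phi> i) \<and>
        total_flux N k \<gamma> \<rho> \<Phi> = I)"

text \<open>A point of the graph violates the strict inequality defining \<open>D\<close> in the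
  chart, while moving it slightly along \<open>-k\<close> satisfies it. Therefore a flux depends on
  the values of the field on the frontier only.\<close>

lemma graph_chart_frontier:
  fixes D :: "'a::euclidean_space set"
  assumes D: "open D" and chart: "graph_chart D k \<gamma> W" and u: "u \<bullet> k = 0" and W: "graph_map k \<gamma> u \<in> W"
  shows "graph_map k \<gamma> u \<in> frontier D"
proof -
  have k: "k \<in> Basis \<union> uminus ` Basis" and oW: "open W"
    and DW: "\<And>x. x \<in> W \<Longrightarrow> x \<in> D \<longleftrightarrow> x \<bullet> k < \<gamma> (x - (x \<bullet> k) *\<^sub>R k)"
    using chart unfolding graph_chart_def by blast+
  note kk = signed_Basis_inner[OF k]
  let ?y = "graph_map k \<gamma> u"
  have y: "(?y + s *\<^sub>R k) \<bullet> k = \<gamma> u + s" "?y + s *\<^sub>R k - ((?y + s *\<^sub>R k) \<bullet> k) *\<^sub>R k = u" for s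
    using u kk by (simp_all add: graph_map_def inner_add_left algebra_simps)
  have "?y \<notin> D"
    using DW[OF W] y[of 0] by simp
  moreover have "?y \<in> closure D"
    unfolding closure_approachable
  proof (intro allI impI)
    fix e :: real assume "e > 0"
    obtain d where d: "d > 0" "ball ?y d \<subseteq> W"
      using oW W open_contains_ball by blast
    define t where "t = min d e / 2"
    have t: "t > 0" "t < d" "t < e"
      using d(1) \<open>e > 0\<close> by (auto simp: t_def)
    let ?z = "?y + (- t) *\<^sub>R k"
    have dist: "dist ?z ?y = t"
      using t(1) kk(2) by (simp add: dist_norm)
    then have "?z \<in> W"
      using d(2) t(2) by (auto simp: dist_commute subset_iff)
    then have "?z \<in> D"
      using DW y[of "- t"] t(1) by simp
    then show "\<exists>z\<in>D. dist z ?y < e"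
      using dist t(3) by (metis)
  qed
  ultimately show ?thesis
    using D by (simp add: frontier_def interior_open)
qed

lemma flux_density_cong:
  assumes D: "open D" and chart: "graph_chart D k \<gamma> W" and \<rho>: "closure {Y. \<rho> Y \<noteq> 0} \<subseteq> W"
    and u: "u \<in> space (hyperplane_lborel k)"
    and eq: "\<And>b Y. b \<in> Basis \<Longrightarrow> Y \<in> frontier D \<Longrightarrow> \<Phi> b Y = \<Phi>' b Y"
  shows "flux_density k \<gamma> \<rho> \<Phi> u = flux_density k \<gamma> \<rho> \<Phi>' u"
proof (cases "\<rho> (graph_map k \<gamma> u) = 0")
  case False
  then have "graph_map k \<gamma> u \<in> W"
    using \<rho> closure_subset[of "{Y. \<rho> Y \<noteq> 0}"] by blast
  then have "graph_map k \<gamma> u \<in> frontier D"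
    using u by (intro graph_chart_frontier[OF D chart]) (auto simp: space_hyperplane_lborel)
  then show ?thesis
    by (simp add: flux_density_def eq)
qed (simp add: flux_density_def)

section \<open>Fluxes under congruence, linear maps and limits\<close>

lemma has_flux_cong:
  assumes D: "open D" and flux: "has_flux D \<Phi> I"
    and eq: "\<And>b Y. b \<in> Basis \<Longrightarrow> Y \<in> frontier D \<Longrightarrow> \<Phi> b Y = \<Phi>' b Y"
  shows "has_flux D \<Phi>' I"
  unfolding has_flux_def
proof (intro allI impI)
  fix N :: nat and k \<gamma> W \<rho>
  assume sys: "chart_system D N k \<gamma> W \<rho>"
  have f: "\<And>i. i < N \<Longrightarrow> chart_integrable k \<gamma> \<rho> \<Phi> i"
    "total_flux N k \<gamma> \<rho> \<Phi> = I"
    using flux sys unfolding has_flux_def by blast+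
  have e: "flux_density (k i) (\<gamma> i) (\<rho> i) \<Phi> u = flux_density (k i) (\<gamma> i) (\<rho> i) \<Phi>' u"
    if "i < N" "u \<in> space (hyperplane_lborel (k i))" for i u
    using sys that unfolding chart_system_def
    by (intro flux_density_cong[OF D _ _ that(2) eq, of "\<gamma> i" "W i" "\<rho> i"]) auto
  have "chart_integrable k \<gamma> \<rho> \<Phi> i
     \<longleftrightarrow> chart_integrable k \<gamma> \<rho> \<Phi>' i" if "i < N" for i
    by (rule Bochner_Integration.integrable_cong[OF refl e[OF that]])
  moreover have "total_flux N k \<gamma> \<rho> \<Phi>
    = total_flux N k \<gamma> \<rho> \<Phi>'"
    by (intro sum.cong refl Bochner_Integration.integral_cong e) auto
  ultimately show "(\<forall>i<N. chart_integrable k \<gamma> \<rho> \<Phi>' i) \<and>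
    total_flux N k \<gamma> \<rho> \<Phi>' = I"
    using f(1) unfolding f(2) by blast
qed

lemma has_flux_bounded_linear:
  assumes L: "bounded_linear L" and flux: "has_flux D \<Phi> I"
  shows "has_flux D (\<lambda>b Y. L (\<Phi> b Y)) (L I)"
  unfolding has_flux_def
proof (intro allI impI)
  fix N :: nat and k \<gamma> W \<rho>
  assume sys: "chart_system D N k \<gamma> W \<rho>"
  interpret bounded_linear L
    by fact
  have e: "flux_density (k i) (\<gamma> i) (\<rho> i) (\<lambda>b Y. L (\<Phi> b Y)) = (\<lambda>u. L (flux_density (k i) (\<gamma> i) (\<rho> i) \<Phi> u))" for i
    by (simp add: flux_density_def fun_eq_iff sum scale)
  have int: "chart_integrable k \<gamma> \<rho> \<Phi> i" if "i < N" for i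
    using flux sys that unfolding has_flux_def by blast
  have I: "total_flux N k \<gamma> \<rho> \<Phi> = I"
    using flux sys unfolding has_flux_def by blast
  show "(\<forall>i<N. integrable (hyperplane_lborel (k i)) (flux_density (k i) (\<gamma> i) (\<rho> i) (\<lambda>b Y. L (\<Phi> b Y)))) \<and>
    (\<Sum>i<N. \<integral>u. flux_density (k i) (\<gamma> i) (\<rho> i) (\<lambda>b Y. L (\<Phi> b Y)) u \<partial>hyperplane_lborel (k i)) = L I"
    unfolding e I[symmetric] sum
    using int by (auto intro!: integrable_bounded_linear[OF L] sum.cong integral_bounded_linear[OF L])
qed

lemma has_flux_add:
  assumes "has_flux D \<Phi> I" "has_flux D \<Psi> J"
  shows "has_flux D (\<lambda>b Y. \<Phi> b Y + \<Psi> b Y) (I + J)"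
proof -
  have e: "flux_density k \<gamma> \<rho> (\<lambda>b Y. \<Phi> b Y + \<Psi> b Y) = (\<lambda>u. flux_density k \<gamma> \<rho> \<Phi> u + flux_density k \<gamma> \<rho> \<Psi> u)"
    for k \<gamma> \<rho>
    by (simp add: flux_density_def fun_eq_iff sum.distrib scaleR_add_right)
  show ?thesis
    unfolding has_flux_def e
  proof (intro allI impI conjI)
    fix N :: nat and k \<gamma> W \<rho>
    assume sys: "chart_system D N k \<gamma> W \<rho>"
    have f: "\<And>i. i < N \<Longrightarrow> chart_integrable k \<gamma> \<rho> \<Phi> i"
      "total_flux N k \<gamma> \<rho> \<Phi> = I"
      using assms(1) sys unfolding has_flux_def by blast+
    have g: "\<And>i. i < N \<Longrightarrow> chart_integrable k \<gamma> \<rho> \<Psi> i"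
      "total_flux N k \<gamma> \<rho> \<Psi> = J"
      using assms(2) sys unfolding has_flux_def by blast+
    show "integrable (hyperplane_lborel (k i))
        (\<lambda>u. flux_density (k i) (\<gamma> i) (\<rho> i) \<Phi> u + flux_density (k i) (\<gamma> i) (\<rho> i) \<Psi> u)" if "i < N" for i
      by (intro Bochner_Integration.integrable_add f g that)
    have "(\<Sum>i<N. \<integral>u. flux_density (k i) (\<gamma> i) (\<rho> i) \<Phi> u + flux_density (k i) (\<gamma> i) (\<rho> i) \<Psi> u \<partial>hyperplane_lborel (k i))
      = (\<Sum>i<N. (\<integral>u. flux_density (k i) (\<gamma> i) (\<rho> i) \<Phi> u \<partial>hyperplane_lborel (k i))
          + (\<integral>u. flux_density (k i) (\<gamma> i) (\<rho> i) \<Psi> u \<partial>hyperplane_lborel (k i)))"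
      by (intro sum.cong refl Bochner_Integration.integral_add f g) auto
    then show "(\<Sum>i<N. \<integral>u. flux_density (k i) (\<gamma> i) (\<rho> i) \<Phi> u + flux_density (k i) (\<gamma> i) (\<rho> i) \<Psi> u \<partial>hyperplane_lborel (k i)) = I + J"
      unfolding sum.distrib f(2) g(2) .
  qed
qed

lemma has_flux_zero: "has_flux D (\<lambda>b Y. 0) 0"
  unfolding has_flux_def flux_density_def by simp

lemma has_flux_sum:
  "(\<And>j. j \<in> J \<Longrightarrow> has_flux D (\<Phi> j) (I j)) \<Longrightarrow> has_flux D (\<lambda>b Y. \<Sum>j\<in>J. \<Phi> j b Y) (\<Sum>j\<in>J. I j)"
  by (induction J rule: infinite_finite_induct) (auto intro: has_flux_add has_flux_zero)

text \<open>Dominated convergence in each chart. The fluxes \<open>I n\<close> are the same for all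
  chart systems, hence so is their limit, and the convergence need not be uniform on the
  frontier.\<close>

lemma has_flux_limit:
  fixes \<Phi> :: "'a::euclidean_space \<Rightarrow> 'a \<Rightarrow> 'b::{banach, second_countable_topology}"
  assumes D: "open D" and flux: "\<And>n::nat. has_flux D (\<Phi>s n) (I n)"
    and lim: "\<And>b Y. b \<in> Basis \<Longrightarrow> Y \<in> frontier D \<Longrightarrow> (\<lambda>n. \<Phi>s n b Y) \<longlonglongrightarrow> \<Phi> b Y"
    and bnd: "\<And>n b Y. b \<in> Basis \<Longrightarrow> Y \<in> frontier D \<Longrightarrow> norm (\<Phi>s n b Y) \<le> M"
    and I: "I \<longlonglongrightarrow> J"
  shows "has_flux D \<Phi> J"
  unfolding has_flux_def
proof (intro allI impI)
  fix N :: nat and k \<gamma> W \<rho>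
  assume sys: "chart_system D N k \<gamma> W \<rho>"
  have key: "chart_integrable k \<gamma> \<rho> \<Phi> i \<and>
    (\<lambda>n. \<integral>u. flux_density (k i) (\<gamma> i) (\<rho> i) (\<Phi>s n) u \<partial>hyperplane_lborel (k i))
      \<longlonglongrightarrow> (\<integral>u. flux_density (k i) (\<gamma> i) (\<rho> i) \<Phi> u \<partial>hyperplane_lborel (k i))" if i: "i < N" for i
  proof -
    let ?M = "hyperplane_lborel (k i)" and ?f = "flux_density (k i) (\<gamma> i) (\<rho> i)"
    let ?c = "\<lambda>b u. graph_conormal (k i) (\<gamma> i) u b * \<rho> i (graph_map (k i) (\<gamma> i) u)"
    have chart: "graph_chart D (k i) (\<gamma> i) (W i)" and \<rho>: "C1_on UNIV (\<rho> i)"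
      "compact (closure {Y. \<rho> i Y \<noteq> 0})" "closure {Y. \<rho> i Y \<noteq> 0} \<subseteq> W i"
      using sys i unfolding chart_system_def by blast+
    \<comment> \<open>The chart theorem applied to the scalar function \<open>\<rho> i\<close>
      itself shows that the weights are integrable; their moduli times \<open>M\<close> give the
      dominating function.\<close>
    have c: "integrable ?M (?c b)" if "b \<in> Basis" for b
      using divergence_theorem_chart(1)[OF D chart \<rho> that] by simp
    have int: "integrable ?M (?f (\<Phi>s n))" for n
      using flux[of n] sys i unfolding has_flux_def by blast
    have fr: "graph_map (k i) (\<gamma> i) u \<in> frontier D"
      if "u \<in> space ?M" "\<rho> i (graph_map (k i) (\<gamma> i) u) \<noteq> 0" for u
      using that \<rho>(3) closure_subset[of "{Y. \<rho> i Y \<noteq> 0}"]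
      by (intro graph_chart_frontier[OF D chart]) (auto simp: space_hyperplane_lborel)
    have lim': "(\<lambda>n. ?f (\<Phi>s n) u) \<longlonglongrightarrow> ?f \<Phi> u" if "u \<in> space ?M" for u
    proof (cases "\<rho> i (graph_map (k i) (\<gamma> i) u) = 0")
      case False
      show ?thesis
        unfolding flux_density_def by (intro tendsto_intros lim fr that False)
    qed (simp add: flux_density_def)
    have bnd': "norm (?f (\<Phi>s n) u) \<le> (\<Sum>b\<in>Basis. \<bar>?c b u\<bar> * M)" if "u \<in> space ?M" for n u
    proof (cases "\<rho> i (graph_map (k i) (\<gamma> i) u) = 0")
      case False
      then show ?thesis
        unfolding flux_density_def
        by (intro sum_norm_le) (auto simp: intro!: mult_left_mono bnd fr that)
    qed (simp add: flux_density_def)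
    have w: "integrable ?M (\<lambda>u. \<Sum>b\<in>Basis. \<bar>?c b u\<bar> * M)"
      by (intro Bochner_Integration.integrable_sum integrable_mult_left integrable_abs c)
    have m: "?f \<Phi> \<in> borel_measurable ?M"
      by (rule borel_measurable_LIMSEQ_metric[OF borel_measurable_integrable[OF int] lim'])
    have m': "?f (\<Phi>s n) \<in> borel_measurable ?M" for n
      using int by (rule borel_measurable_integrable)
    note dc = m m' w AE_I2[OF lim'] AE_I2[OF bnd']
    show ?thesis
      using integrable_dominated_convergence[OF dc] integral_dominated_convergence[OF dc] by blast
  qed
  have "(\<lambda>n. \<Sum>i<N. \<integral>u. flux_density (k i) (\<gamma> i) (\<rho> i) (\<Phi>s n) u \<partial>hyperplane_lborel (k i))
    \<longlonglongrightarrow> total_flux N k \<gamma> \<rho> \<Phi>"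
    by (intro tendsto_sum) (use key in auto)
  moreover have "(\<lambda>n. \<Sum>i<N. \<integral>u. flux_density (k i) (\<gamma> i) (\<rho> i) (\<Phi>s n) u \<partial>hyperplane_lborel (k i)) = I"
    using flux sys unfolding has_flux_def by blast
  ultimately have "I \<longlonglongrightarrow> total_flux N k \<gamma> \<rho> \<Phi>"
    by simp
  then have "total_flux N k \<gamma> \<rho> \<Phi> = J"
    using I by (rule LIMSEQ_unique)
  then show "(\<forall>i<N. chart_integrable k \<gamma> \<rho> \<Phi> i) \<and>
    total_flux N k \<gamma> \<rho> \<Phi> = J"
    using key by blast
qed

text \<open>\<open>has_flux\<close> quantifies universally over chart systems, so existence of one
  is what makes its value unique and lets \<open>boundary_integral\<close> denote it.\<close>

lemma ex_chart_system:
  fixes D :: "'a::euclidean_space set"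
  assumes "bounded D" "smooth_boundary D"
  obtains N k \<gamma> W \<rho> where "chart_system D N k \<gamma> W \<rho>"
proof -
  obtain k \<gamma> W where chart: "\<And>q. q \<in> frontier D \<Longrightarrow> q \<in> W q \<and> graph_chart D (k q) (\<gamma> q) (W q)"
    using assms(2) unfolding smooth_boundary_def by metis
  have W: "open (W q) \<and> q \<in> W q" if "q \<in> frontier D" for q
    using chart[OF that] unfolding graph_chart_def by blast
  have "compact (frontier D)"
    using assms(1) by (rule compact_frontier_bounded)
  then show ?thesis
  proof (rule C1_partition_of_unity[of _ W])
    fix N :: nat and c V and \<rho> :: "nat \<Rightarrow> 'a \<Rightarrow> real"
    assume "frontier D \<subseteq> V" "\<And>Y. Y \<in> V \<Longrightarrow> (\<Sum>i<N. \<rho> i Y) = 1" "\<And>i. i < N \<Longrightarrow> c i \<in> frontier D"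
      "\<And>i. C1_on UNIV (\<rho> i)" "\<And>i Y. 0 \<le> \<rho> i Y" "\<And>i. compact (closure {Y. \<rho> i Y \<noteq> 0})"
      "\<And>i. i < N \<Longrightarrow> closure {Y. \<rho> i Y \<noteq> 0} \<subseteq> W (c i)"
    then have "chart_system D N (\<lambda>i. k (c i)) (\<lambda>i. \<gamma> (c i)) (\<lambda>i. W (c i)) \<rho>"
      using chart unfolding chart_system_def by blast
    then show thesis
      by (rule that)
  qed (rule W)
qed

section \<open>The divergence theorem on the whole region and independence of the charts\<close>

lemma C1_on_support_mult:
  fixes f :: "'a::euclidean_space \<Rightarrow> 'b::real_normed_vector"
  assumes "C1_on UNIV \<rho>" "compact (closure {x. \<rho> x \<noteq> 0})" "C1_on UNIV f"
  shows "C1_on UNIV (\<lambda>x. \<rho> x *\<^sub>R f x)" "compact (closure {x. \<rho> x *\<^sub>R f x \<noteq> 0})"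
    "closure {x. \<rho> x *\<^sub>R f x \<noteq> 0} \<subseteq> closure {x. \<rho> x \<noteq> 0}"
proof -
  show sub: "closure {x. \<rho> x *\<^sub>R f x \<noteq> 0} \<subseteq> closure {x. \<rho> x \<noteq> 0}"
    by (rule closure_mono) auto
  show "C1_on UNIV (\<lambda>x. \<rho> x *\<^sub>R f x)"
    by (intro C1_on_scaleR assms)
  show "compact (closure {x. \<rho> x *\<^sub>R f x \<noteq> 0})"
    using assms(2) sub by (meson bounded_subset closed_closure compact_eq_bounded_closed)
qed

lemma integrable_indicator_derivative:
  assumes D: "open D" "bounded D" and f: "C1_on UNIV f"
  shows "integrable lborel (\<lambda>x. indicator D x *\<^sub>R (\<D> f x b :: 'b::euclidean_space))"
proof -
  have "integrable lborel (\<lambda>x. indicator (closure D) x *\<^sub>R \<D> f x b)"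
    using D(2) by (intro borel_integrable_compact continuous_on_subset[OF C1_on_continuous_derivative[OF f]])
      (auto simp: compact_closure)
  then have "integrable lborel (\<lambda>x. indicator D x *\<^sub>R indicator (closure D) x *\<^sub>R \<D> f x b)"
    by (rule integrable_mult_indicator[rotated]) (use D(1) in simp)
  also have "(\<lambda>x. indicator D x *\<^sub>R indicator (closure D) x *\<^sub>R \<D> f x b)
     = (\<lambda>x. indicator D x *\<^sub>R \<D> f x b)"
    using closure_subset[of D] by (auto simp: indicator_def fun_eq_iff)
  finally show ?thesis .
qed

text \<open>This handles partitions that sum to 1 on the frontier but on no neighbourhood of it.
  After localising on the closure of \<open>D\<close>, a piece supported inside \<open>D\<close> is
  integrated over the whole space, and a piece near the frontier reduces to a surface term that
  contains \<open>f\<close> on the graph, hence 0.\<close>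

lemma integral_derivative_zero_boundary:
  fixes f :: "'a::euclidean_space \<Rightarrow> 'b::euclidean_space"
  assumes D: "open D" "bounded D" "smooth_boundary D"
    and f: "C1_on UNIV f" "\<And>Y. Y \<in> frontier D \<Longrightarrow> f Y = 0" and b: "b \<in> Basis"
  shows "(\<integral>x. indicator D x *\<^sub>R \<D> f x b \<partial>lborel) = 0"
proof -
  obtain k \<gamma> W where chart: "\<And>q. q \<in> frontier D \<Longrightarrow> q \<in> W q \<and> graph_chart D (k q) (\<gamma> q) (W q)"
    using D(3) unfolding smooth_boundary_def by metis
  \<comment> \<open>Interior points get \<open>D\<close> itself as neighbourhood and frontier points
    their chart domain, so each member of the partition falls under one of two cases.\<close>
  define U where "U q = (if q \<in> D then D else W q)" for q
  have U: "open (U q) \<and> q \<in> U q" if "q \<in> closure D" for q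
    using chart[of q] that D(1) unfolding U_def graph_chart_def by (auto simp: frontier_def interior_open)
  have "compact (closure D)"
    using D(2) by (simp add: compact_closure)
  then show ?thesis
  proof (rule C1_partition_of_unity[of _ U])
    fix N :: nat and c V and \<rho> :: "nat \<Rightarrow> 'a \<Rightarrow> real"
    assume V: "open V" "closure D \<subseteq> V" "\<And>Y. Y \<in> V \<Longrightarrow> (\<Sum>i<N. \<rho> i Y) = 1"
      and c: "\<And>i. i < N \<Longrightarrow> c i \<in> closure D"
      and \<rho>: "\<And>i. C1_on UNIV (\<rho> i)" "\<And>i. compact (closure {Y. \<rho> i Y \<noteq> 0})"
        "\<And>i. i < N \<Longrightarrow> closure {Y. \<rho> i Y \<noteq> 0} \<subseteq> U (c i)"
    let ?f = "\<lambda>i x. \<rho> i x *\<^sub>R f x"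
    note C = C1_on_support_mult[OF \<rho>(1,2) f(1)]
    have zero: "(\<integral>x. indicator D x *\<^sub>R \<D> (?f i) x b \<partial>lborel) = 0" if i: "i < N" for i
    proof (cases "c i \<in> D")
      case True
      then have sub: "closure {x. ?f i x \<noteq> 0} \<subseteq> D"
        using C(3)[of i] \<rho>(3)[OF i] by (simp add: U_def)
      have "\<D> (?f i) x = (\<lambda>h. 0)" if "x \<notin> D" for x
        using that sub by (intro frechet_derivative_outside_support) blast
      then have "(\<integral>x. indicator D x *\<^sub>R \<D> (?f i) x b \<partial>lborel)
          = (\<integral>x. \<D> (?f i) x b \<partial>lborel)"
        by (intro Bochner_Integration.integral_cong) (auto simp: indicator_def)
      then show ?thesis
        using integral_derivative_compact_support[OF C(1,2) b, of i] by simp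
    next
      case False
      then have fr: "c i \<in> frontier D"
        using c[OF i] D(1) by (simp add: frontier_def interior_open)
      have sub: "closure {x. ?f i x \<noteq> 0} \<subseteq> W (c i)"
        using C(3)[of i] \<rho>(3)[OF i] False by (simp add: U_def)
      have ch: "graph_chart D (k (c i)) (\<gamma> (c i)) (W (c i))"
        using chart[OF fr] by blast
      have "graph_conormal (k (c i)) (\<gamma> (c i)) u b *\<^sub>R ?f i (graph_map (k (c i)) (\<gamma> (c i)) u) = 0"
        if "u \<in> space (hyperplane_lborel (k (c i)))" for u
      proof (cases "graph_map (k (c i)) (\<gamma> (c i)) u \<in> W (c i)")
        case True
        then have "graph_map (k (c i)) (\<gamma> (c i)) u \<in> frontier D"
          using that by (intro graph_chart_frontier[OF D(1) ch]) (auto simp: space_hyperplane_lborel)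
        then show ?thesis
          by (simp add: f(2))
      next
        case False
        then have "?f i (graph_map (k (c i)) (\<gamma> (c i)) u) = 0"
          using sub closure_subset[of "{x. ?f i x \<noteq> 0}"] by blast
        then show ?thesis
          by simp
      qed
      then have "(\<integral>u. graph_conormal (k (c i)) (\<gamma> (c i)) u b *\<^sub>R ?f i (graph_map (k (c i)) (\<gamma> (c i)) u)
          \<partial>hyperplane_lborel (k (c i))) = (\<integral>u. 0 \<partial>hyperplane_lborel (k (c i)))"
        by (intro Bochner_Integration.integral_cong refl)
      then show ?thesis
        using divergence_theorem_chart(2)[OF D(1) ch C(1,2) sub b] by simp
    qed
    have "indicator D x *\<^sub>R \<D> f x b
      = (\<Sum>i<N. indicator D x *\<^sub>R \<D> (?f i) x b)" for x
    proof (cases "x \<in> D")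
      case True
      then have x: "x \<in> V"
        using V(2) closure_subset by blast
      \<comment> \<open>The derivatives of the pieces add up to that of \<open>f\<close> because the
        partition functions sum to 1 on the open set \<open>V\<close>, not merely at
        \<open>x\<close>.\<close>
      have "((\<lambda>y. \<Sum>i<N. ?f i y) has_derivative (\<lambda>h. \<Sum>i<N. \<D> (?f i) x h)) (at x)"
        by (intro has_derivative_sum C1_on_has_derivative[OF C(1)]) auto
      then have "(f has_derivative (\<lambda>h. \<Sum>i<N. \<D> (?f i) x h)) (at x)"
        by (rule has_derivative_transform_within_open[OF _ V(1) x]) (simp add: V(3) flip: scaleR_sum_left)
      then show ?thesis
        by (simp flip: frechet_derivative_at add: scaleR_sum_right)
    qed simp
    then have "(\<integral>x. indicator D x *\<^sub>R \<D> f x b \<partial>lborel)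
      = (\<integral>x. (\<Sum>i<N. indicator D x *\<^sub>R \<D> (?f i) x b) \<partial>lborel)"
      by (simp only:)
    also have "\<dots> = (\<Sum>i<N. \<integral>x. indicator D x *\<^sub>R \<D> (?f i) x b \<partial>lborel)"
      by (intro Bochner_Integration.integral_sum integrable_indicator_derivative D C)
    also have "\<dots> = 0"
      by (intro sum.neutral ballI zero) auto
    finally show ?thesis .
  qed (rule U)
qed

text \<open>The chart theorem turns each local term into a volume integral of a derivative of
  \<open>\<rho> i *\<^sub>R \<Phi> b\<close>. Their sum over \<open>i\<close> differs from
  \<open>\<Phi> b\<close> by a function vanishing on the frontier, which contributes nothing; the
  result no longer mentions the chart system.\<close>

lemma has_flux_divergence:
  fixes \<Phi> :: "'a::euclidean_space \<Rightarrow> 'a \<Rightarrow> 'b::euclidean_space"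
  assumes D: "open D" "bounded D" "smooth_boundary D" and \<Phi>: "\<And>b. b \<in> Basis \<Longrightarrow> C1_on UNIV (\<Phi> b)"
  shows "has_flux D \<Phi> (\<integral>x. indicator D x *\<^sub>R (\<Sum>b\<in>Basis. \<D> (\<Phi> b) x b) \<partial>lborel)"
  unfolding has_flux_def
proof (intro allI impI)
  fix N :: nat and k \<gamma> W \<rho>
  assume sys: "chart_system D N k \<gamma> W \<rho>"
  have chart: "graph_chart D (k i) (\<gamma> i) (W i)" and \<rho>: "C1_on UNIV (\<rho> i)"
    "compact (closure {Y. \<rho> i Y \<noteq> 0})" "closure {Y. \<rho> i Y \<noteq> 0} \<subseteq> W i" if "i < N" for i
    using sys that unfolding chart_system_def by blast+
  let ?f = "\<lambda>i b x. \<rho> i x *\<^sub>R \<Phi> b x"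
  let ?J = "\<lambda>g b. \<integral>x. indicator D x *\<^sub>R \<D> g x b \<partial>lborel"
  note C = C1_on_support_mult[OF \<rho>(1,2) \<Phi>]
  have fd: "flux_density (k i) (\<gamma> i) (\<rho> i) \<Phi>
    = (\<lambda>u. \<Sum>b\<in>Basis. graph_conormal (k i) (\<gamma> i) u b *\<^sub>R ?f i b (graph_map (k i) (\<gamma> i) u))" for i
    by (simp add: flux_density_def fun_eq_iff)
  have sub: "closure {x. ?f i b x \<noteq> 0} \<subseteq> W i" if "i < N" "b \<in> Basis" for i b
    using C(3)[OF that(1,1,2)] \<rho>(3)[OF that(1)] by blast
  note dt = divergence_theorem_chart[OF D(1) chart C(1,2) sub]
  have int: "chart_integrable k \<gamma> \<rho> \<Phi> i" if "i < N" for i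
    unfolding fd using that by (intro Bochner_Integration.integrable_sum dt(1)) auto
  have "(\<integral>u. flux_density (k i) (\<gamma> i) (\<rho> i) \<Phi> u \<partial>hyperplane_lborel (k i)) = (\<Sum>b\<in>Basis. ?J (?f i b) b)"
    if "i < N" for i
    unfolding fd using that
    by (subst Bochner_Integration.integral_sum) (auto intro!: dt sum.cong simp del: scaleR_scaleR)
  then have "total_flux N k \<gamma> \<rho> \<Phi>
    = (\<Sum>i<N. \<Sum>b\<in>Basis. ?J (?f i b) b)"
    by simp
  also have "\<dots> = (\<Sum>b\<in>Basis. \<Sum>i<N. ?J (?f i b) b)"
    by (rule sum.swap)
  also have "\<dots> = (\<Sum>b\<in>Basis. ?J (\<Phi> b) b)"
  proof (rule sum.cong[OF refl])
    fix b :: 'a assume b: "b \<in> Basis"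
    let ?g = "\<lambda>x. (\<Sum>i<N. ?f i b x) - \<Phi> b x"
    have S: "C1_on UNIV (\<lambda>x. \<Sum>i<N. ?f i b x)"
      using b by (intro C1_on_sum C) auto
    have g: "C1_on UNIV ?g"
      by (intro C1_on_diff S \<Phi> b)
    \<comment> \<open>Inside \<open>D\<close> the difference may well be nonzero, since nothing is
      known there about the sum of the partition functions.\<close>
    have "?g Y = 0" if "Y \<in> frontier D" for Y
      using sys that unfolding chart_system_def by (simp flip: scaleR_sum_left)
    then have "?J ?g b = 0"
      by (intro integral_derivative_zero_boundary D g b)
    moreover have "?J ?g b = (\<Sum>i<N. ?J (?f i b) b) - ?J (\<Phi> b) b"
    proof -
      have "\<D> ?g x b
        = (\<Sum>i<N. \<D> (?f i b) x b) - \<D> (\<Phi> b) x b" for x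
      proof -
        have "(?g has_derivative (\<lambda>h. (\<Sum>i<N. \<D> (?f i b) x h)
           - \<D> (\<Phi> b) x h)) (at x)"
          using b by (intro has_derivative_diff has_derivative_sum C1_on_has_derivative[OF C(1)]
              C1_on_has_derivative[OF \<Phi>]) auto
        from frechet_derivative_at[OF this, symmetric] show ?thesis
          by simp
      qed
      then have "?J ?g b = (\<integral>x. (\<Sum>i<N. indicator D x *\<^sub>R \<D> (?f i b) x b)
          - indicator D x *\<^sub>R \<D> (\<Phi> b) x b \<partial>lborel)"
        by (simp add: scaleR_diff_right scaleR_sum_right)
      also have "\<dots> = (\<integral>x. (\<Sum>i<N. indicator D x *\<^sub>R \<D> (?f i b) x b) \<partial>lborel) - ?J (\<Phi> b) b"
        using b by (intro Bochner_Integration.integral_diff Bochner_Integration.integrable_sum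
            integrable_indicator_derivative D C \<Phi>) auto
      also have "(\<integral>x. (\<Sum>i<N. indicator D x *\<^sub>R \<D> (?f i b) x b) \<partial>lborel)
          = (\<Sum>i<N. ?J (?f i b) b)"
        using b by (intro Bochner_Integration.integral_sum integrable_indicator_derivative D C) auto
      finally show ?thesis .
    qed
    ultimately show "(\<Sum>i<N. ?J (?f i b) b) = ?J (\<Phi> b) b"
      by simp
  qed
  also have "\<dots> = (\<integral>x. indicator D x *\<^sub>R (\<Sum>b\<in>Basis. \<D> (\<Phi> b) x b) \<partial>lborel)"
    unfolding scaleR_sum_right
    by (intro Bochner_Integration.integral_sum[symmetric] integrable_indicator_derivative D \<Phi>)
  finally show "(\<forall>i<N. chart_integrable k \<gamma> \<rho> \<Phi> i) \<and>
    total_flux N k \<gamma> \<rho> \<Phi>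
      = (\<integral>x. indicator D x *\<^sub>R (\<Sum>b\<in>Basis. \<D> (\<Phi> b) x b) \<partial>lborel)"
    using int by blast
qed

text \<open>The derivative of the graph map sends \<open>b\<close> to
  \<open>b + \<D> \<gamma> u b *\<^sub>R k\<close>, so the pulled back frame is the one of
  \<open>vol_form_graph_frame\<close>, and the oriented volume form becomes the conormal.\<close>

lemma graph_pullback_eq_flux_density:
  fixes k :: "'m::{finite,linorder} point"
  assumes k: "k \<in> Basis \<union> uminus ` Basis" and \<gamma>: "C1_on UNIV \<gamma>"
    and \<omega>: "\<And>ts. \<omega> (graph_map k \<gamma> u) ts = (\<Sum>b\<in>Basis. vol_form (b # ts) *\<^sub>R \<Phi> b (graph_map k \<gamma> u))"
  shows "graph_pullback k \<gamma> (\<lambda>Y ts. \<rho> Y *\<^sub>R \<omega> Y ts) u = flux_density k \<gamma> \<rho> \<Phi> u"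
proof -
  let ?L = "\<D> \<gamma> u"
  have "(\<gamma> has_derivative ?L) (at u)"
    by (rule C1_on_has_derivative[OF \<gamma> UNIV_I])
  then have "(graph_map k \<gamma> has_derivative (\<lambda>b. b + ?L b *\<^sub>R k)) (at u)" and L: "linear ?L"
    unfolding graph_map_def[abs_def] by (auto intro!: derivative_eq_intros has_derivative_linear)
  then have D: "\<D> (graph_map k \<gamma>) u = (\<lambda>b. b + ?L b *\<^sub>R k)"
    by (metis frechet_derivative_at)
  show ?thesis
    unfolding graph_pullback_def Let_def D \<omega> flux_density_def graph_conormal_def
      vol_form_graph_frame[OF k L, symmetric]
    by (simp add: scaleR_sum_right ac_simps)
qed

text \<open>Pullbacks with nonzero weight evaluate the form at frontier points and on frames of
  length \<open>CARD('m) - 1\<close>, which is why \<open>\<omega>\<close> is prescribed only there.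
  Every chart system gives the value \<open>I\<close> and at least one exists, so the definite
  description denotes \<open>I\<close>.\<close>

lemma boundary_integral_eq_flux:
  fixes D :: "'m::{finite,linorder} point set"
  assumes D: "open D" "bounded D" "smooth_boundary D" and flux: "has_flux D \<Phi> I"
    and \<omega>: "\<And>Y ts. Y \<in> frontier D \<Longrightarrow> Suc (length ts) = CARD('m) \<Longrightarrow>
      \<omega> Y ts = (\<Sum>b\<in>Basis. vol_form (b # ts) *\<^sub>R \<Phi> b Y)"
  shows "boundary_integral D \<omega> = I"
proof -
  have pb: "graph_pullback (k i) (\<gamma> i) (\<lambda>Y ts. \<rho> i Y *\<^sub>R \<omega> Y ts) u = flux_density (k i) (\<gamma> i) (\<rho> i) \<Phi> u"
    if sys: "chart_system D N k \<gamma> W \<rho>" and i: "i < N" and u: "u \<in> space (hyperplane_lborel (k i))" for N k \<gamma> W \<rho> i u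
  proof -
    have chart: "graph_chart D (k i) (\<gamma> i) (W i)" and \<rho>: "closure {Y. \<rho> i Y \<noteq> 0} \<subseteq> W i"
      using sys i unfolding chart_system_def by blast+
    then have k: "k i \<in> Basis \<union> uminus ` Basis" and \<gamma>: "C1_on UNIV (\<gamma> i)"
      unfolding graph_chart_def Ck_on_1_iff[symmetric] by blast+
    show ?thesis
    proof (cases "\<rho> i (graph_map (k i) (\<gamma> i) u) = 0")
      case True
      then show ?thesis
        by (simp add: graph_pullback_def flux_density_def Let_def)
    next
      case False
      then have fr: "graph_map (k i) (\<gamma> i) u \<in> frontier D"
        using u \<rho> closure_subset[of "{Y. \<rho> i Y \<noteq> 0}"]
        by (intro graph_chart_frontier[OF D(1) chart]) (auto simp: space_hyperplane_lborel)
      \<comment> \<open>The flux formula for the pullback asks for the expansion on lists of every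
        length; \<open>\<omega>'\<close> satisfies it by definition and agrees with
        \<open>\<omega>\<close> on the frame in question.\<close>
      define \<omega>' where "\<omega>' Y ts = (\<Sum>b\<in>Basis. vol_form (b # ts) *\<^sub>R \<Phi> b Y)" for Y ts
      have "graph_pullback (k i) (\<gamma> i) (\<lambda>Y ts. \<rho> i Y *\<^sub>R \<omega> Y ts) u
          = graph_pullback (k i) (\<gamma> i) (\<lambda>Y ts. \<rho> i Y *\<^sub>R \<omega>' Y ts) u"
        unfolding graph_pullback_def Let_def \<omega>'_def
        by (subst \<omega>[OF fr]) (simp_all add: hyperplane_frame_props[OF k])
      also have "\<dots> = flux_density (k i) (\<gamma> i) (\<rho> i) \<Phi> u"
        by (rule graph_pullback_eq_flux_density[OF k \<gamma>]) (simp add: \<omega>'_def)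
      finally show ?thesis .
    qed
  qed
  have hb: "has_boundary_integral \<omega> D J \<longleftrightarrow> (\<exists>N k \<gamma> W \<rho>. chart_system D N k \<gamma> W \<rho> \<and> J = I)" for J
  proof -
    define Q where "Q N k \<gamma> \<rho> \<longleftrightarrow>
      (\<forall>i<N. integrable (hyperplane_lborel (k i)) (graph_pullback (k i) (\<gamma> i) (\<lambda>Y ts. \<rho> i Y *\<^sub>R \<omega> Y ts))) \<and>
      J = (\<Sum>i<N. \<integral>u. graph_pullback (k i) (\<gamma> i) (\<lambda>Y ts. \<rho> i Y *\<^sub>R \<omega> Y ts) u \<partial>hyperplane_lborel (k i))"
      for N :: nat and k :: "nat \<Rightarrow> 'm point" and \<gamma> \<rho> :: "nat \<Rightarrow> 'm point \<Rightarrow> real"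
    have Q: "Q N k \<gamma> \<rho> \<longleftrightarrow> J = I" if sys: "chart_system D N k \<gamma> W \<rho>" for N k \<gamma> W \<rho>
    proof -
      note pb' = pb[OF sys]
      have "integrable (hyperplane_lborel (k i)) (graph_pullback (k i) (\<gamma> i) (\<lambda>Y ts. \<rho> i Y *\<^sub>R \<omega> Y ts))"
        if "i < N" for i
        using flux sys that unfolding has_flux_def
        by (subst Bochner_Integration.integrable_cong[OF refl pb'[OF that]]) auto
      moreover have "(\<Sum>i<N. \<integral>u. graph_pullback (k i) (\<gamma> i) (\<lambda>Y ts. \<rho> i Y *\<^sub>R \<omega> Y ts) u \<partial>hyperplane_lborel (k i))
        = total_flux N k \<gamma> \<rho> \<Phi>"
        by (intro sum.cong refl Bochner_Integration.integral_cong pb') auto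
      moreover have "\<dots> = I"
        using flux sys unfolding has_flux_def by blast
      ultimately show ?thesis
        unfolding Q_def by auto
    qed
    have "has_boundary_integral \<omega> D J \<longleftrightarrow> (\<exists>N k \<gamma> W \<rho>. chart_system D N k \<gamma> W \<rho> \<and> Q N k \<gamma> \<rho>)"
      unfolding has_boundary_integral_def chart_system_def Ck_on_1_iff Q_def by (intro iff_exI) blast
    then show ?thesis
      using Q by blast
  qed
  obtain N k \<gamma> W \<rho> where "chart_system D N k \<gamma> W \<rho>"
    using ex_chart_system[OF D(2,3)] .
  then have "has_boundary_integral \<omega> D = (\<lambda>J. J = I)"
    unfolding hb fun_eq_iff by blast
  then show ?thesis
    unfolding boundary_integral_def by simp
qed



section \<open>Cauchy kernels\<close>

text \<open>Polar coordinates for radial functions. The measures are compared on the rays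
  \<open>{x<..}\<close>, where they must be finite: for \<open>norm\<close> the preimages would be
  complements of balls, for \<open>- norm\<close> they are balls of known volume.\<close>

lemma distr_minus_norm:
  "distr lborel borel (\<lambda>w::'a::euclidean_space. - norm w) =
    density lborel (\<lambda>r. ennreal (if r \<le> 0 then DIM('a) * unit_ball_vol DIM('a) * (- r) ^ (DIM('a) - 1) else 0))"
  (is "?M = density lborel (\<lambda>r. ennreal (?g r))")
proof (rule measure_eqI_lessThan)
  let ?V = "unit_ball_vol DIM('a)" and ?m = "DIM('a)"
  have E: "emeasure ?M {x<..} = ennreal (if x < 0 then ?V * (- x) ^ ?m else 0)" for x
  proof -
    have "emeasure ?M {x<..} = emeasure lborel {w::'a. x < - norm w}"
      by (subst emeasure_distr) (auto simp: vimage_def)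
    also have "{w::'a. x < - norm w} = (if x < 0 then ball 0 (- x) else {})"
      by (auto simp: less_minus_iff intro: order.strict_trans2[of x 0]) (smt (verit) norm_ge_zero)+
    finally show ?thesis
      by (simp add: emeasure_ball)
  qed
  show "emeasure ?M {x<..} < \<infinity>" for x
    by (simp add: E)
  show "emeasure ?M {x<..} = emeasure (density lborel (\<lambda>r. ennreal (?g r))) {x<..}" for x
  proof -
    let ?f = "\<lambda>r. ?m * ?V * (- r) ^ (?m - 1)"
    have "emeasure (density lborel (\<lambda>r. ennreal (?g r))) {x<..}
        = (\<integral>\<^sup>+r. ennreal (?g r) * indicator {x<..} r \<partial>lborel)"
      by (subst emeasure_density) auto
    also have "\<dots> = ennreal (if x < 0 then ?V * (- x) ^ ?m else 0)"
    proof (cases "x < 0")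
      case True
      have "(\<integral>\<^sup>+r. ennreal (?g r) * indicator {x<..} r \<partial>lborel)
          = (\<integral>\<^sup>+r. ennreal (?g r) * indicator {x..0} r \<partial>lborel)"
      proof (rule nn_integral_cong_AE)
        show "AE r in lborel. ennreal (?g r) * indicator {x<..} r = ennreal (?g r) * indicator {x..0} r"
          using AE_lborel_singleton[of x] by eventually_elim (auto simp: indicator_def)
      qed
      also have "\<dots> = (\<integral>\<^sup>+r. ennreal (?f r) * indicator {x..0} r \<partial>lborel)"
        by (intro nn_integral_cong) (auto simp: indicator_def)
      \<comment> \<open>The primitive is minus the volume of the ball of radius
        \<open>- r\<close>.\<close>
      also have "\<dots> = ennreal (- (?V * (- 0) ^ ?m) - - (?V * (- x) ^ ?m))"
      proof (rule nn_integral_FTC_Icc)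
        show "((\<lambda>r. - (?V * (- r) ^ ?m)) has_real_derivative ?f r) (at r)" for r
          by (auto intro!: derivative_eq_intros)
      qed (use True in auto)
      finally show ?thesis
        using True by (simp add: zero_power)
    next
      case False
      then have "ennreal (?g r) * indicator {x<..} r = 0" for r
        by (auto simp: indicator_def)
      then have "(\<integral>\<^sup>+r. ennreal (?g r) * indicator {x<..} r \<partial>lborel) = 0"
        by (simp only: nn_integral_const mult_zero_left)
      then show ?thesis
        using False by (simp only: if_False ennreal_0)
    qed
    finally show ?thesis
      by (simp add: E)
  qed
qed auto

lemma integral_radial:
  fixes f :: "real \<Rightarrow> real"
  assumes [measurable]: "f \<in> borel_measurable borel"
  shows "integral\<^sup>L lborel (\<lambda>w::'a::euclidean_space. f (norm w)) =
    (\<integral>r. (if 0 \<le> r then DIM('a) * unit_ball_vol DIM('a) * r ^ (DIM('a) - 1) * f r else 0) \<partial>lborel)"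
proof -
  let ?g = "\<lambda>r::real. if r \<le> 0 then DIM('a) * unit_ball_vol DIM('a) * (- r) ^ (DIM('a) - 1) else 0"
  have "integral\<^sup>L lborel (\<lambda>w::'a. f (norm w)) = (\<integral>r. f (- r) \<partial>distr lborel borel (\<lambda>w::'a. - norm w))"
    by (subst integral_distr) auto
  also have "\<dots> = (\<integral>r. ?g r *\<^sub>R f (- r) \<partial>lborel)"
    unfolding distr_minus_norm by (rule integral_density) auto
  also have "\<dots> = (\<integral>r. (if 0 \<le> r then DIM('a) * unit_ball_vol DIM('a) * r ^ (DIM('a) - 1) * f r else 0) \<partial>lborel)"
    by (subst lborel_integral_real_affine[of "-1" _ 0]) (auto intro!: Bochner_Integration.integral_cong)
  finally show ?thesis .
qed

text \<open>With \<open>s = w \<bullet> w\<close> this is the divergence of the field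
  \<open>w / norm w ^ (2 * d)\<close> cut off near 0, in dimension \<open>2 * d\<close>; it is an
  approximate identity up to a constant. It lives on the shell of radii between
  \<open>\<epsilon> / 2\<close> and \<open>\<epsilon>\<close>, and the value at \<open>s = 0\<close>
  is 0.\<close>

definition bump_kernel :: "real \<Rightarrow> nat \<Rightarrow> real \<Rightarrow> real" where
  "bump_kernel \<epsilon> d s = - 2 * cutoff' (s / \<epsilon>\<^sup>2) / \<epsilon>\<^sup>2 * (s / s ^ d)"

lemma bump_kernel_nonneg: "0 \<le> s \<Longrightarrow> 0 \<le> bump_kernel \<epsilon> d s"
proof -
  have 1: "0 \<le> - 2 * cutoff' (s / \<epsilon>\<^sup>2) / \<epsilon>\<^sup>2"
    using cutoff'_nonpos[of "s / \<epsilon>\<^sup>2"] by (intro divide_nonneg_nonneg) auto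
  assume "0 \<le> s"
  then have 2: "0 \<le> s / s ^ d"
    by simp
  show ?thesis
    unfolding bump_kernel_def by (rule mult_nonneg_nonneg[OF 1 2])
qed

lemma bump_kernel_eq_0: "\<epsilon> \<noteq> 0 \<Longrightarrow> s \<ge> \<epsilon>\<^sup>2 \<Longrightarrow> bump_kernel \<epsilon> d s = 0"
  by (simp add: bump_kernel_def cutoff'_eq_0)

lemma borel_measurable_cutoff'[measurable]: "cutoff' \<in> borel_measurable borel"
  by (rule borel_measurable_continuous_onI) (rule continuous_on_cutoff')

text \<open>In polar coordinates the dimension \<open>2 * d\<close> makes
  \<open>r ^ (2 * d - 1) * r\<^sup>2 / r ^ (2 * d)\<close> equal to \<open>r\<close>, so the radial
  density is the exact derivative of \<open>- cutoff (r\<^sup>2 / \<epsilon>\<^sup>2)\<close>. Its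
  increment is 1 for every \<open>\<epsilon>\<close>, and the sphere area remains.\<close>

lemma integral_bump_kernel:
  assumes m: "DIM('a) = 2 * d" and \<epsilon>: "\<epsilon> > 0"
  shows "integral\<^sup>L lborel (\<lambda>w::'a::euclidean_space. bump_kernel \<epsilon> d (w \<bullet> w)) = DIM('a) * unit_ball_vol DIM('a)"
    "integrable lborel (\<lambda>w::'a. bump_kernel \<epsilon> d (w \<bullet> w))"
proof -
  let ?V = "unit_ball_vol DIM('a)" and ?m = "DIM('a)"
  let ?F' = "\<lambda>r. - (cutoff' (r\<^sup>2 / \<epsilon>\<^sup>2) * (2 * r / \<epsilon>\<^sup>2))"
  have meas: "(\<lambda>r. bump_kernel \<epsilon> d (r\<^sup>2)) \<in> borel_measurable borel"
    unfolding bump_kernel_def by measurable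
  have "d \<ge> 1"
    using m DIM_positive[where 'a = 'a] by (cases d) auto
  have pow: "r ^ (?m - 1) * (r\<^sup>2 / (r\<^sup>2) ^ d) = r" if "r > 0" for r :: real
  proof -
    have "r ^ (?m - 1) * r\<^sup>2 = r * (r\<^sup>2) ^ d"
      using m \<open>d \<ge> 1\<close> by (simp flip: power_mult power_add power_Suc)
    then show ?thesis
      using that by (simp add: field_simps)
  qed
  have "integral\<^sup>L lborel (\<lambda>w::'a. bump_kernel \<epsilon> d (w \<bullet> w)) = integral\<^sup>L lborel (\<lambda>w::'a. bump_kernel \<epsilon> d ((norm w)\<^sup>2))"
    by (simp add: power2_norm_eq_inner)
  also have "\<dots> = (\<integral>r. (if 0 \<le> r then ?m * ?V * r ^ (?m - 1) * bump_kernel \<epsilon> d (r\<^sup>2) else 0) \<partial>lborel)"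
    by (rule integral_radial[OF meas])
  also have "\<dots> = (\<integral>r. (?m * ?V) *\<^sub>R (indicator {0..\<epsilon>} r *\<^sub>R ?F' r) \<partial>lborel)"
  proof (intro Bochner_Integration.integral_cong refl)
    fix r :: real
    consider "r < 0" | "r = 0" | "r > 0" "r \<le> \<epsilon>" | "r > \<epsilon>"
      by linarith
    then show "(if 0 \<le> r then ?m * ?V * r ^ (?m - 1) * bump_kernel \<epsilon> d (r\<^sup>2) else 0)
        = (?m * ?V) *\<^sub>R (indicator {0..\<epsilon>} r *\<^sub>R ?F' r)"
    proof cases
      case 3
      have "r ^ (?m - 1) * bump_kernel \<epsilon> d (r\<^sup>2) = - 2 * cutoff' (r\<^sup>2 / \<epsilon>\<^sup>2) / \<epsilon>\<^sup>2 * (r ^ (?m - 1) * (r\<^sup>2 / (r\<^sup>2) ^ d))"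
        by (simp add: bump_kernel_def)
      also have "\<dots> = ?F' r"
        unfolding pow[OF 3(1)] by simp
      finally show ?thesis
        using 3 by (simp add: mult.assoc)
    next
      case 4
      then have "bump_kernel \<epsilon> d (r\<^sup>2) = 0"
        using \<epsilon> by (intro bump_kernel_eq_0 power_mono) auto
      then show ?thesis
        using 4 by simp
    next
      case 2
      then have "bump_kernel \<epsilon> d (r\<^sup>2) = 0"
        by (simp add: bump_kernel_def)
      then show ?thesis
        using 2 by simp
    qed simp
  qed
  also have "\<dots> = (?m * ?V) *\<^sub>R (\<integral>r. indicator {0..\<epsilon>} r *\<^sub>R ?F' r \<partial>lborel)"
    by (rule integral_scaleR_right)
  also have "(\<integral>r. indicator {0..\<epsilon>} r *\<^sub>R ?F' r \<partial>lborel) = - cutoff (\<epsilon>\<^sup>2 / \<epsilon>\<^sup>2) - - cutoff (0\<^sup>2 / \<epsilon>\<^sup>2)"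
  proof (rule integral_FTC_Icc)
    show "((\<lambda>r. - cutoff (r\<^sup>2 / \<epsilon>\<^sup>2)) has_vector_derivative ?F' r) (at r within {0..\<epsilon>})" for r
    proof -
      have "((\<lambda>r. r\<^sup>2 / \<epsilon>\<^sup>2) has_real_derivative 2 * r / \<epsilon>\<^sup>2) (at r)"
      proof (rule DERIV_cdivide)
        show "((\<lambda>r. r\<^sup>2) has_real_derivative 2 * r) (at r)"
          by (auto intro!: derivative_eq_intros)
      qed
      from DERIV_minus[OF DERIV_chain2[OF DERIV_cutoff this]]
      show ?thesis
        by (rule has_vector_derivative_at_within[OF has_real_derivative_iff_has_vector_derivative[THEN iffD1]])
    qed
    show "continuous_on {0..\<epsilon>} ?F'"
      by (intro continuous_intros continuous_on_compose2[OF continuous_on_cutoff'[of UNIV]]) (use \<epsilon> in auto)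
  qed (use \<epsilon> in simp)
  also have "\<dots> = 1"
    using \<epsilon> by (simp add: cutoff_eq_0 cutoff_eq_1)
  finally show int: "integral\<^sup>L lborel (\<lambda>w::'a. bump_kernel \<epsilon> d (w \<bullet> w)) = ?m * ?V"
    by simp
  \<comment> \<open>The Bochner integral of a non-integrable function is 0 by convention, so a
    nonzero value already proves integrability.\<close>
  have "0 < real ?m * ?V"
    by (intro mult_pos_pos unit_ball_vol_pos) auto
  then have "real ?m * ?V \<noteq> 0"
    by (rule less_imp_neq[symmetric])
  then show "integrable lborel (\<lambda>w::'a. bump_kernel \<epsilon> d (w \<bullet> w))"
    using int not_integrable_integral_eq by metis
qed

lemma integral_lborel_translate:
  fixes f :: "'a::euclidean_space \<Rightarrow> 'b::{banach, second_countable_topology}"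
  assumes [measurable]: "f \<in> borel_measurable borel"
  shows "(\<integral>Y. f (Y - X) \<partial>lborel) = (\<integral>w. f w \<partial>lborel)"
    "integrable lborel f \<Longrightarrow> integrable lborel (\<lambda>Y. f (Y - X))"
proof -
  have e: "lborel = distr lborel borel ((+) (- X))"
    by (rule lborel_distr_plus[symmetric])
  show "(\<integral>Y. f (Y - X) \<partial>lborel) = (\<integral>w. f w \<partial>lborel)"
    by (subst (2) e, subst integral_distr) auto
  show "integrable lborel (\<lambda>Y. f (Y - X))" if "integrable lborel f"
    using that by (subst (asm) e, subst (asm) integrable_distr_eq) auto
qed

text \<open>Equal to 0 for \<open>s \<le> \<epsilon>\<^sup>2 / 4\<close> and to
  \<open>1 / s ^ d\<close> for \<open>s \<ge> \<epsilon>\<^sup>2\<close>. With \<open>d\<close> half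
  the dimension and \<open>s\<close> the squared distance to the pole it replaces the singular
  factor of the kernels.\<close>

definition regularized_power :: "real \<Rightarrow> nat \<Rightarrow> real \<Rightarrow> real" where
  "regularized_power \<epsilon> d s = (1 - cutoff (s / \<epsilon>\<^sup>2)) / s ^ d"

definition regularized_power' :: "real \<Rightarrow> nat \<Rightarrow> real \<Rightarrow> real" where
  "regularized_power' \<epsilon> d s = - (cutoff' (s / \<epsilon>\<^sup>2) / \<epsilon>\<^sup>2) / s ^ d - d * (1 - cutoff (s / \<epsilon>\<^sup>2)) / s ^ Suc d"

lemma DERIV_regularized_power:
  assumes \<epsilon>: "\<epsilon> > 0"
  shows "(regularized_power \<epsilon> d has_real_derivative regularized_power' \<epsilon> d s) (at s)"
proof (cases "s > 0")
  case True
  have 1: "((\<lambda>s. 1 - cutoff (s / \<epsilon>\<^sup>2)) has_real_derivative - (cutoff' (s / \<epsilon>\<^sup>2) / \<epsilon>\<^sup>2)) (at s)"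
  proof -
    have "((\<lambda>s. s / \<epsilon>\<^sup>2) has_real_derivative 1 / \<epsilon>\<^sup>2) (at s)"
      by (rule DERIV_cdivide[OF DERIV_ident])
    from DERIV_diff[OF DERIV_const DERIV_chain2[OF DERIV_cutoff this]] show ?thesis
      by simp
  qed
  have eq: "(a * s ^ d - c * (real d * s ^ (d - Suc 0))) / (s ^ d * s ^ d) = a / s ^ d - d * c / s ^ Suc d" for a c :: real
    using True by (cases d) (simp_all add: field_simps)
  show ?thesis
    using DERIV_divide[OF 1 DERIV_pow[of d s UNIV]] True
    unfolding regularized_power_def[abs_def] regularized_power'_def by (simp only: eq) simp
next
  case False
  \<comment> \<open>For \<open>s \<le> 0\<close> the division is harmless, since the function
    vanishes identically on the open half line below \<open>\<epsilon>\<^sup>2 / 4\<close>.\<close>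
  have "(regularized_power \<epsilon> d has_real_derivative 0) (at s)"
  proof (rule has_field_derivative_transform_within_open[of "\<lambda>_. 0" _ _ "{..<\<epsilon>\<^sup>2 / 4}"])
    show "0 = regularized_power \<epsilon> d t" if "t \<in> {..<\<epsilon>\<^sup>2 / 4}" for t
      using that \<epsilon> by (simp add: regularized_power_def cutoff_eq_1 field_simps)
    have "s < \<epsilon>\<^sup>2 / 4"
      using False zero_less_power[OF \<epsilon>, of 2] by linarith
    then show "s \<in> {..<\<epsilon>\<^sup>2 / 4}"
      by (simp only: lessThan_iff)
  qed auto
  moreover have "s / \<epsilon>\<^sup>2 \<le> 1 / 4"
    using False \<epsilon> by (auto simp: not_less intro: order.trans[of _ 0] divide_nonpos_nonneg)
  ultimately show ?thesis
    by (simp add: regularized_power'_def cutoff_eq_1 cutoff'_eq_0)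
qed

lemma C1_on_regularized_power:
  assumes \<epsilon>: "\<epsilon> > 0"
  shows "C1_on UNIV (regularized_power \<epsilon> d)"
proof (rule C1_on_real[OF DERIV_regularized_power[OF \<epsilon>]])
  have U: "{..<\<epsilon>\<^sup>2 / 4} \<union> {0<..} = (UNIV :: real set)"
  proof -
    have "s \<in> {..<\<epsilon>\<^sup>2 / 4} \<union> {0<..}" for s
    proof -
      have "s < \<epsilon>\<^sup>2 / 4 \<or> 0 < s"
        using zero_less_power[OF \<epsilon>, of 2] by linarith
      then show ?thesis
        by (simp only: Un_iff lessThan_iff greaterThan_iff)
    qed
    then show ?thesis
      by blast
  qed
  have "continuous_on ({..<\<epsilon>\<^sup>2 / 4} \<union> {0<..}) (regularized_power' \<epsilon> d)"
  proof (rule continuous_on_open_Un)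
    have "0 = regularized_power' \<epsilon> d s" if "s \<in> {..<\<epsilon>\<^sup>2 / 4}" for s
      using that \<epsilon> by (simp add: regularized_power'_def cutoff_eq_1 cutoff'_eq_0 field_simps)
    then show "continuous_on {..<\<epsilon>\<^sup>2 / 4} (regularized_power' \<epsilon> d)"
      by (rule continuous_on_eq[OF continuous_on_const])
    show "continuous_on {0<..} (regularized_power' \<epsilon> d)"
      unfolding regularized_power'_def[abs_def]
      by (intro continuous_intros continuous_on_compose2[OF continuous_on_cutoff'[of UNIV]]
          continuous_on_compose2[OF C1_on_continuous[OF C1_on_cutoff[of UNIV]]]) (use \<epsilon> in auto)
  qed auto
  then show "continuous_on UNIV (regularized_power' \<epsilon> d)"
    unfolding U .
qed

text \<open>\<open>1 / s ^ d\<close> is homogeneous of degree \<open>-d\<close> in \<open>s\<close>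
  and is annihilated by this Euler-type expression, so only the derivative of the cut-off
  remains.\<close>

lemma regularized_power_divergence:
  assumes "\<epsilon> > 0" "0 < d" "0 \<le> s"
  shows "2 * real d * regularized_power \<epsilon> d s + 2 * s * regularized_power' \<epsilon> d s = bump_kernel \<epsilon> d s"
proof (cases "s = 0")
  case True
  then show ?thesis
    using assms by (simp add: regularized_power_def bump_kernel_def cutoff_eq_1)
next
  case False
  then show ?thesis
    using assms by (simp add: regularized_power_def regularized_power'_def bump_kernel_def field_simps)
qed

lemma has_flux_unique:
  assumes "bounded D" "smooth_boundary D" "has_flux D \<Phi> I" "has_flux D \<Phi> J"
  shows "I = J"
proof -
  obtain N k \<gamma> W \<rho> where "chart_system D N k \<gamma> W \<rho>"
    using ex_chart_system[OF assms(1,2)] .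
  then show ?thesis
    using assms(3,4) unfolding has_flux_def by blast
qed

text \<open>Weighting \<open>g\<close> by partition functions supported in \<open>\<Omega>\<close>
  extends it by zero, and near \<open>K\<close> the weights sum to 1. Agreement on an open set
  preserves the derivatives as well.\<close>

lemma C1_on_global_extension:
  fixes g :: "'a::euclidean_space \<Rightarrow> 'b::real_normed_vector"
  assumes K: "compact K" and \<Omega>: "open \<Omega>" "K \<subseteq> \<Omega>" and g: "C1_on \<Omega> g"
  obtains g' V where "C1_on UNIV g'" "open V" "K \<subseteq> V" "\<And>Y. Y \<in> V \<Longrightarrow> g' Y = g Y"
proof -
  have "open \<Omega> \<and> q \<in> \<Omega>" if "q \<in> K" for q
    using that \<Omega> by blast
  then show ?thesis
  proof (rule C1_partition_of_unity[OF K, where U = "\<lambda>_. \<Omega>"])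
    fix N :: nat and c V and \<rho> :: "nat \<Rightarrow> 'a \<Rightarrow> real"
    assume V: "open V" "K \<subseteq> V" "\<And>Y. Y \<in> V \<Longrightarrow> (\<Sum>i<N. \<rho> i Y) = 1"
      and \<rho>: "\<And>i. C1_on UNIV (\<rho> i)" "\<And>i. i < N \<Longrightarrow> closure {Y. \<rho> i Y \<noteq> 0} \<subseteq> \<Omega>"
    have "C1_on UNIV (\<lambda>Y. \<Sum>i<N. \<rho> i Y *\<^sub>R g Y)"
      by (intro C1_on_sum C1_on_extend_by_zero[OF \<Omega>(1) \<rho>(2) \<rho>(1) g]) auto
    moreover have "(\<Sum>i<N. \<rho> i Y *\<^sub>R g Y) = g Y" if "Y \<in> V" for Y
      using V(3)[OF that] by (simp flip: scaleR_sum_left)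
    ultimately show thesis
      using V(1,2) that by blast
  qed
qed

text \<open>On \<open>D\<close> the divergence of the regularized kernel is a multiple of an approximate identity
  at \<open>X\<close>, while on the boundary the regularization is invisible; hence the flux does not depend on
  the radius \<open>\<epsilon>\<close>, and letting \<open>\<epsilon> \<rightarrow> 0\<close> computes it.\<close>

theorem has_flux_Cauchy_kernel:
  fixes g :: "'a::euclidean_space \<Rightarrow> 'b::euclidean_space" and L :: "'a \<Rightarrow> 'a \<Rightarrow> 'b \<Rightarrow> 'b"
  assumes dim: "DIM('a) = 2 * d"
    and D: "open D" "bounded D" "smooth_boundary D" and X: "X \<in> D"
    and \<Omega>: "open \<Omega>" "closure D \<subseteq> \<Omega>" and g: "C1_on \<Omega> g"
    and L: "\<And>b. b \<in> Basis \<Longrightarrow> bounded_bilinear (\<lambda>w. L w b)" and l: "bounded_linear l"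
    and Ll: "\<And>w y. (\<Sum>b\<in>Basis. (w \<bullet> b) *\<^sub>R L w b y) = (w \<bullet> w) *\<^sub>R l y"
    and Lg: "\<And>w Y. Y \<in> D \<Longrightarrow> (\<Sum>b\<in>Basis. L w b (\<D> g Y b)) = 0"
  shows "has_flux D (\<lambda>b Y. (1 / norm (Y - X) ^ (2 * d)) *\<^sub>R L (Y - X) b (g Y))
    ((DIM('a) * unit_ball_vol DIM('a)) *\<^sub>R l (g X))"
proof -
  define C where "C = DIM('a) * unit_ball_vol DIM('a)"
  have d: "0 < d"
    using dim DIM_positive[where 'a = 'a] by (cases d) auto
  have "unit_ball_vol DIM('a) > 0"
    by (rule unit_ball_vol_pos) simp
  then have C: "C > 0"
    by (simp add: C_def)
  \<comment> \<open>The diagonal case \<open>w = b\<close> of \<open>Ll\<close> gives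
    \<open>L b b = l\<close>. Summing over the basis is the divergence of the linear field
    \<open>L (Y - X)\<close>, hence the factor equal to the dimension.\<close>
  have Lbb: "(\<Sum>b\<in>Basis. L b b y) = DIM('a) *\<^sub>R l y" for y
  proof -
    have "L b b y = l y" if "b \<in> Basis" for b
    proof -
      have "(\<Sum>b'\<in>Basis. (b \<bullet> b') *\<^sub>R L b b' y) = (\<Sum>b'\<in>Basis. if b' = b then L b b y else 0)"
        using that by (intro sum.cong) (auto simp: inner_Basis)
      also have "\<dots> = L b b y"
        using that by simp
      finally show ?thesis
        using Ll[of b y] that by simp
    qed
    then show ?thesis
      by (simp add: sum_constant_scaleR)
  qed
  have "compact (closure D)"
    using D(2) by (simp add: compact_closure)
  then obtain g' V where g': "C1_on UNIV g'" and V: "open V" "closure D \<subseteq> V" "\<And>Y. Y \<in> V \<Longrightarrow> g' Y = g Y"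
    using C1_on_global_extension[OF _ \<Omega> g] by metis
  have DV: "Y \<in> V" if "Y \<in> D \<or> Y \<in> frontier D" for Y
    using that V(2) closure_subset[of D] by (auto simp: frontier_def)
  have Dg': "\<D> g' Y = \<D> g Y" if "Y \<in> D" for Y
  proof -
    have "(g has_derivative \<D> g' Y) (at Y)"
      by (rule has_derivative_transform_within_open[OF C1_on_has_derivative[OF g' UNIV_I] V(1)])
        (use that DV V(3) in auto)
    then show ?thesis
      by (rule frechet_derivative_at)
  qed
  obtain e0 where e0: "e0 > 0" "ball X e0 \<subseteq> D"
    using D(1) X open_contains_ball by blast
  let ?\<Phi> = "\<lambda>b Y. (1 / norm (Y - X) ^ (2 * d)) *\<^sub>R L (Y - X) b (g Y)"
  define J where "J \<epsilon> = (\<integral>Y. bump_kernel \<epsilon> d ((Y - X) \<bullet> (Y - X)) *\<^sub>R l (g' Y) \<partial>lborel)" for \<epsilon>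
  have flux: "has_flux D ?\<Phi> (J \<epsilon>)" if \<epsilon>: "0 < \<epsilon>" "\<epsilon> < e0" for \<epsilon>
  proof -
    define \<Psi> where "\<Psi> b Y = regularized_power \<epsilon> d ((Y - X) \<bullet> (Y - X)) *\<^sub>R L (Y - X) b (g' Y)" for b Y
    have C1: "C1_on UNIV (\<Psi> b)" if "b \<in> Basis" for b
      unfolding \<Psi>_def[abs_def]
      by (intro C1_on_scaleR C1_on_compose[OF C1_on_regularized_power[OF \<epsilon>(1)]] C1_on_bilinear[OF L[OF that]]
          C1_on_intros g') auto
    have D\<Psi>: "\<D> (\<Psi> b) Y b =
        regularized_power \<epsilon> d ((Y - X) \<bullet> (Y - X)) *\<^sub>R (L (Y - X) b (\<D> g' Y b) + L b b (g' Y))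
        + (regularized_power' \<epsilon> d ((Y - X) \<bullet> (Y - X)) * (2 * ((Y - X) \<bullet> b))) *\<^sub>R L (Y - X) b (g' Y)"
      if "b \<in> Basis" for b Y
    proof -
      have 1: "((\<lambda>Y. (Y - X) \<bullet> (Y - X)) has_derivative (\<lambda>h. (Y - X) \<bullet> h + h \<bullet> (Y - X))) (at Y)"
        by (auto intro!: derivative_eq_intros)
      have 2: "((\<lambda>Y. regularized_power \<epsilon> d ((Y - X) \<bullet> (Y - X))) has_derivative
         (\<lambda>h. regularized_power' \<epsilon> d ((Y - X) \<bullet> (Y - X)) * ((Y - X) \<bullet> h + h \<bullet> (Y - X)))) (at Y)"
        using has_derivative_compose[OF 1 DERIV_regularized_power[OF \<epsilon>(1), of d, THEN has_field_derivative_imp_has_derivative]]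
        by simp
      have 3: "((\<lambda>Y. L (Y - X) b (g' Y)) has_derivative
         (\<lambda>h. L (Y - X) b (\<D> g' Y h) + L h b (g' Y))) (at Y)"
      proof -
        have "((\<lambda>Y. Y - X) has_derivative (\<lambda>h. h)) (at Y)"
          by (auto intro!: derivative_eq_intros)
        from bounded_bilinear.FDERIV[OF L[OF that] this C1_on_has_derivative[OF g' UNIV_I]]
        show ?thesis .
      qed
      from has_derivative_scaleR[OF 2 3] have "(\<Psi> b has_derivative (\<lambda>h.
        regularized_power \<epsilon> d ((Y - X) \<bullet> (Y - X)) *\<^sub>R (L (Y - X) b (\<D> g' Y h) + L h b (g' Y))
        + (regularized_power' \<epsilon> d ((Y - X) \<bullet> (Y - X)) * ((Y - X) \<bullet> h + h \<bullet> (Y - X))) *\<^sub>R L (Y - X) b (g' Y))) (at Y)"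
        unfolding \<Psi>_def[abs_def] .
      from frechet_derivative_at[OF this, symmetric] show ?thesis
        by (simp add: inner_commute)
    qed
    \<comment> \<open>Of the three terms of the product rule, the one differentiating
      \<open>g'\<close> vanishes by \<open>Lg\<close>, the one differentiating \<open>Y - X\<close>
      gives the trace \<open>Lbb\<close>, and the one differentiating the power gives
      \<open>Ll\<close> at \<open>w = Y - X\<close>.\<close>
    have div: "(\<Sum>b\<in>Basis. \<D> (\<Psi> b) Y b)
        = bump_kernel \<epsilon> d ((Y - X) \<bullet> (Y - X)) *\<^sub>R l (g' Y)" if "Y \<in> D" for Y
    proof -
      let ?s = "(Y - X) \<bullet> (Y - X)"
      have "(\<Sum>b\<in>Basis. \<D> (\<Psi> b) Y b) =
        regularized_power \<epsilon> d ?s *\<^sub>R ((\<Sum>b\<in>Basis. L (Y - X) b (\<D> g' Y b)) + (\<Sum>b\<in>Basis. L b b (g' Y)))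
        + (2 * regularized_power' \<epsilon> d ?s) *\<^sub>R (\<Sum>b\<in>Basis. ((Y - X) \<bullet> b) *\<^sub>R L (Y - X) b (g' Y))"
        by (simp add: D\<Psi> sum.distrib scaleR_sum_right scaleR_add_right ac_simps)
      also have "\<dots> = (2 * real d * regularized_power \<epsilon> d ?s + 2 * ?s * regularized_power' \<epsilon> d ?s) *\<^sub>R l (g' Y)"
        by (simp add: Dg'[OF that] Lg[OF that] Lbb Ll dim scaleR_add_left ac_simps)
      finally show ?thesis
        unfolding regularized_power_divergence[OF \<epsilon>(1) d inner_ge_zero] .
    qed
    have "has_flux D \<Psi> (\<integral>Y. indicator D Y *\<^sub>R (\<Sum>b\<in>Basis. \<D> (\<Psi> b) Y b) \<partial>lborel)"
      by (rule has_flux_divergence[OF D C1])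
    also have "(\<integral>Y. indicator D Y *\<^sub>R (\<Sum>b\<in>Basis. \<D> (\<Psi> b) Y b) \<partial>lborel) = J \<epsilon>"
      unfolding J_def
    proof (rule Bochner_Integration.integral_cong[OF refl])
      fix Y
      show "indicator D Y *\<^sub>R (\<Sum>b\<in>Basis. \<D> (\<Psi> b) Y b)
        = bump_kernel \<epsilon> d ((Y - X) \<bullet> (Y - X)) *\<^sub>R l (g' Y)"
      proof (cases "Y \<in> D")
        case False
        then have "e0 \<le> norm (Y - X)"
          using e0(2) by (auto simp: dist_norm norm_minus_commute subset_iff not_less[symmetric])
        then have "\<epsilon>\<^sup>2 \<le> (norm (Y - X))\<^sup>2"
          using \<epsilon> by (intro power_mono) auto
        then have "bump_kernel \<epsilon> d ((Y - X) \<bullet> (Y - X)) = 0"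
          using \<epsilon>(1) by (intro bump_kernel_eq_0) (auto simp: power2_norm_eq_inner)
        then show ?thesis
          using False by simp
      qed (simp add: div)
    qed
    finally show ?thesis
    proof (rule has_flux_cong[OF D(1)])
      fix b Y :: 'a assume "Y \<in> frontier D"
      then have "Y \<notin> D"
        using D(1) by (simp add: frontier_def interior_open)
      then have "e0 \<le> norm (Y - X)"
        using e0(2) by (auto simp: dist_norm norm_minus_commute subset_iff not_less[symmetric])
      then have "\<epsilon>\<^sup>2 \<le> (norm (Y - X))\<^sup>2"
        using \<epsilon> by (intro power_mono) auto
      then have "1 \<le> (Y - X) \<bullet> (Y - X) / \<epsilon>\<^sup>2"
        using \<epsilon>(1) by (simp add: power2_norm_eq_inner field_simps)
      then have "regularized_power \<epsilon> d ((Y - X) \<bullet> (Y - X)) = 1 / norm (Y - X) ^ (2 * d)"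
        by (simp add: regularized_power_def cutoff_eq_0 power_mult power2_norm_eq_inner)
      then show "\<Psi> b Y = ?\<Phi> b Y"
        using V(3) DV \<open>Y \<in> frontier D\<close> by (simp add: \<Psi>_def)
    qed
  qed
  \<comment> \<open>The bump is nonnegative with total mass \<open>C\<close>, so replacing
    \<open>l (g' Y)\<close> by \<open>l (g' X)\<close> costs at most its oscillation over the ball
    of radius \<open>\<epsilon>\<close> times \<open>C\<close>.\<close>
  have est: "norm (J \<epsilon> - C *\<^sub>R l (g' X)) \<le> C * \<eta>"
    if \<epsilon>: "0 < \<epsilon>" and \<eta>: "\<And>Y. dist Y X \<le> \<epsilon> \<Longrightarrow> norm (l (g' Y) - l (g' X)) \<le> \<eta>" for \<epsilon> \<eta>
  proof -
    let ?\<kappa> = "\<lambda>Y. bump_kernel \<epsilon> d ((Y - X) \<bullet> (Y - X))"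
    have m: "(\<lambda>w::'a. bump_kernel \<epsilon> d (w \<bullet> w)) \<in> borel_measurable borel"
      unfolding bump_kernel_def by measurable
    have \<kappa>: "integrable lborel ?\<kappa>" "(\<integral>Y. ?\<kappa> Y \<partial>lborel) = C"
      using integral_lborel_translate[OF m] integral_bump_kernel[OF dim \<epsilon>] by (simp_all add: C_def)
    have nn: "0 \<le> ?\<kappa> Y" for Y
      by (rule bump_kernel_nonneg) simp
    have zero: "?\<kappa> Y = 0" if "\<not> dist Y X \<le> \<epsilon>" for Y
    proof (rule bump_kernel_eq_0)
      have "\<epsilon>\<^sup>2 \<le> (norm (Y - X))\<^sup>2"
        using that \<epsilon> by (intro power_mono) (auto simp: dist_norm)
      then show "\<epsilon>\<^sup>2 \<le> (Y - X) \<bullet> (Y - X)"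
        by (simp add: power2_norm_eq_inner)
    qed (use \<epsilon> in simp)
    have pw: "norm (?\<kappa> Y *\<^sub>R (l (g' Y) - l (g' X))) \<le> ?\<kappa> Y * \<eta>" for Y
      using nn[of Y] \<eta>[of Y] zero[of Y] by (cases "dist Y X \<le> \<epsilon>") (auto intro: mult_left_mono)
    have lc: "continuous_on UNIV (\<lambda>Y. l (g' Y))"
      by (intro bounded_linear.continuous_on[OF l] C1_on_continuous[OF g'])
    have [measurable]: "(\<lambda>Y. l (g' Y)) \<in> borel_measurable borel"
      using lc by (rule borel_measurable_continuous_onI)
    have [measurable]: "?\<kappa> \<in> borel_measurable borel"
      unfolding bump_kernel_def by measurable
    have i0: "integrable lborel (\<lambda>Y. ?\<kappa> Y *\<^sub>R (l (g' Y) - l (g' X)))"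
    proof (rule Bochner_Integration.integrable_bound)
      show "integrable lborel (\<lambda>Y. ?\<kappa> Y * \<eta>)"
        by (intro integrable_mult_left \<kappa>)
      show "AE Y in lborel. norm (?\<kappa> Y *\<^sub>R (l (g' Y) - l (g' X))) \<le> norm (?\<kappa> Y * \<eta>)"
        using order.trans[OF pw abs_ge_self] by (intro AE_I2) (simp only: real_norm_def)
    qed measurable
    have i1: "integrable lborel (\<lambda>Y. ?\<kappa> Y *\<^sub>R l (g' X))"
      using \<kappa>(1) by (intro integrable_scaleR_left)
    have "J \<epsilon> = (\<integral>Y. ?\<kappa> Y *\<^sub>R (l (g' Y) - l (g' X)) + ?\<kappa> Y *\<^sub>R l (g' X) \<partial>lborel)"
      unfolding J_def by (simp add: scaleR_diff_right)
    also have "\<dots> = (\<integral>Y. ?\<kappa> Y *\<^sub>R (l (g' Y) - l (g' X)) \<partial>lborel) + C *\<^sub>R l (g' X)"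
      using i0 i1 \<kappa> by (simp add: Bochner_Integration.integral_add)
    finally have "J \<epsilon> - C *\<^sub>R l (g' X) = (\<integral>Y. ?\<kappa> Y *\<^sub>R (l (g' Y) - l (g' X)) \<partial>lborel)"
      by simp
    also have "norm \<dots> \<le> (\<integral>Y. ?\<kappa> Y * \<eta> \<partial>lborel)"
      using i0 pw \<kappa>(1) by (intro Bochner_Integration.integral_norm_bound_integral integrable_mult_left) auto
    also have "\<dots> = C * \<eta>"
      using \<kappa> by simp
    finally show ?thesis .
  qed
  have "isCont (\<lambda>Y. l (g' Y)) X"
    using bounded_linear.continuous_on[OF l C1_on_continuous[OF g']]
    by (simp add: continuous_on_eq_continuous_at)
  have J: "J (e0 / 2) = C *\<^sub>R l (g' X)"
  proof (rule ccontr)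
    assume ne: "J (e0 / 2) \<noteq> C *\<^sub>R l (g' X)"
    \<comment> \<open>Chosen so that \<open>C * \<eta>\<close> is half the supposed discrepancy. By
      uniqueness of the flux the discrepancy is the same for all small \<open>\<epsilon>\<close>, so
      the estimate bounds it by its own half.\<close>
    define \<eta> where "\<eta> = norm (J (e0 / 2) - C *\<^sub>R l (g' X)) / (2 * C)"
    have \<eta>: "\<eta> > 0"
      using ne C by (simp add: \<eta>_def)
    obtain \<delta> where \<delta>: "\<delta> > 0" "\<And>Y. dist Y X < \<delta> \<Longrightarrow> dist (l (g' Y)) (l (g' X)) < \<eta>"
      using \<open>isCont (\<lambda>Y. l (g' Y)) X\<close> \<eta> unfolding continuous_at_eps_delta by blast
    define \<epsilon> where "\<epsilon> = min \<delta> e0 / 2"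
    have \<epsilon>: "0 < \<epsilon>" "\<epsilon> < \<delta>" "\<epsilon> < e0"
      using \<delta>(1) e0(1) by (auto simp: \<epsilon>_def)
    have "J \<epsilon> = J (e0 / 2)"
      by (rule has_flux_unique[OF D(2,3) flux[OF \<epsilon>(1,3)] flux]) (use e0(1) in auto)
    moreover have "norm (J \<epsilon> - C *\<^sub>R l (g' X)) \<le> C * \<eta>"
      using \<delta>(2) \<epsilon> by (intro est) (auto simp: dist_norm intro: less_imp_le)
    ultimately have "norm (J (e0 / 2) - C *\<^sub>R l (g' X)) \<le> C * \<eta>"
      by simp
    then show False
      using C ne by (simp add: \<eta>_def)
  qed
  have "g' X = g X"
    using X by (intro V(3) DV) auto
  then show ?thesis
    using flux[of "e0 / 2"] e0(1) J by (simp add: C_def)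
qed



section \<open>Differentiating a flux with respect to the pole\<close>

lemma C1_on_derivative_bounded:
  fixes f :: "'a::euclidean_space \<Rightarrow> 'b::real_normed_vector"
  assumes f: "C1_on S f" and K: "compact K" "K \<subseteq> S"
  shows "\<exists>B. \<forall>x\<in>K. \<forall>h. norm (\<D> f x h) \<le> B * norm h"
proof -
  have "\<exists>B. \<forall>x\<in>K. norm (\<D> f x b) \<le> B" for b
  proof -
    have "compact ((\<lambda>x. \<D> f x b) ` K)"
      by (intro compact_continuous_image continuous_on_subset[OF C1_on_continuous_derivative[OF f]] K)
    then obtain B where B: "\<And>y. y \<in> (\<lambda>x. \<D> f x b) ` K \<Longrightarrow> norm y \<le> B"
      using compact_imp_bounded bounded_iff by metis
    then show ?thesis
      by blast
  qed
  then obtain B where B: "\<And>x b. x \<in> K \<Longrightarrow> norm (\<D> f x b) \<le> B b"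
    by metis
  have "norm (\<D> f x h) \<le> (\<Sum>b\<in>Basis. B b) * norm h" if "x \<in> K" for x h
  proof -
    interpret linear "\<D> f x"
      using C1_on_has_derivative[OF f] that K(2) has_derivative_linear by blast
    have "\<D> f x (\<Sum>b\<in>Basis. (h \<bullet> b) *\<^sub>R b)
        = (\<Sum>b\<in>Basis. (h \<bullet> b) *\<^sub>R \<D> f x b)"
      by (simp only: sum scale)
    then have e: "\<D> f x h = (\<Sum>b\<in>Basis. (h \<bullet> b) *\<^sub>R \<D> f x b)"
      by (simp only: euclidean_representation)
    have "norm (\<D> f x h) \<le> (\<Sum>b\<in>Basis. norm h * B b)"
      unfolding e
      by (intro sum_norm_le) (simp add: mult_mono Basis_le_norm B[OF that])
    then show ?thesis
      by (simp add: sum_distrib_left mult.commute)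
  qed
  then show ?thesis
    by blast
qed

lemma has_derivative_difference_quotient:
  assumes f: "(f has_derivative f') (at x)" and e: "norm e = 1" and t: "t \<longlonglongrightarrow> 0" "\<And>n. t n > 0"
  shows "(\<lambda>n. (1 / t n) *\<^sub>R (f (x + t n *\<^sub>R e) - f x)) \<longlonglongrightarrow> f' e"
proof -
  interpret linear f'
    using f by (rule has_derivative_linear)
  have "filterlim (\<lambda>n. t n *\<^sub>R e) (at 0) sequentially"
    unfolding filterlim_at
  proof
    show "(\<lambda>n. t n *\<^sub>R e) \<longlonglongrightarrow> 0"
      using tendsto_scaleR[OF t(1) tendsto_const[of e]] by simp
    show "\<forall>\<^sub>F n in sequentially. t n *\<^sub>R e \<in> UNIV \<and> t n *\<^sub>R e \<noteq> 0"
      using t(2) e by (intro always_eventually) (auto simp: less_imp_neq[symmetric])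
  qed
  then have "(\<lambda>n. norm (f (x + t n *\<^sub>R e) - f x - f' (t n *\<^sub>R e)) / norm (t n *\<^sub>R e)) \<longlonglongrightarrow> 0"
    using f[unfolded has_derivative_at] filterlim_compose by blast
  moreover have "norm (f (x + t n *\<^sub>R e) - f x - f' (t n *\<^sub>R e)) / norm (t n *\<^sub>R e)
     = norm ((1 / t n) *\<^sub>R (f (x + t n *\<^sub>R e) - f x) - f' e)" for n
  proof -
    have "(1 / t n) *\<^sub>R (f (x + t n *\<^sub>R e) - f x) - f' e = (1 / t n) *\<^sub>R (f (x + t n *\<^sub>R e) - f x - f' (t n *\<^sub>R e))"
      using t(2)[of n] by (simp add: scale scaleR_diff_right)
    then show ?thesis
      using t(2)[of n] e by (simp add: divide_inverse mult.commute)
  qed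
  ultimately show ?thesis
    by (simp add: tendsto_norm_zero_iff LIM_zero_iff)
qed

text \<open>Differentiation under the integral sign. The difference quotients along a sequence
  tending to \<open>X\<close> are again fluxes by linearity. On the frontier they converge pointwise
  and are uniformly bounded by a Lipschitz estimate for \<open>K\<close>, so
  \<open>has_flux_limit\<close> applies.\<close>

lemma has_flux_kernel_derivative:
  fixes K :: "'a::euclidean_space \<Rightarrow> 'c::euclidean_space" and B :: "'a \<Rightarrow> 'c \<Rightarrow> 'b \<Rightarrow> 'b::euclidean_space"
  assumes D: "open D" "bounded D" and X: "X \<in> D" and K: "C1_on (- {0}) K"
    and B: "\<And>b. b \<in> Basis \<Longrightarrow> bounded_bilinear (B b)" and g: "continuous_on (frontier D) g"
    and flux: "\<And>Z. Z \<in> D \<Longrightarrow> has_flux D (\<lambda>b Y. B b (K (Y - Z)) (g Y)) (I Z)"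
    and I: "(I has_derivative I') (at X)" and e: "norm e = 1"
  shows "has_flux D (\<lambda>b Y. B b (\<D> (\<lambda>Z. K (Y - Z)) X e) (g Y)) (I' e)"
proof -
  \<comment> \<open>The radius \<open>2 * r\<close> leaves a margin \<open>r\<close>: poles within
    \<open>r\<close> of \<open>X\<close> stay at distance at least \<open>r\<close> from the
    frontier.\<close>
  obtain r where r: "r > 0" "cball X (2 * r) \<subseteq> D"
  proof -
    obtain r0 where "r0 > 0" "cball X r0 \<subseteq> D"
      using D(1) X open_contains_cball by blast
    then show ?thesis
      using that[of "r0 / 2"] by auto
  qed
  have cf: "compact (frontier D)"
    using D(2) by (rule compact_frontier_bounded)
  have far: "2 * r \<le> norm (Y - X)" if "Y \<in> frontier D" for Y
  proof (rule ccontr)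
    assume "\<not> 2 * r \<le> norm (Y - X)"
    then have "Y \<in> cball X (2 * r)"
      by (simp add: dist_norm norm_minus_commute)
    then have "Y \<in> D"
      using r(2) by blast
    then show False
      using that D(1) by (simp add: frontier_def interior_open)
  qed
  obtain R where R: "\<And>Y. Y \<in> frontier D \<Longrightarrow> norm (Y - X) \<le> R"
  proof -
    have "compact ((\<lambda>Y. Y - X) ` frontier D)"
      by (intro compact_continuous_image continuous_intros cf)
    then obtain R where "\<And>w. w \<in> (\<lambda>Y. Y - X) ` frontier D \<Longrightarrow> norm w \<le> R"
      using compact_imp_bounded bounded_iff by metis
    then show ?thesis
      using that by blast
  qed
  \<comment> \<open>A compact shell avoiding the singularity and containing the ball of radius
    \<open>r\<close> around \<open>Y - X\<close> for every frontier point \<open>Y\<close>.\<close>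
  let ?A = "{w::'a. r \<le> norm w \<and> norm w \<le> R + r}"
  have "?A = cball 0 (R + r) - ball 0 r"
    by (auto simp: not_less)
  then have A: "compact ?A"
    by (simp add: compact_diff)
  have "?A \<subseteq> - {0}"
    using r(1) by auto
  from C1_on_derivative_bounded[OF K A this]
  obtain M where M: "\<And>w h. w \<in> ?A \<Longrightarrow> norm (\<D> K w h) \<le> M * norm h"
    by blast
  have lip: "norm (K (Y - Z) - K (Y - X)) \<le> M * norm (Z - X)" if Y: "Y \<in> frontier D" and Z: "norm (Z - X) \<le> r" for Y Z
  proof -
    have A: "w \<in> ?A" if "w \<in> cball (Y - X) r" for w
    proof -
      have d: "norm (Y - X - w) \<le> r"
        using that by (simp add: dist_norm)
      have w: "Y - X - (Y - X - w) = w"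
        by simp
      have "norm (Y - X) - norm (Y - X - w) \<le> norm w" "norm w \<le> norm (Y - X) + norm (Y - X - w)"
        using norm_triangle_ineq2[of "Y - X" "Y - X - w"] norm_triangle_ineq4[of "Y - X" "Y - X - w"]
        unfolding w by blast+
      then have "r \<le> norm w" "norm w \<le> R + r"
        using d far[OF Y] R[OF Y] by linarith+
      then show ?thesis
        by simp
    qed
    \<comment> \<open>The mean value inequality needs a convex set; the shell is not convex, but the
      ball around \<open>Y - X\<close> inside it is.\<close>
    have "norm (K (Y - Z) - K (Y - X)) \<le> M * norm ((Y - Z) - (Y - X))"
    proof (rule differentiable_bound[where S = "cball (Y - X) r" and f' = "\<lambda>w. \<D> K w"])
      show "(K has_derivative \<D> K w) (at w within cball (Y - X) r)"
        if "w \<in> cball (Y - X) r" for w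
        by (rule has_derivative_at_withinI[OF C1_on_has_derivative[OF K]]) (use A[OF that] r(1) in auto)
      show "onorm (\<D> K w) \<le> M" if "w \<in> cball (Y - X) r" for w
        by (rule onorm_le[OF M[OF A[OF that]]])
      show "Y - Z \<in> cball (Y - X) r" "Y - X \<in> cball (Y - X) r"
        using Z r(1) by (simp_all add: dist_norm)
    qed (rule convex_cball)
    then show ?thesis
      by (simp add: norm_minus_commute)
  qed
  obtain G where G: "\<And>Y. Y \<in> frontier D \<Longrightarrow> norm (g Y) \<le> G"
  proof -
    have "compact (g ` frontier D)"
      by (intro compact_continuous_image g cf)
    then obtain G where "\<And>y. y \<in> g ` frontier D \<Longrightarrow> norm y \<le> G"
      using compact_imp_bounded bounded_iff by metis
    then show ?thesis
      using that by blast
  qed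
  have "\<exists>c. \<forall>k y. norm (B b k y) \<le> norm k * norm y * c" if "b \<in> Basis" for b
    using bounded_bilinear.bounded[OF B[OF that]] by blast
  then obtain c where c: "\<And>b k y. b \<in> Basis \<Longrightarrow> norm (B b k y) \<le> norm k * norm y * c b"
    by metis
  define C where "C = (\<Sum>b\<in>Basis. \<bar>c b\<bar>)"
  have C: "norm (B b k y) \<le> norm k * norm y * C" if "b \<in> Basis" for b k y
  proof -
    have "c b \<le> C"
      using member_le_sum[OF that, of "\<lambda>b. \<bar>c b\<bar>"] unfolding C_def by simp
    then show ?thesis
      using c[OF that, of k y] by (meson mult_left_mono mult_nonneg_nonneg norm_ge_zero order_trans)
  qed
  \<comment> \<open>Positive, tending to 0 and never above \<open>r\<close>, so that every shifted
    pole lies in \<open>D\<close> and within reach of the Lipschitz bound.\<close>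
  define t where "t n = r / real (Suc n)" for n
  have t: "t \<longlonglongrightarrow> 0" "\<And>n. t n > 0" "\<And>n. t n \<le> r"
  proof -
    show "t \<longlonglongrightarrow> 0"
      unfolding t_def[abs_def] by (rule LIMSEQ_Suc[OF lim_const_over_n])
    show "t n > 0" "t n \<le> r" for n
      using r(1) by (auto simp: t_def field_simps)
  qed
  define X' where "X' n = X + t n *\<^sub>R e" for n
  have X': "X' n \<in> D" "norm (X' n - X) = t n" for n
  proof -
    show "norm (X' n - X) = t n"
      using t(2)[of n] e by (simp add: X'_def)
    then have "X' n \<in> cball X (2 * r)"
      using t(3)[of n] r(1) by (simp add: dist_norm norm_minus_commute)
    then show "X' n \<in> D"
      using r(2) by blast
  qed
  show ?thesis
  proof (rule has_flux_limit[OF D(1)])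
    fix n
    have sub: "has_flux D (\<lambda>b Y. B b (K (Y - X' n)) (g Y) + (- 1) *\<^sub>R B b (K (Y - X)) (g Y)) (I (X' n) + (- 1) *\<^sub>R I X)"
      by (intro has_flux_add flux X' X has_flux_bounded_linear[OF bounded_linear_scaleR_right])
    show "has_flux D (\<lambda>b Y. (1 / t n) *\<^sub>R (B b (K (Y - X' n)) (g Y) + (- 1) *\<^sub>R B b (K (Y - X)) (g Y)))
       ((1 / t n) *\<^sub>R (I (X' n) + (- 1) *\<^sub>R I X))"
      by (rule has_flux_bounded_linear[OF bounded_linear_scaleR_right sub])
  next
    show "(\<lambda>n. (1 / t n) *\<^sub>R (I (X' n) + (- 1) *\<^sub>R I X)) \<longlonglongrightarrow> I' e"
      using has_derivative_difference_quotient[OF I e t(1,2)] by (simp add: X'_def)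
  next
    fix b Y :: 'a assume b: "b \<in> Basis" and Y: "Y \<in> frontier D"
    have "Y - X \<in> - {0}"
      using far[OF Y] r(1) by auto
    then have "(K has_derivative \<D> K (Y - X)) (at (Y - X))"
      by (rule C1_on_has_derivative[OF K])
    moreover have "((\<lambda>Z. Y - Z) has_derivative (\<lambda>h. - h)) (at X)"
      by (auto intro!: derivative_eq_intros)
    ultimately have "((\<lambda>Z. K (Y - Z)) has_derivative (\<lambda>h. \<D> K (Y - X) (- h))) (at X)"
      using has_derivative_compose by blast
    then have "((\<lambda>Z. K (Y - Z)) has_derivative \<D> (\<lambda>Z. K (Y - Z)) X) (at X)"
      using frechet_derivative_at by metis
    then have "(\<lambda>n. (1 / t n) *\<^sub>R (K (Y - X' n) - K (Y - X))) \<longlonglongrightarrow> \<D> (\<lambda>Z. K (Y - Z)) X e"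
      unfolding X'_def by (rule has_derivative_difference_quotient[OF _ e t(1,2)])
    from bounded_bilinear.tendsto[OF B[OF b] this tendsto_const[of "g Y"]]
    show "(\<lambda>n. (1 / t n) *\<^sub>R (B b (K (Y - X' n)) (g Y) + (- 1) *\<^sub>R B b (K (Y - X)) (g Y)))
      \<longlonglongrightarrow> B b (\<D> (\<lambda>Z. K (Y - Z)) X e) (g Y)"
      using B[OF b] by (simp add: bounded_bilinear.scaleR_left bounded_bilinear.diff_left)
  next
    fix n and b Y :: 'a assume b: "b \<in> Basis" and Y: "Y \<in> frontier D"
    have "norm ((1 / t n) *\<^sub>R (B b (K (Y - X' n)) (g Y) + (- 1) *\<^sub>R B b (K (Y - X)) (g Y)))
        = (1 / t n) * norm (B b (K (Y - X' n) - K (Y - X)) (g Y))"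
      using B[OF b] t(2)[of n] by (simp add: bounded_bilinear.diff_left)
    also have "\<dots> \<le> (1 / t n) * (norm (K (Y - X' n) - K (Y - X)) * norm (g Y) * C)"
      using t(2)[of n] by (intro mult_left_mono C[OF b]) auto
    also have "\<dots> \<le> (1 / t n) * ((M * t n) * G * C)"
    proof (intro mult_left_mono mult_right_mono mult_mono)
      show "norm (K (Y - X' n) - K (Y - X)) \<le> M * t n"
        using lip[OF Y, of "X' n"] X'(2)[of n] t(3)[of n] by simp
      then show "0 \<le> M * t n"
        using norm_ge_zero order_trans by blast
      show "0 \<le> C"
        unfolding C_def by (rule sum_nonneg) simp
    qed (use G[OF Y] t(2)[of n] in auto)
    also have "\<dots> = M * G * C"
      using t(2)[of n] by simp
    finally show "norm ((1 / t n) *\<^sub>R (B b (K (Y - X' n)) (g Y) + (- 1) *\<^sub>R B b (K (Y - X)) (g Y))) \<le> M * G * C" .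
  qed
qed



section \<open>Witt bases\<close>

lemma scaleR_eq_smult: "r *\<^sub>R x = complex_of_real r *s x" for x :: "complex ^ 'n"
  by (simp add: vec_eq_iff complex_eq_iff)

lemma bounded_linear_smult: "bounded_linear (\<lambda>x :: complex ^ 'n. c *s x)"
  by (rule linear_conv_bounded_linear[THEN iffD1])
    (simp add: linear_iff vec_eq_iff algebra_simps)

lemma bounded_bilinear_cmul: "bounded_bilinear (cmul :: 'm::{finite,linorder} cliff \<Rightarrow> _)"
  unfolding bilinear_conv_bounded_bilinear[symmetric] bilinear_def linear_iff
  by (simp add: cmul_distrib scaleR_eq_smult cmul_scale)

lemmas cmul_zero = bounded_bilinear.zero_left[OF bounded_bilinear_cmul] bounded_bilinear.zero_right[OF bounded_bilinear_cmul]
lemmas cmul_minus = bounded_bilinear.minus_left[OF bounded_bilinear_cmul] bounded_bilinear.minus_right[OF bounded_bilinear_cmul]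

definition anticomm :: "'m::{finite,linorder} cliff \<Rightarrow> 'm cliff \<Rightarrow> 'm cliff" where
  "anticomm a b = a \<odot> b + b \<odot> a"

lemma anticomm_linear:
  "anticomm (a + b) c = anticomm a c + anticomm b c" "anticomm c (a + b) = anticomm c a + anticomm c b"
  "anticomm (x *s a) c = x *s anticomm a c" "anticomm c (x *s a) = x *s anticomm c a"
  "anticomm (- a) c = - anticomm a c" "anticomm c (- a) = - anticomm c a"
  by (simp_all add: anticomm_def cmul_distrib cmul_scale cmul_minus)

lemma anticomm_sum_left: "anticomm (sum f S) c = (\<Sum>i\<in>S. anticomm (f i) c)"
  unfolding anticomm_def cmul_sum sum.distrib ..

lemma anticomm_sum_right: "anticomm c (sum f S) = (\<Sum>i\<in>S. anticomm c (f i))"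
  unfolding anticomm_def cmul_sum sum.distrib ..

lemma anticomm_sum:
  "anticomm (\<Sum>j\<in>I. x j *s A j) (\<Sum>k\<in>J. y k *s B k) = (\<Sum>j\<in>I. \<Sum>k\<in>J. (x j * y k) *s anticomm (A j) (B k))"
  unfolding anticomm_sum_left unfolding anticomm_sum_right by (simp add: anticomm_linear mult.commute)

text \<open>In terms of generators the anticommutator of vectors is -2 times their complex bilinear
  product, so every Witt relation becomes arithmetic on two pairs of coefficients.\<close>

lemma anticomm_gen_pairs:
  assumes m: "CARD('m::{finite,linorder}) = 4 * p" and jk: "j \<in> {1..2 * p}" "k \<in> {1..2 * p}"
  shows "anticomm (x1 *s gen (2 * j - 1) + x2 *s gen (2 * j)) (y1 *s gen (2 * k - 1) + y2 *s gen (2 * k))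
    = (if j = k then - 2 * (x1 * y1 + x2 * y2) else 0) *s (cl_one :: 'm cliff)"
proof -
  have r: "2 * j \<in> {1..CARD('m)}" "2 * j - 1 \<in> {1..CARD('m)}" "2 * k \<in> {1..CARD('m)}" "2 * k - 1 \<in> {1..CARD('m)}"
    using jk m by auto
  have ne: "2 * j - 1 = 2 * k - 1 \<longleftrightarrow> j = k" "2 * j \<noteq> 2 * k - 1" "2 * j - 1 \<noteq> 2 * k"
    using jk by (simp; presburger)+
  have "anticomm (gen (2 * j - 1)) (gen (2 * k - 1)) = (if j = k then -2 else 0) *s (cl_one :: 'm cliff)"
    "anticomm (gen (2 * j)) (gen (2 * k)) = (if j = k then -2 else 0) *s (cl_one :: 'm cliff)"
    "anticomm (gen (2 * j - 1)) (gen (2 * k)) = (0 :: 'm cliff)"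
    "anticomm (gen (2 * j)) (gen (2 * k - 1)) = (0 :: 'm cliff)"
    using gen_relations[OF r(2,4)] gen_relations[OF r(1,3)] gen_relations[OF r(2,3)] gen_relations[OF r(1,4)] ne
    unfolding anticomm_def by auto
  then show ?thesis
    unfolding anticomm_linear by (simp add: vec_eq_iff algebra_simps)
qed

lemma witt_gen: "witt k = (- 1/2) *s gen (2 * k - 1) + (\<i>/2) *s gen (2 * k)"
  and wittd_gen: "wittd k = (1/2) *s gen (2 * k - 1) + (\<i>/2) *s gen (2 * k)"
  by (simp_all add: witt_def wittd_def vec_eq_iff algebra_simps)

text \<open>\<open>comb_products\<close> uses nothing else about the two families. Stating the
  relations for an arbitrary pair lets one computation serve the standard and the
  \<open>J\<close>-twisted basis.\<close>

definition witt_dual :: "nat \<Rightarrow> (nat \<Rightarrow> 'm::{finite,linorder} cliff) \<Rightarrow> (nat \<Rightarrow> 'm cliff) \<Rightarrow> bool" where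
  "witt_dual p A B \<longleftrightarrow> (\<forall>j\<in>{1..2 * p}. \<forall>k\<in>{1..2 * p}.
     anticomm (A j) (A k) = 0 \<and> anticomm (B j) (B k) = 0 \<and>
     anticomm (A j) (B k) = (if j = k then cl_one else 0))"

text \<open>The coefficient pairs \<open>(-1/2, \<i>/2)\<close> and \<open>(1/2, \<i>/2)\<close> are
  isotropic, and their mutual bilinear product is -1/2, which the factor -2 turns into 1.\<close>

lemma witt_dual_witt:
  assumes m: "CARD('m::{finite,linorder}) = 4 * p"
  shows "witt_dual p (witt :: nat \<Rightarrow> 'm cliff) wittd"
  unfolding witt_dual_def witt_gen wittd_gen
  by (intro ballI conjI; subst anticomm_gen_pairs[OF m]) (auto simp: vec_eq_iff)

text \<open>The \<open>J\<close>-twisted Witt basis, for which \<open>z\<^sup>J = \<Sum> z\<^sub>k wittJ k\<close> and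
  \<open>z\<^sup>\<dagger>\<^sup>J = \<Sum> z\<^sub>k\<^sup>c wittdJ k\<close>.\<close>

definition wittJ :: "nat \<Rightarrow> 'm::{finite,linorder} cliff" where
  "wittJ k = (if even k then wittd (k - 1) else - wittd (k + 1))"

definition wittdJ :: "nat \<Rightarrow> 'm::{finite,linorder} cliff" where
  "wittdJ k = (if even k then witt (k - 1) else - witt (k + 1))"

lemma wittJ_pairs:
  assumes "1 \<le> j"
  shows "wittJ (2 * j) = wittd (2 * j - 1)" "wittJ (2 * j - 1) = - wittd (2 * j)"
    "wittdJ (2 * j) = witt (2 * j - 1)" "wittdJ (2 * j - 1) = - witt (2 * j)"
  using assms by (auto simp: wittJ_def wittdJ_def)

lemma anticomm_commute: "anticomm a b = anticomm b a"
  by (simp add: anticomm_def add.commute)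

text \<open>The twist exchanges the roles of \<open>witt\<close> and \<open>wittd\<close> and swaps
  the two indices of each pair. The sign depends only on the parity of the index, so it squares away
  on the diagonal, and off the diagonal the anticommutators vanish anyway.\<close>

lemma witt_dual_wittJ:
  assumes m: "CARD('m::{finite,linorder}) = 4 * p"
  shows "witt_dual p (wittJ :: nat \<Rightarrow> 'm cliff) wittdJ"
  unfolding witt_dual_def
proof (intro ballI)
  fix j k assume jk: "j \<in> {1..2 * p}" "k \<in> {1..2 * p}"
  have w: "anticomm (witt j) (witt k) = (0 :: 'm cliff)" "anticomm (wittd j) (wittd k) = (0 :: 'm cliff)"
    "anticomm (wittd j) (witt k) = (if j = k then cl_one else 0 :: 'm cliff)"
    if "j \<in> {1..2 * p}" "k \<in> {1..2 * p}" for j k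
    using witt_dual_witt[OF m] that unfolding witt_dual_def by (auto simp: anticomm_commute[of "wittd j"])
  have \<sigma>: "even l \<Longrightarrow> l - 1 \<in> {1..2 * p}" "odd l \<Longrightarrow> l + 1 \<in> {1..2 * p}" if "l \<in> {1..2 * p}" for l
    using that unfolding atLeastAtMost_iff by presburger+
  have e: "j - 1 = k - 1 \<longleftrightarrow> j = k" "j + 1 = k + 1 \<longleftrightarrow> j = k"
    "even j \<Longrightarrow> odd k \<Longrightarrow> j - 1 \<noteq> k + 1 \<and> j \<noteq> k" "odd j \<Longrightarrow> even k \<Longrightarrow> j + 1 \<noteq> k - 1 \<and> j \<noteq> k"
    using jk unfolding atLeastAtMost_iff by presburger+
  show "anticomm (wittJ j) (wittJ k) = (0 :: 'm cliff) \<and> anticomm (wittdJ j) (wittdJ k) = (0 :: 'm cliff) \<and>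
    anticomm (wittJ j) (wittdJ k) = (if j = k then cl_one else 0 :: 'm cliff)"
    unfolding wittJ_def wittdJ_def
    using \<sigma>[OF jk(1)] \<sigma>[OF jk(2)] e(3,4)
    by (cases "even j"; cases "even k") (simp_all add: anticomm_linear w e(1,2) del: One_nat_def Suc_eq_plus1 add_Suc_right)
qed

text \<open>With \<open>antihol_comb\<close> the common shape of the four vector variables:
  \<open>z\<close> and \<open>z^J\<close> are combinations of the \<open>z_k\<close>, the two
  daggered ones of the conjugates.\<close>

definition hol_comb :: "nat \<Rightarrow> (nat \<Rightarrow> 'm::{finite,linorder} cliff) \<Rightarrow> 'm point \<Rightarrow> 'm cliff" where
  "hol_comb p A w = (\<Sum>k=1..2*p. zc k w *s A k)"

definition antihol_comb :: "nat \<Rightarrow> (nat \<Rightarrow> 'm::{finite,linorder} cliff) \<Rightarrow> 'm point \<Rightarrow> 'm cliff" where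
  "antihol_comb p B w = (\<Sum>k=1..2*p. zcc k w *s B k)"

lemma vec_z_eq: "vec_z p = hol_comb p witt" "vec_zdag p = antihol_comb p wittd"
  "vec_zJ p = hol_comb p wittJ" "vec_zdagJ p = antihol_comb p wittdJ"
proof -
  show "vec_z p = hol_comb p witt" "vec_zdag p = antihol_comb p wittd"
    by (simp_all add: fun_eq_iff vec_z_def vec_zdag_def hol_comb_def antihol_comb_def)
  show "vec_zJ p = hol_comb p wittJ" "vec_zdagJ p = antihol_comb p wittdJ"
    unfolding fun_eq_iff vec_zJ_def vec_zdagJ_def hol_comb_def antihol_comb_def sum_pairs[of _ p]
    by (auto intro!: sum.cong simp: wittJ_pairs simp del: One_nat_def)
qed

lemma zc_linear: "zc k (x + y) = zc k x + zc k y" "zc k (r *\<^sub>R x) = complex_of_real r * zc k x"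
  by (simp_all add: zc_def complex_eq_iff)

lemma bounded_linear_comb: "bounded_linear (hol_comb p A)" "bounded_linear (antihol_comb p A)"
  by (rule linear_conv_bounded_linear[THEN iffD1],
      simp add: linear_iff hol_comb_def antihol_comb_def zcc_def zc_linear scaleR_eq_smult
        vec.scale_left_distrib sum.distrib vec.scale_sum_right)+

lemma sum_zc_zcc:
  fixes w :: "'m::{finite,linorder} point"
  assumes m: "CARD('m) = 4 * p"
  shows "(\<Sum>k=1..2*p. zc k w * zcc k w) = complex_of_real (w \<bullet> w)"
proof -
  have "w \<bullet> w = (\<Sum>b\<in>Basis. (w \<bullet> b)\<^sup>2)"
    by (subst euclidean_inner) (simp add: power2_eq_square)
  also have "\<dots> = (\<Sum>k=1..2*p. (w $ idx (2 * k - 1))\<^sup>2 + (w $ idx (2 * k))\<^sup>2)"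
    unfolding sum_Basis_idx[OF m] by (simp add: inner_axis)
  finally show ?thesis
    by (simp add: zc_def zcc_def complex_mult_cnj)
qed

text \<open>By bilinearity only the diagonal anticommutators survive and leave the sum of
  \<open>zc k w * zcc k w\<close>. A square is half of the anticommutator of an element with itself,
  hence 0 here.\<close>

lemma comb_products:
  fixes w :: "'m::{finite,linorder} point"
  assumes m: "CARD('m) = 4 * p" and AB: "witt_dual p A B"
  shows "hol_comb p A w \<odot> antihol_comb p B w + antihol_comb p B w \<odot> hol_comb p A w
      = complex_of_real (w \<bullet> w) *s cl_one"
    and "hol_comb p A w \<odot> hol_comb p A w = 0" and "antihol_comb p B w \<odot> antihol_comb p B w = 0"
proof -
  have "anticomm (hol_comb p A w) (antihol_comb p B w)
     = (\<Sum>j=1..2*p. \<Sum>k=1..2*p. if k = j then (zc j w * zcc j w) *s cl_one else 0)"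
    unfolding hol_comb_def antihol_comb_def anticomm_sum using AB
    by (intro sum.cong refl) (auto simp: witt_dual_def)
  also have "\<dots> = (\<Sum>j=1..2*p. zc j w * zcc j w) *s cl_one"
    unfolding vec.scale_sum_left by (intro sum.cong refl) (simp add: sum.delta)
  finally show "hol_comb p A w \<odot> antihol_comb p B w + antihol_comb p B w \<odot> hol_comb p A w
      = complex_of_real (w \<bullet> w) *s cl_one"
    unfolding sum_zc_zcc[OF m] anticomm_def .
  have sq: "a \<odot> a = 0" if "anticomm a a = 0" for a :: "'m cliff"
    using that by (simp add: anticomm_def vec_eq_iff)
  show "hol_comb p A w \<odot> hol_comb p A w = 0"
    unfolding hol_comb_def using AB
    by (intro sq) (simp add: anticomm_sum witt_dual_def)
  show "antihol_comb p B w \<odot> antihol_comb p B w = 0"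
    unfolding antihol_comb_def using AB
    by (intro sq) (simp add: anticomm_sum witt_dual_def)
qed

lemma comb_axis:
  assumes m: "CARD('m::{finite,linorder}) = 4 * p" and l: "l \<in> {1..2 * p}"
  shows "hol_comb p A (axis (idx (2 * l - 1)) 1 :: 'm point) = A l"
    "hol_comb p A (axis (idx (2 * l)) 1 :: 'm point) = \<i> *s A l"
    "antihol_comb p A (axis (idx (2 * l - 1)) 1 :: 'm point) = A l"
    "antihol_comb p A (axis (idx (2 * l)) 1 :: 'm point) = (- \<i>) *s A l"
proof -
  have "(\<Sum>k=1..2*p. c k *s A k) = x *s A l"
    if "\<And>k. k \<in> {1..2 * p} \<Longrightarrow> c k = (if k = l then x else 0)" for c x
  proof -
    have "(\<Sum>k=1..2*p. c k *s A k) = (\<Sum>k=1..2*p. if k = l then x *s A l else 0)"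
      using that by (intro sum.cong) auto
    then show ?thesis
      using l by simp
  qed
  note s = this
  show "hol_comb p A (axis (idx (2 * l - 1)) 1 :: 'm point) = A l"
    unfolding hol_comb_def by (subst s[of _ 1]) (simp_all only: zc_axis[OF m _ l] vector_smult_lid)
  show "hol_comb p A (axis (idx (2 * l)) 1 :: 'm point) = \<i> *s A l"
    unfolding hol_comb_def by (subst s[of _ \<i>]) (simp_all only: zc_axis[OF m _ l])
  show "antihol_comb p A (axis (idx (2 * l - 1)) 1 :: 'm point) = A l"
    unfolding antihol_comb_def zcc_def
    by (subst s[of _ 1]) (simp_all only: zc_axis[OF m _ l] vector_smult_lid, auto)
  show "antihol_comb p A (axis (idx (2 * l)) 1 :: 'm point) = (- \<i>) *s A l"
    unfolding antihol_comb_def zcc_def by (subst s[of _ "- \<i>"]) (simp_all only: zc_axis[OF m _ l], auto)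
qed

text \<open>At the two coordinate vectors of the \<open>k\<close>-th coordinate the antiholomorphic
  combination takes the values \<open>B k\<close> and \<open>- \<i> *s B k\<close>, which assembles
  \<open>2 *s d_z k\<close>. Conjugated coefficients thus go with derivatives in \<open>z\<close>,
  and holomorphic ones with derivatives in \<open>z^c\<close>.\<close>

lemma sum_comb_derivative:
  fixes g :: "'m::{finite,linorder} point \<Rightarrow> 'm cliff"
  assumes m: "CARD('m) = 4 * p"
  shows "(\<Sum>b\<in>Basis. antihol_comb p B b \<odot> \<D> g Y b) = 2 *s (\<Sum>k=1..2*p. B k \<odot> d_z k g Y)"
    "(\<Sum>b\<in>Basis. hol_comb p A b \<odot> \<D> g Y b) = 2 *s (\<Sum>k=1..2*p. A k \<odot> d_zc k g Y)"
  unfolding sum_Basis_idx[OF m] vec.scale_sum_right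
  by (auto intro!: sum.cong simp: comb_axis[OF m] d_z_def d_zc_def partial_at_def cmul_scale cmul_distrib cmul_minus
      bounded_bilinear.diff_right[OF bounded_bilinear_cmul] vec_eq_iff simp del: One_nat_def)

lemma dirac_J_eq:
  "dirac_J p g Y = (\<Sum>k=1..2*p. wittdJ k \<odot> d_z k g Y)" "dirac_dagJ p g Y = (\<Sum>k=1..2*p. wittJ k \<odot> d_zc k g Y)"
proof -
  show "dirac_J p g Y = (\<Sum>k=1..2*p. wittdJ k \<odot> d_z k g Y)" "dirac_dagJ p g Y = (\<Sum>k=1..2*p. wittJ k \<odot> d_zc k g Y)"
    unfolding dirac_J_def dirac_dagJ_def sum_pairs[of _ p]
    by (auto intro!: sum.cong simp: wittJ_pairs cmul_minus simp del: One_nat_def)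
qed

lemma hat_form_sums:
  fixes ts :: "('m::{finite,linorder} point) list"
  assumes m: "CARD('m) = 4 * p" and ts: "Suc (length ts) = CARD('m)"
  shows "(\<Sum>k=1..2*p. hat_dz p k ts *s B k)
      = ((- 2 * \<i>) ^ (2 * p) / 2) *s (\<Sum>b\<in>Basis. complex_of_real (vol_form (b # ts)) *s antihol_comb p B b)"
    and "- (\<Sum>k=1..2*p. hat_dzc p k ts *s A k)
      = ((- 2 * \<i>) ^ (2 * p) / 2) *s (\<Sum>b\<in>Basis. complex_of_real (vol_form (b # ts)) *s hol_comb p A b)"
proof -
  define N where "N = (- 2 * \<i>) ^ (2 * p)"
  have sw: "(\<Sum>k=1..2*p. (N / 2 * (\<Sum>b\<in>Basis. complex_of_real (vol_form (b # ts)) * f k b)) *s C k)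
    = (N / 2) *s (\<Sum>b\<in>Basis. complex_of_real (vol_form (b # ts)) *s (\<Sum>k=1..2*p. f k b *s C k))"
    for f :: "nat \<Rightarrow> 'm point \<Rightarrow> complex" and C :: "nat \<Rightarrow> 'm cliff"
    unfolding vec.scale_sum_right sum_distrib_left vec.scale_sum_left
    by (subst sum.swap) (simp add: mult.assoc)
  have "(\<Sum>k=1..2*p. hat_dz p k ts *s B k)
    = (\<Sum>k=1..2*p. (N / 2 * (\<Sum>b\<in>Basis. complex_of_real (vol_form (b # ts)) * zcc k b)) *s B k)"
    by (intro sum.cong refl) (simp only: hat_forms(1)[OF m ts] N_def)
  also have "\<dots> = (N / 2) *s (\<Sum>b\<in>Basis. complex_of_real (vol_form (b # ts)) *s (\<Sum>k=1..2*p. zcc k b *s B k))"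
    by (rule sw)
  finally show "(\<Sum>k=1..2*p. hat_dz p k ts *s B k)
      = ((- 2 * \<i>) ^ (2 * p) / 2) *s (\<Sum>b\<in>Basis. complex_of_real (vol_form (b # ts)) *s antihol_comb p B b)"
    unfolding antihol_comb_def N_def .
  have "- (\<Sum>k=1..2*p. hat_dzc p k ts *s A k) = (\<Sum>k=1..2*p. (- hat_dzc p k ts) *s A k)"
    by (simp add: sum_negf)
  also have "\<dots> = (\<Sum>k=1..2*p. (N / 2 * (\<Sum>b\<in>Basis. complex_of_real (vol_form (b # ts)) * zc k b)) *s A k)"
    by (intro sum.cong refl) (simp only: hat_forms(2)[OF m ts] N_def)
  also have "\<dots> = (N / 2) *s (\<Sum>b\<in>Basis. complex_of_real (vol_form (b # ts)) *s (\<Sum>k=1..2*p. zc k b *s A k))"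
    by (rule sw)
  finally show "- (\<Sum>k=1..2*p. hat_dzc p k ts *s A k)
      = ((- 2 * \<i>) ^ (2 * p) / 2) *s (\<Sum>b\<in>Basis. complex_of_real (vol_form (b # ts)) *s hol_comb p A b)"
    unfolding hol_comb_def N_def .
qed

lemma dsigma_eq:
  "dsigma p ts = (\<Sum>k=1..2*p. hat_dz p k ts *s wittd k)"
  "dsigma_dag p ts = - (\<Sum>k=1..2*p. hat_dzc p k ts *s witt k)"
  "dsigma_J p ts = (\<Sum>k=1..2*p. hat_dz p k ts *s wittdJ k)"
  "dsigma_dagJ p ts = - (\<Sum>k=1..2*p. hat_dzc p k ts *s wittJ k)"
proof -
  show "dsigma p ts = (\<Sum>k=1..2*p. hat_dz p k ts *s wittd k)"
    "dsigma_dag p ts = - (\<Sum>k=1..2*p. hat_dzc p k ts *s witt k)"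
    by (simp_all add: dsigma_def dsigma_dag_def)
  show "dsigma_J p ts = (\<Sum>k=1..2*p. hat_dz p k ts *s wittdJ k)"
    "dsigma_dagJ p ts = - (\<Sum>k=1..2*p. hat_dzc p k ts *s wittJ k)"
    unfolding dsigma_J_def dsigma_dagJ_def sum_pairs[of _ p]
    by (auto intro!: sum.cong simp: wittJ_pairs simp del: One_nat_def)
qed

section \<open>The Cauchy kernels of Hermitian Clifford analysis\<close>

text \<open>Both summands of an integrand as one map, bilinear in the pair of kernel values and in
  \<open>y\<close>. This is the shape required for differentiating in the pole; \<open>N / 2\<close>
  is the factor between the hat forms and the volume form.\<close>

definition kernel_form ::
  "complex \<Rightarrow> ('m point \<Rightarrow> 'm cliff) \<Rightarrow> ('m point \<Rightarrow> 'm cliff) \<Rightarrow> 'm::{finite,linorder} point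
    \<Rightarrow> 'm cliff \<times> 'm cliff \<Rightarrow> 'm cliff \<Rightarrow> 'm cliff" where
  "kernel_form N R1 R2 b k y = (N / 2) *s ((fst k \<odot> R1 b + snd k \<odot> R2 b) \<odot> y)"

lemma bounded_bilinear_kernel_form: "bounded_bilinear (kernel_form N R1 R2 b)"
  unfolding bilinear_conv_bounded_bilinear[symmetric] bilinear_def linear_iff
  by (simp add: kernel_form_def cmul_distrib scaleR_eq_smult cmul_scale vec_eq_iff algebra_simps)

lemma kernel_form_sum:
  "(\<Sum>e\<in>S. c e *s kernel_form N R1 R2 b (u e, v e) y)
    = kernel_form N R1 R2 b (\<Sum>e\<in>S. c e *s u e, \<Sum>e\<in>S. c e *s v e) y"
  by (induction S rule: infinite_finite_induct)
    (simp_all add: kernel_form_def cmul_zero cmul_distrib cmul_scale vec_eq_iff algebra_simps)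

lemma boundary_integral_kernel_form:
  fixes D :: "'m::{finite,linorder} point set"
  assumes D: "open D" "bounded D" "smooth_boundary D"
    and flux: "has_flux D (\<lambda>b Y. kernel_form N R1 R2 b (K1 Y, K2 Y) (g Y)) I"
    and \<sigma>: "\<And>ts. Suc (length ts) = CARD('m) \<Longrightarrow>
        \<sigma>1 ts = (N / 2) *s (\<Sum>b\<in>Basis. complex_of_real (vol_form (b # ts)) *s R1 b)"
      "\<And>ts. Suc (length ts) = CARD('m) \<Longrightarrow>
        \<sigma>2 ts = (N / 2) *s (\<Sum>b\<in>Basis. complex_of_real (vol_form (b # ts)) *s R2 b)"
  shows "boundary_integral D (\<lambda>Y ts. (K1 Y \<odot> \<sigma>1 ts + K2 Y \<odot> \<sigma>2 ts) \<odot> g Y) = I"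
proof (rule boundary_integral_eq_flux[OF D flux])
  fix Y :: "'m point" and ts :: "'m point list"
  assume ts: "Suc (length ts) = CARD('m)"
  show "(K1 Y \<odot> \<sigma>1 ts + K2 Y \<odot> \<sigma>2 ts) \<odot> g Y
      = (\<Sum>b\<in>Basis. vol_form (b # ts) *\<^sub>R kernel_form N R1 R2 b (K1 Y, K2 Y) (g Y))"
    unfolding \<sigma>[OF ts] kernel_form_def fst_conv snd_conv scaleR_eq_smult
    by (simp add: cmul_scale cmul_sum cmul_distrib vec.scale_sum_right vec.scale_right_distrib sum.distrib mult.commute)
qed

lemma sphere_area_unit_ball: "sphere_area TYPE('a::euclidean_space) = DIM('a) * unit_ball_vol DIM('a)"
  by (simp add: sphere_area_def content_cball)

text \<open>Specialises the Cauchy kernel flux to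
  \<open>L w b y = (S1 w \<odot> R1 b + S2 w \<odot> R2 b) \<odot> y\<close>. The scalar
  \<open>l\<close> is kept general so that 1 yields reproduction of \<open>g X\<close> and 0 yields
  a vanishing integral.\<close>

lemma has_flux_kernel_form:
  fixes D :: "'m::{finite,linorder} point set" and g :: "'m point \<Rightarrow> 'm cliff"
  assumes m: "CARD('m) = 4 * p" and D: "open D" "bounded D" "smooth_boundary D" and X: "X \<in> D"
    and \<Omega>: "open \<Omega>" "closure D \<subseteq> \<Omega>" and g: "C1_on \<Omega> g"
    and lin: "bounded_linear S1" "bounded_linear S2" "bounded_linear R1" "bounded_linear R2"
    and alg: "\<And>w. S1 w \<odot> R1 w + S2 w \<odot> R2 w = (complex_of_real (w \<bullet> w) * l) *s cl_one"
    and grad: "\<And>Y. Y \<in> D \<Longrightarrow> (\<Sum>b\<in>Basis. R1 b \<odot> \<D> g Y b) = 0"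
      "\<And>Y. Y \<in> D \<Longrightarrow> (\<Sum>b\<in>Basis. R2 b \<odot> \<D> g Y b) = 0"
  shows "has_flux D (\<lambda>b Y. kernel_form N R1 R2 b
      (kfactor p (Y - X) *s S1 (Y - X), kfactor p (Y - X) *s S2 (Y - X)) (g Y)) ((N * l) *s g X)"
proof -
  let ?m = "DIM('m point)" and ?V = "unit_ball_vol DIM('m point)"
  let ?L = "\<lambda>w b y. (S1 w \<odot> R1 b + S2 w \<odot> R2 b) \<odot> y"
  interpret S1: bounded_linear S1 by fact
  interpret S2: bounded_linear S2 by fact
  interpret R1: bounded_linear R1 by fact
  interpret R2: bounded_linear R2 by fact
  have dim: "?m = 2 * (2 * p)"
    using m by simp
  have flux: "has_flux D (\<lambda>b Y. (1 / norm (Y - X) ^ (2 * (2 * p))) *\<^sub>R ?L (Y - X) b (g Y))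
      ((?m * ?V) *\<^sub>R (l *s g X))"
  proof (rule has_flux_Cauchy_kernel[OF dim D X \<Omega> g])
    show "bounded_bilinear (\<lambda>w. ?L w b)" for b
      unfolding bilinear_conv_bounded_bilinear[symmetric] bilinear_def linear_iff
      by (simp add: S1.add S2.add S1.scale S2.scale cmul_distrib scaleR_eq_smult cmul_scale vec_eq_iff algebra_simps)
    show "bounded_linear (\<lambda>y :: 'm cliff. l *s y)"
      by (rule bounded_linear_smult)
    show "(\<Sum>b\<in>Basis. (w \<bullet> b) *\<^sub>R ?L w b y) = (w \<bullet> w) *\<^sub>R (l *s y)" for w :: "'m point" and y :: "'m cliff"
    proof -
      \<comment> \<open>By linearity the radial contraction of \<open>L\<close> puts
        \<open>w\<close> in both slots, where \<open>alg\<close> applies.\<close>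
      have "R1 w = (\<Sum>b\<in>Basis. (w \<bullet> b) *\<^sub>R R1 b)" "R2 w = (\<Sum>b\<in>Basis. (w \<bullet> b) *\<^sub>R R2 b)"
        using R1.sum[of "\<lambda>b. (w \<bullet> b) *\<^sub>R b" Basis] R2.sum[of "\<lambda>b. (w \<bullet> b) *\<^sub>R b" Basis]
        by (simp_all add: R1.scale R2.scale euclidean_representation)
      then have "?L w w y = (\<Sum>b\<in>Basis. (w \<bullet> b) *\<^sub>R ?L w b y)"
        by (simp add: cmul_sum cmul_distrib cmul_scale scaleR_eq_smult sum.distrib vec.scale_right_distrib)
      moreover have "?L w w y = (w \<bullet> w) *\<^sub>R (l *s y)"
        unfolding alg by (simp add: cmul_scale cmul_one scaleR_eq_smult)
      ultimately show ?thesis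
        by simp
    qed
    show "(\<Sum>b\<in>Basis. ?L w b (\<D> g Y b)) = 0" if "Y \<in> D" for w Y
    proof -
      \<comment> \<open>Associativity moves the multipliers depending on \<open>w\<close> to the
        outside and leaves the two first-order equations for \<open>g\<close>.\<close>
      have "(\<Sum>b\<in>Basis. ?L w b (\<D> g Y b))
          = S1 w \<odot> (\<Sum>b\<in>Basis. R1 b \<odot> \<D> g Y b)
            + S2 w \<odot> (\<Sum>b\<in>Basis. R2 b \<odot> \<D> g Y b)"
        by (simp add: cmul_sum cmul_distrib cmul_assoc sum.distrib)
      then show ?thesis
        by (simp add: grad[OF that] cmul_zero)
    qed
  qed
  let ?c = "2 / sphere_area TYPE('m point)"
  \<comment> \<open>The sphere area in the kernel cancels the mass of the flux; the remaining 2
    cancels the denominator of \<open>N / 2\<close>.\<close>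
  have c: "?c * (?m * ?V) = 2"
  proof -
    have "0 < ?m * ?V"
      by (intro mult_pos_pos unit_ball_vol_pos) auto
    moreover have "2 / x * x = 2" if "0 < x" for x :: real
      using that by simp
    ultimately show ?thesis
      unfolding sphere_area_unit_ball by blast
  qed
  have "has_flux D (\<lambda>b Y. (N / 2 * complex_of_real ?c) *s
       ((1 / norm (Y - X) ^ (2 * (2 * p))) *\<^sub>R ?L (Y - X) b (g Y)))
      ((N / 2 * complex_of_real ?c) *s ((?m * ?V) *\<^sub>R (l *s g X)))"
    by (rule has_flux_bounded_linear[OF bounded_linear_smult flux])
  also have "(\<lambda>b Y. (N / 2 * complex_of_real ?c) *s
       ((1 / norm (Y - X) ^ (2 * (2 * p))) *\<^sub>R ?L (Y - X) b (g Y)))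
    = (\<lambda>b Y. kernel_form N R1 R2 b
      (kfactor p (Y - X) *s S1 (Y - X), kfactor p (Y - X) *s S2 (Y - X)) (g Y))"
    by (simp add: fun_eq_iff kernel_form_def kfactor_def scaleR_eq_smult cmul_scale cmul_distrib
        vec.scale_right_distrib ac_simps)
  also have "(N / 2 * complex_of_real ?c) *s ((?m * ?V) *\<^sub>R (l *s g X)) = (N * l) *s g X"
  proof -
    have "(N / 2 * complex_of_real ?c) *s ((?m * ?V) *\<^sub>R (l *s g X))
      = (N / 2 * complex_of_real (?c * (?m * ?V)) * l) *s g X"
      by (simp only: scaleR_eq_smult vector_smult_assoc of_real_mult mult.assoc)
    then show ?thesis
      unfolding c by simp
  qed
  finally show ?thesis .
qed

section \<open>Euler derivatives of the kernels\<close>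

lemma C1_on_Pair:
  assumes f: "C1_on S f" and g: "C1_on S g"
  shows "C1_on S (\<lambda>x. (f x, g x))"
  by (rule C1_onI[OF has_derivative_Pair[OF C1_on_has_derivative[OF f] C1_on_has_derivative[OF g]]], assumption, assumption)
    (intro continuous_on_Pair C1_on_continuous_derivative[OF f] C1_on_continuous_derivative[OF g])

text \<open>The even exponent turns \<open>norm w ^ (4 * p)\<close> into a power of
  \<open>w \<bullet> w\<close>, so differentiating the norm is avoided.\<close>

lemma C1_on_kfactor:
  fixes S :: "'m::{finite,linorder} point \<Rightarrow> 'm cliff"
  assumes "bounded_linear S"
  shows "C1_on (- {0}) (\<lambda>w. kfactor p w *s S w)"
proof -
  let ?c = "2 / sphere_area TYPE('m point)"
  have r: "C1_on (- {0}) (\<lambda>s::real. ?c / s ^ (2 * p))"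
  proof (rule C1_on_real)
    show "((\<lambda>s. ?c / s ^ (2 * p)) has_real_derivative
        (0 * s ^ (2 * p) - ?c * (real (2 * p) * s ^ (2 * p - Suc 0))) / (s ^ (2 * p) * s ^ (2 * p))) (at s)"
      if "s \<in> - {0}" for s
      by (rule DERIV_divide[OF DERIV_const DERIV_pow]) (use that in simp)
    show "continuous_on (- {0}) (\<lambda>s::real.
        (0 * s ^ (2 * p) - ?c * (real (2 * p) * s ^ (2 * p - Suc 0))) / (s ^ (2 * p) * s ^ (2 * p)))"
      by (intro continuous_intros) simp
  qed
  have "C1_on (- {0}) (\<lambda>w :: 'm point. (?c / (w \<bullet> w) ^ (2 * p)) *\<^sub>R S w)"
    by (intro C1_on_scaleR C1_on_compose[OF r] C1_on_inner C1_on_id C1_on_linear assms) auto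
  also have "(\<lambda>w :: 'm point. (?c / (w \<bullet> w) ^ (2 * p)) *\<^sub>R S w) = (\<lambda>w. kfactor p w *s S w)"
  proof -
    have "norm w ^ (4 * p) = (w \<bullet> w) ^ (2 * p)" for w :: "'m point"
      by (simp add: power2_norm_eq_inner[symmetric] flip: power_mult)
    then show ?thesis
      by (simp add: kfactor_def scaleR_eq_smult fun_eq_iff)
  qed
  finally show ?thesis .
qed

text \<open>The Euler operator is a combination of the derivatives in \<open>z_l^c\<close>, each of
  which is half the sum over \<open>b\<close> of \<open>zc l b\<close> times the derivative along
  \<open>b\<close>. This is the resulting coefficient of the derivative along \<open>b\<close>; the
  index shift picks the partner coordinate, with its sign.\<close>

definition euler_coeff :: "nat \<Rightarrow> 'm::{finite,linorder} point \<Rightarrow> 'm point \<Rightarrow> complex" where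
  "euler_coeff p X b = (\<Sum>l=1..2*p. (if even l then zc (l - 1) X else - zc (l + 1) X) / 2 * zc l b)"

lemma euler_eq_frechet:
  fixes X :: "'m::{finite,linorder} point"
  assumes m: "CARD('m) = 4 * p"
  shows "euler p F X = (\<Sum>b\<in>Basis. euler_coeff p X b *s \<D> F X b)"
proof -
  define q where "q l = (if even l then zc (l - 1) X else - zc (l + 1) X)" for l
  have c: "euler_coeff p X (axis (idx (2 * k - 1)) 1) = q k / 2"
    "euler_coeff p X (axis (idx (2 * k)) 1) = q k / 2 * \<i>" if k: "k \<in> {1..2 * p}" for k
  proof -
    have s: "(\<Sum>l=1..2*p. q l / 2 * y l) = q k / 2 * x" if "\<And>l. l \<in> {1..2*p} \<Longrightarrow> y l = (if l = k then x else 0)" for x y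
    proof -
      have "(\<Sum>l=1..2*p. q l / 2 * y l) = (\<Sum>l=1..2*p. if l = k then q k / 2 * x else 0)"
        using that by (intro sum.cong) auto
      then show ?thesis
        using k by simp
    qed
    show "euler_coeff p X (axis (idx (2 * k - 1)) 1) = q k / 2"
      "euler_coeff p X (axis (idx (2 * k)) 1) = q k / 2 * \<i>"
      unfolding euler_coeff_def q_def[symmetric]
      using s[of "\<lambda>l. zc l (axis (idx (2 * k - 1)) 1 :: 'm point)" 1]
        s[of "\<lambda>l. zc l (axis (idx (2 * k)) 1 :: 'm point)" \<i>] zc_axis[OF m _ k] by auto
  qed
  have "(\<Sum>b\<in>Basis. euler_coeff p X b *s \<D> F X b) = (\<Sum>k=1..2*p. q k *s d_zc k F X)"
    unfolding sum_Basis_idx[OF m]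
    by (intro sum.cong refl) (simp only: c, simp add: d_zc_def partial_at_def vec_eq_iff algebra_simps)
  also have "\<dots> = euler p F X"
  proof -
    have "q (2 * j) = zc (2 * j - 1) X" "q (2 * j - 1) = - zc (2 * j) X" if "j \<in> {1..p}" for j
      using that by (auto simp: q_def)
    then show ?thesis
      unfolding euler_def sum_pairs[of _ p] by (auto intro!: sum.cong simp del: One_nat_def)
  qed
  finally show ?thesis ..
qed

text \<open>The flux formula with value \<open>M *s g Z\<close> holds for all poles \<open>Z\<close>
  in \<open>D\<close>, so it can be differentiated along each coordinate vector at \<open>X\<close>.
  Combined with the coefficients of the Euler operator, the value becomes a multiple of the Euler
  derivative of \<open>g\<close>, which is 0.\<close>

lemma has_flux_euler_kernel:
  fixes D :: "'m::{finite,linorder} point set" and g :: "'m point \<Rightarrow> 'm cliff"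
  assumes m: "CARD('m) = 4 * p" and D: "open D" "bounded D" and X: "X \<in> D"
    and \<Omega>: "open \<Omega>" "closure D \<subseteq> \<Omega>" and g: "C1_on \<Omega> g"
    and lin: "bounded_linear S1" "bounded_linear S2"
    and flux: "\<And>Z. Z \<in> D \<Longrightarrow> has_flux D (\<lambda>b Y. kernel_form N R1 R2 b
      (kfactor p (Y - Z) *s S1 (Y - Z), kfactor p (Y - Z) *s S2 (Y - Z)) (g Y)) (M *s g Z)"
    and eg: "euler p g X = 0"
  shows "has_flux D (\<lambda>b Y. kernel_form N R1 R2 b
      (euler p (\<lambda>Z. kfactor p (Y - Z) *s S1 (Y - Z)) X, euler p (\<lambda>Z. kfactor p (Y - Z) *s S2 (Y - Z)) X) (g Y)) 0"
proof -
  let ?K1 = "\<lambda>w. kfactor p w *s S1 w" and ?K2 = "\<lambda>w. kfactor p w *s S2 w"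
  let ?c = "euler_coeff p X"
  have K1: "C1_on (- {0}) ?K1" and K2: "C1_on (- {0}) ?K2"
    by (intro C1_on_kfactor lin)+
  have K: "C1_on (- {0}) (\<lambda>w. (?K1 w, ?K2 w))"
    by (intro C1_on_Pair K1 K2)
  have X\<Omega>: "X \<in> \<Omega>"
    using X \<Omega>(2) closure_subset by blast
  have gc: "continuous_on (frontier D) g"
    using \<Omega>(2) by (intro continuous_on_subset[OF C1_on_continuous[OF g]]) (auto simp: frontier_def)
  have I: "((\<lambda>Z. M *s g Z) has_derivative (\<lambda>h. M *s \<D> g X h)) (at X)"
    by (rule bounded_linear.has_derivative[OF bounded_linear_smult C1_on_has_derivative[OF g X\<Omega>]])
  have "has_flux D (\<lambda>b Y. kernel_form N R1 R2 b (\<D> (\<lambda>Z. (?K1 (Y - Z), ?K2 (Y - Z))) X e) (g Y))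
      (M *s \<D> g X e)" if "e \<in> Basis" for e
    by (rule has_flux_kernel_derivative[OF D X K bounded_bilinear_kernel_form gc flux I]) (use that in auto)
  then have "has_flux D (\<lambda>b Y. \<Sum>e\<in>Basis. ?c e *s kernel_form N R1 R2 b
      (\<D> (\<lambda>Z. (?K1 (Y - Z), ?K2 (Y - Z))) X e) (g Y))
      (\<Sum>e\<in>Basis. ?c e *s (M *s \<D> g X e))"
    by (intro has_flux_sum has_flux_bounded_linear[OF bounded_linear_smult])
  also have "(\<Sum>e\<in>Basis. ?c e *s (M *s \<D> g X e)) = M *s euler p g X"
    unfolding euler_eq_frechet[OF m] vec.scale_sum_right by (simp add: mult.commute)
  also have "\<dots> = 0"
    by (simp add: eg)
  finally show ?thesis
  proof (rule has_flux_cong[OF D(1)])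
    fix b Y :: "'m point" assume "Y \<in> frontier D"
    \<comment> \<open>At a frontier point the pole is avoided, so both kernels are differentiable
      there and the derivative of the pair is the pair of derivatives.\<close>
    then have "Y - X \<in> - {0}"
      using X D(1) by (auto simp: frontier_def interior_open)
    have shift: "((\<lambda>Z. Y - Z) has_derivative (\<lambda>h. - h)) (at X)"
      by (auto intro!: derivative_eq_intros)
    have d: "((\<lambda>Z. F (Y - Z)) has_derivative \<D> (\<lambda>Z. F (Y - Z)) X) (at X)"
      if "C1_on (- {0}) F" for F :: "'m point \<Rightarrow> 'm cliff"
      using has_derivative_compose[OF shift C1_on_has_derivative[OF that \<open>Y - X \<in> - {0}\<close>]]
        frechet_derivative_works differentiableI by blast
    have "\<D> (\<lambda>Z. (?K1 (Y - Z), ?K2 (Y - Z))) X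
      = (\<lambda>e. (\<D> (\<lambda>Z. ?K1 (Y - Z)) X e, \<D> (\<lambda>Z. ?K2 (Y - Z)) X e))"
      by (rule frechet_derivative_at[OF has_derivative_Pair[OF d[OF K1] d[OF K2]], symmetric])
    then show "(\<Sum>e\<in>Basis. ?c e *s kernel_form N R1 R2 b
        (\<D> (\<lambda>Z. (?K1 (Y - Z), ?K2 (Y - Z))) X e) (g Y))
      = kernel_form N R1 R2 b (euler p (\<lambda>Z. ?K1 (Y - Z)) X, euler p (\<lambda>Z. ?K2 (Y - Z)) X) (g Y)"
      by (simp only: kernel_form_sum euler_eq_frechet[OF m])
  qed
qed

theorem theorem1:
  fixes p :: nat
    and D \<Omega> :: "('m::{finite,linorder} point) set"
    and g :: "'m point \<Rightarrow> 'm cliff"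
    and X :: "'m point"
  assumes "CARD('m) = 4 * p"
    and "open D" "connected D" "bounded D" "smooth_boundary D"
    and "open \<Omega>" "closure D \<subseteq> \<Omega>"
    and "osp_monogenic p \<Omega> g"
    and "X \<in> interior D"
  shows "g X = (1 / (- 2 * \<i>) ^ (2 * p)) *s boundary_integral D
           (\<lambda>Y ts. (E p (Y - X) \<odot> dsigma p ts + Edag p (Y - X) \<odot> dsigma_dag p ts) \<odot> g Y) \<and>
         g X = (1 / (- 2 * \<i>) ^ (2 * p)) *s boundary_integral D
           (\<lambda>Y ts. (EJ p (Y - X) \<odot> dsigma_J p ts + EdagJ p (Y - X) \<odot> dsigma_dagJ p ts) \<odot> g Y) \<and>
         0 = boundary_integral D (\<lambda>Y ts. Edag p (Y - X) \<odot> dsigma p ts \<odot> g Y) \<and>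
         0 = boundary_integral D (\<lambda>Y ts. EJ p (Y - X) \<odot> dsigma_dagJ p ts \<odot> g Y) \<and>
         0 = boundary_integral D
           (\<lambda>Y ts. (euler p (\<lambda>Z. E p (Y - Z)) X \<odot> dsigma p ts
                  + euler p (\<lambda>Z. Edag p (Y - Z)) X \<odot> dsigma_dag p ts) \<odot> g Y) \<and>
         0 = boundary_integral D
           (\<lambda>Y ts. (euler p (\<lambda>Z. EJ p (Y - Z)) X \<odot> dsigma_J p ts
                  + euler p (\<lambda>Z. EdagJ p (Y - Z)) X \<odot> dsigma_dagJ p ts) \<odot> g Y)"
proof -
  note m = assms(1)
  note D = assms(2,4,5)
  note \<Omega> = assms(6,7)
  define N where "N = (- 2 * \<i>) ^ (2 * p)"
  have N: "N \<noteq> 0"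
    by (simp add: N_def)
  have X: "X \<in> D"
    using assms(2,9) by (simp add: interior_open)
  have D\<Omega>: "Y \<in> \<Omega>" if "Y \<in> D" for Y
    using that \<Omega>(2) closure_subset by blast
  have g: "C1_on \<Omega> g"
    and mono: "\<And>Y. Y \<in> \<Omega> \<Longrightarrow> dirac p g Y = 0 \<and> dirac_dag p g Y = 0 \<and> dirac_J p g Y = 0 \<and>
      dirac_dagJ p g Y = 0 \<and> euler p g Y = 0"
    using assms(8) unfolding osp_monogenic_def Ck_on_1_iff by blast+
  have grad: "(\<Sum>b\<in>Basis. vec_zdag p b \<odot> \<D> g Y b) = 0"
    "(\<Sum>b\<in>Basis. vec_z p b \<odot> \<D> g Y b) = 0"
    "(\<Sum>b\<in>Basis. vec_zdagJ p b \<odot> \<D> g Y b) = 0"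
    "(\<Sum>b\<in>Basis. vec_zJ p b \<odot> \<D> g Y b) = 0" if "Y \<in> D" for Y
    using mono[OF D\<Omega>[OF that]]
    unfolding vec_z_eq sum_comb_derivative[OF m] dirac_J_eq dirac_def dirac_dag_def by simp_all
  have lin: "bounded_linear (vec_z p :: 'm point \<Rightarrow> 'm cliff)" "bounded_linear (vec_zdag p :: 'm point \<Rightarrow> 'm cliff)"
    "bounded_linear (vec_zJ p :: 'm point \<Rightarrow> 'm cliff)" "bounded_linear (vec_zdagJ p :: 'm point \<Rightarrow> 'm cliff)"
    unfolding vec_z_eq by (rule bounded_linear_comb)+
  note prod = comb_products[OF m witt_dual_witt[OF m], folded vec_z_eq]
    comb_products[OF m witt_dual_wittJ[OF m], folded vec_z_eq]
  note flux = has_flux_kernel_form[OF m D _ \<Omega> g, where N = N]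
  \<comment> \<open>Stated for every pole \<open>Z\<close>, because the Euler identities
    differentiate the formula in the pole. The form \<open>dsigma\<close> corresponds to
    \<open>vec_zdag\<close> and \<open>dsigma_dag\<close> to \<open>vec_z\<close>, so the
    contraction is the full anticommutator and \<open>l = 1\<close>.\<close>
  have 1: "has_flux D (\<lambda>b Y. kernel_form N (vec_zdag p) (vec_z p) b (E p (Y - Z), Edag p (Y - Z)) (g Y)) (N *s g Z)"
    if "Z \<in> D" for Z
    using flux[OF that lin(1,2,2,1), of 1] prod(1) grad unfolding E_def Edag_def by simp
  have 2: "has_flux D (\<lambda>b Y. kernel_form N (vec_zdagJ p) (vec_zJ p) b (EJ p (Y - Z), EdagJ p (Y - Z)) (g Y)) (N *s g Z)"
    if "Z \<in> D" for Z
    using flux[OF that lin(3,4,4,3), of 1] prod(4) grad unfolding EJ_def EdagJ_def by simp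
  \<comment> \<open>Now \<open>vec_zdag\<close> stands in both slots and its square is 0, so
    \<open>l = 0\<close>; the second summand is filled with zero maps.\<close>
  have 3: "has_flux D (\<lambda>b Y. kernel_form N (vec_zdag p) (\<lambda>b. 0) b (Edag p (Y - X), 0) (g Y)) 0"
    using flux[OF X lin(2) bounded_linear_zero lin(2) bounded_linear_zero, of 0] prod(3) grad
    unfolding Edag_def by (simp add: cmul_zero)
  \<comment> \<open>The form \<open>dsigma_dagJ\<close> corresponds to \<open>vec_zJ\<close>, the
    vector variable of \<open>EJ\<close>, so again a square appears.\<close>
  have 4: "has_flux D (\<lambda>b Y. kernel_form N (vec_zJ p) (\<lambda>b. 0) b (EJ p (Y - X), 0) (g Y)) 0"
    using flux[OF X lin(3) bounded_linear_zero lin(3) bounded_linear_zero, of 0] prod(5) grad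
    unfolding EJ_def by (simp add: cmul_zero)
  have eg: "euler p g X = 0"
    using mono D\<Omega> X by blast
  note euler = has_flux_euler_kernel[OF m D(1,2) X \<Omega> g _ _ _ eg]
  have 5: "has_flux D (\<lambda>b Y. kernel_form N (vec_zdag p) (vec_z p) b
      (euler p (\<lambda>Z. E p (Y - Z)) X, euler p (\<lambda>Z. Edag p (Y - Z)) X) (g Y)) 0"
    using euler[OF lin(1,2) 1[unfolded E_def Edag_def]] unfolding E_def Edag_def .
  have 6: "has_flux D (\<lambda>b Y. kernel_form N (vec_zdagJ p) (vec_zJ p) b
      (euler p (\<lambda>Z. EJ p (Y - Z)) X, euler p (\<lambda>Z. EdagJ p (Y - Z)) X) (g Y)) 0"
    using euler[OF lin(3,4) 2[unfolded EJ_def EdagJ_def]] unfolding EJ_def EdagJ_def .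
  note \<sigma> = hat_form_sums(1)[OF m, of _ wittd, folded dsigma_eq vec_z_eq N_def]
    hat_form_sums(2)[OF m, of _ witt, folded dsigma_eq vec_z_eq N_def]
    hat_form_sums(1)[OF m, of _ wittdJ, folded dsigma_eq vec_z_eq N_def]
    hat_form_sums(2)[OF m, of _ wittJ, folded dsigma_eq vec_z_eq N_def]
  note bi = boundary_integral_kernel_form[OF D]
  \<comment> \<open>The missing second form, written in the shape in which a form is
    expected.\<close>
  have zero: "(0 :: 'm cliff) = (N / 2) *s (\<Sum>b\<in>Basis. complex_of_real (vol_form (b # ts)) *s 0)" for ts
    by simp
  have "boundary_integral D (\<lambda>Y ts. (E p (Y - X) \<odot> dsigma p ts + Edag p (Y - X) \<odot> dsigma_dag p ts) \<odot> g Y) = N *s g X"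
    by (rule bi[OF 1[OF X] \<sigma>(1,2)])
  moreover have "boundary_integral D
      (\<lambda>Y ts. (EJ p (Y - X) \<odot> dsigma_J p ts + EdagJ p (Y - X) \<odot> dsigma_dagJ p ts) \<odot> g Y) = N *s g X"
    by (rule bi[OF 2[OF X] \<sigma>(3,4)])
  moreover have "boundary_integral D (\<lambda>Y ts. Edag p (Y - X) \<odot> dsigma p ts \<odot> g Y) = 0"
    using bi[OF 3 \<sigma>(1) zero] by (simp add: cmul_zero)
  moreover have "boundary_integral D (\<lambda>Y ts. EJ p (Y - X) \<odot> dsigma_dagJ p ts \<odot> g Y) = 0"
    using bi[OF 4 \<sigma>(4) zero] by (simp add: cmul_zero)
  moreover have "boundary_integral D
           (\<lambda>Y ts. (euler p (\<lambda>Z. E p (Y - Z)) X \<odot> dsigma p ts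
                  + euler p (\<lambda>Z. Edag p (Y - Z)) X \<odot> dsigma_dag p ts) \<odot> g Y) = 0"
    by (rule bi[OF 5 \<sigma>(1,2)])
  moreover have "boundary_integral D
           (\<lambda>Y ts. (euler p (\<lambda>Z. EJ p (Y - Z)) X \<odot> dsigma_J p ts
                  + euler p (\<lambda>Z. EdagJ p (Y - Z)) X \<odot> dsigma_dagJ p ts) \<odot> g Y) = 0"
    by (rule bi[OF 6 \<sigma>(3,4)])
  ultimately show ?thesis
    using N unfolding N_def[symmetric] by simp
qed

end
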